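(* Let $\Omega\subset\mathbb{R}^2$ be a connected open set with coordinates $(R^1,R^2)$, $\partial_i=\partial/\partial R^i$. Let $p,V,W:\Omega\to\mathbb{R}$ be smooth functions satisfying $$\partial_2^3p-2W\partial_2p-p\,\partial_2W=0,\qquad \partial_1W=0,\qquad \partial_2V=0 .$$ Let $\psi:\Omega\to\mathbb{C}^4$ be a smooth map satisfying (componentwise) $$\partial_1^2\psi=-ip\,\partial_2\psi+\tfrac12(V+i\,\partial_2p)\,\psi,\qquad \partial_2^2\psi=\tfrac12W\,\psi ,$$ and normalized, at every point of $\Omega$, by $$(\psi,\partial_1\partial_2\psi)=(\partial_1\partial_2\psi,\psi)=-1,\quad (\partial_1\psi,\partial_2\psi)=(\partial_2\psi,\partial_1\psi)=1,$$ all other pseudo-Hermitian products $(\cdot,\cdot)$ among $\psi,\partial_1\psi,\partial_2\psi,\partial_1\partial_2\psi$ being zero, and by $\det(\psi,\partial_1\psi,\partial_2\psi,\partial_1\partial_2\psi)=1$. Define the real vectors in $\Lambda^2(\mathbb{C}^4)\cong\mathbb{C}^6$ $$\mathbf U=i\,\psi\wedge\partial_1\psi-i\,\overline{\psi\wedge\partial_1\psi},\qquad \mathbf V=\psi\wedge\partial_2\psi+\overline{\psi\wedge\partial_2\psi}.$$ Then $\mathbf U$ and $\mathbf V$ have zero norm: $(\mathbf U,\mathbf U)=(\mathbf V,\mathbf V)=0$. Moreover, the triple $\mathbf U,\partial_2\mathbf U,\partial_2^2\mathbf U$ is orthogonal to the triple $\mathbf V,\partial_1\mathbf V,\partial_1^2\mathbf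 V$ (every vector of the first triple is orthogonal to every vector of the second). Hence, $\mathbf U$ and $\mathbf V$ are the curvature spheres of a surface with curvature line coordinates $R^1,R^2$. This surface is a canal surface, since $\partial_2\mathbf V=0$. Conversely, any canal surface can be obtained locally by this construction; that is, near each point of a canal surface there exist curvature line coordinates $(R^1,R^2)$ ranging over a connected open set $\Omega\subset\mathbb{R}^2$, smooth functions $p,V,W:\Omega\to\mathbb{R}$ satisfying $\partial_2^3p-2W\partial_2p-p\,\partial_2W=0$, $\partial_1W=0$, $\partial_2V=0$, and a smooth map $\psi:\Omega\to\mathbb{C}^4$ satisfying $\partial_1^2\psi=-ip\,\partial_2\psi+\tfrac12(V+i\,\partial_2p)\,\psi$ and $\partial_2^2\psi=\tfrac12W\,\psi$, normalized at every point of $\Omega$ by $(\psi,\partial_1\partial_2\psi)=(\partial_1\partial_2\psi,\psi)=-1$, $(\partial_1\psi,\partial_2\psi)=(\partial_2\psi,\partial_1\psi)=1$, all other pseudo-Hermitian products among $\psi,\partial_1\psi,\partial_2\psi,\partial_1\partial_2\psi$ being zero, and by $\det(\psi,\partial_1\psi,\partial_2\psi,\partial_1\partial_2\psi)=1$, such that the curvature spheres of the canal surface are, up to scale, $\mathbf U=i\,\psi\wedge\partial_1\psi-i\,\overline{\psi\wedge\partial_1\psi}$ and $\mathbf V=\psi\wedge\partial_2\psi+\overline{\psi\wedge\partial_2\psi}$.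
   Context: Pseudo-Hermitian product on $\mathbb{C}^4$ (signature $(2,2)$): for $\mathbf a=(a^0,\dots,a^3)$, $\mathbf b=(b^0,\dots,b^3)$, $$(\mathbf a,\mathbf b)=-a^0\bar b^3+a^1\bar b^2+a^2\bar b^1-a^3\bar b^0 .$$ Wedge product, identifying $\Lambda^2(\mathbb{C}^4)$ with $\mathbb{C}^6$: with $p_{ij}=a^ib^j-a^jb^i$, $\mathbf a\wedge\mathbf b=(y^0,\dots,y^5)$, where $$y^0=\tfrac12(p_{02}-p_{31}),\quad y^1=\tfrac12(p_{02}+p_{31}),\quad y^2=\tfrac12(p_{03}+p_{12}),$$ $$y^3=\tfrac1{2i}(p_{03}-p_{12}),\quad y^4=\tfrac1{2i}(p_{01}-p_{23}),\quad y^5=\tfrac1{2i}(p_{01}+p_{23}).$$ Complex conjugation on $\Lambda^2(\mathbb{C}^4)$ is componentwise in $(y^0,\dots,y^5)$, and "real" means all $y^j$ are real. Pseudo-Hermitian product on $\Lambda^2(\mathbb{C}^4)$ (signature $(4,2)$): $$(y,Y)=-y^0\bar Y^0+y^1\bar Y^1+y^2\bar Y^2+y^3\bar Y^3+y^4\bar Y^4-y^5\bar Y^5 ,$$ which satisfies $(\mathbf a\wedge\mathbf b,\mathbf A\wedge\mathbf B)=\frac12\big((\mathbf a,\mathbf B)(\mathbf b,\mathbf A)-(\mathbf a,\mathbf A)(\mathbf b,\mathbf B)\big)$. On real vectors it is the Lie quadratic form $-y_0^2+y_1^2+y_2^2+y_3^2+y_4^2-y_5^2$ on $\mathbb{R}^6$.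 Here $\det(\mathbf a,\mathbf b,\mathbf A,\mathbf B)$ is the determinant of the $4\times4$ matrix with rows $\mathbf a,\mathbf b,\mathbf A,\mathbf B$. Lie sphere geometry: an oriented sphere in $E^3$ with center $\mathbf c$ and (signed) radius $R$ is represented by the point of the Lie quadric $-y_0^2+y_1^2+y_2^2+y_3^2+y_4^2-y_5^2=0$ with homogeneous hexaspherical coordinates $\left(\frac{1+\mathbf c^2-R^2}{2},\frac{1-\mathbf c^2+R^2}{2},\mathbf c,R\right)$. Null vectors of $\mathbb{R}^6$ are regarded as (generalized) oriented spheres up to nonzero scale, and two spheres are in oriented contact iff their vectors are orthogonal. Maps $\mathbf U,\mathbf V:\Omega\to\mathbb{R}^6$ are called the curvature spheres of a surface with curvature line coordinates $R^1,R^2$ (surface understood in the sense of Lie sphere geometry, i.e. as an immersed Legendre surface, the common envelope of the two families of spheres) if at each point $(\mathbf U,\mathbf U)=(\mathbf U,\mathbf V)=(\mathbf V,\mathbf V)=0$, $\partial_1\mathbf U\in\mathrm{span}(\mathbf U,\mathbf V)$, $\partial_2\mathbf V\in\mathrm{span}(\mathbf U,\mathbf V)$, and $\mathbf U,\mathbf V,\partial_2\mathbf U,\partial_1\mathbf V$ are linearly independent. For a surface in $E^3$ with radius vector $\mathbf r$, unit normal $\mathbf n$, and radii of principal curvature $w^1\ne w^2$ with $\partial_i\mathbf r=w^i\partial_i\mathbf n$, these are, up to scale, the spheres of radii $w^i$ centered at $\mathbf r-w^i\mathbf n$. A canal surface is a surface (in this sense) for which one of the two families of curvature spheres is constant along its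 curvature lines; labelling the coordinates so that this is the family $\mathbf V$, this means that the sphere (null line) $[\mathbf V]$ does not depend on $R^2$. *)

theory Defs
  imports "HOL-Analysis.Analysis"
begin

section \<open>Calculus on the coordinate plane\<close>

definition d1 :: "(real \<times> real \<Rightarrow> 'a::real_normed_vector) \<Rightarrow> real \<times> real \<Rightarrow> 'a" where
  "d1 f x = vector_derivative (\<lambda>s. f (s, snd x)) (at (fst x))"

definition d2 :: "(real \<times> real \<Rightarrow> 'a::real_normed_vector) \<Rightarrow> real \<times> real \<Rightarrow> 'a" where
  "d2 f x = vector_derivative (\<lambda>t. f (fst x, t)) (at (snd x))"

text \<open>For open \<open>S\<close>, \<open>C_on k S f\<close> says that \<open>f\<close> is of class \<open>C\<^sup>k\<close> on \<open>S\<close>.\<close>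

primrec C_on :: "nat \<Rightarrow> 'a::real_normed_vector set \<Rightarrow> ('a \<Rightarrow> 'b::real_normed_vector) \<Rightarrow> bool" where
  "C_on 0 S f \<longleftrightarrow> continuous_on S f"
| "C_on (Suc k) S f \<longleftrightarrow>
     (\<forall>x\<in>S. f differentiable (at x)) \<and> (\<forall>v. C_on k S (\<lambda>x. frechet_derivative f (at x) v))"

definition smooth_on :: "'a::real_normed_vector set \<Rightarrow> ('a \<Rightarrow> 'b::real_normed_vector) \<Rightarrow> bool" where
  "smooth_on S f \<longleftrightarrow> (\<forall>k. C_on k S f)"

definition diffeo_on :: "'a::real_normed_vector set \<Rightarrow> ('a \<Rightarrow> 'b::real_normed_vector) \<Rightarrow> bool" where
  "diffeo_on S \<phi> \<longleftrightarrow> open S \<and> open (\<phi> ` S) \<and> inj_on \<phi> S \<and>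
     smooth_on S \<phi> \<and> smooth_on (\<phi> ` S) (inv_into S \<phi>)"

section \<open>The pseudo-Hermitian spaces\<close>

text \<open>
  The elements of the index type \<open>4\<close> are \<open>0, 1, 2, 3\<close> (as \<open>4 = 0\<close> there), and those of the
  index type \<open>6\<close> are \<open>0, \<dots>, 5\<close>; hence components and matrix rows are numbered from \<open>0\<close>.
\<close>

definition herm4 :: "complex^4 \<Rightarrow> complex^4 \<Rightarrow> complex" where
  "herm4 a b = - (a$0 * cnj (b$3)) + a$1 * cnj (b$2) + a$2 * cnj (b$1) - a$3 * cnj (b$0)"

definition herm6 :: "complex^6 \<Rightarrow> complex^6 \<Rightarrow> complex" where
  "herm6 y Y = - (y$0 * cnj (Y$0)) + y$1 * cnj (Y$1) + y$2 * cnj (Y$2) + y$3 * cnj (Y$3)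
      + y$4 * cnj (Y$4) - y$5 * cnj (Y$5)"

definition wedge :: "complex^4 \<Rightarrow> complex^4 \<Rightarrow> complex^6" where
  "wedge a b =
    (let p = (\<lambda>i j. a$i * b$j - a$j * b$i) in
     \<chi> k. if k = 0 then (p 0 2 - p 3 1) / 2
          else if k = 1 then (p 0 2 + p 3 1) / 2
          else if k = 2 then (p 0 3 + p 1 2) / 2
          else if k = 3 then (p 0 3 - p 1 2) / (2 * \<i>)
          else if k = 4 then (p 0 1 - p 2 3) / (2 * \<i>)
          else (p 0 1 + p 2 3) / (2 * \<i>))"

definition cnj6 :: "complex^6 \<Rightarrow> complex^6" where
  "cnj6 y = (\<chi> k. cnj (y$k))"

definition re6 :: "complex^6 \<Rightarrow> real^6" where
  "re6 y = (\<chi> k. Re (y$k))"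

definition det4 :: "complex^4 \<Rightarrow> complex^4 \<Rightarrow> complex^4 \<Rightarrow> complex^4 \<Rightarrow> complex" where
  "det4 a b c d =
    det ((\<chi> i. if i = 0 then a else if i = 1 then b else if i = 2 then c else d) :: complex^4^4)"

section \<open>Surfaces in Lie sphere geometry\<close>

definition lie_form :: "real^6 \<Rightarrow> real^6 \<Rightarrow> real" where
  "lie_form u v = - (u$0 * v$0) + u$1 * v$1 + u$2 * v$2 + u$3 * v$3 + u$4 * v$4 - u$5 * v$5"

definition same_sphere :: "real^6 \<Rightarrow> real^6 \<Rightarrow> bool" where
  "same_sphere u v \<longleftrightarrow> (\<exists>c. c \<noteq> 0 \<and> u = c *\<^sub>R v)"

text \<open>
  \<open>curvature_spheres S U V\<close>: the maps \<open>U, V\<close> are the curvature spheres of a surface (an immersed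
  Legendre surface) whose curvature line coordinates are the standard coordinates on \<open>S\<close>.
\<close>

definition curvature_spheres ::
    "(real \<times> real) set \<Rightarrow> (real \<times> real \<Rightarrow> real^6) \<Rightarrow> (real \<times> real \<Rightarrow> real^6) \<Rightarrow> bool" where
  "curvature_spheres S U V \<longleftrightarrow>
     open S \<and> smooth_on S U \<and> smooth_on S V \<and>
     (\<forall>x\<in>S. lie_form (U x) (U x) = 0 \<and> lie_form (U x) (V x) = 0 \<and> lie_form (V x) (V x) = 0 \<and>
        d1 U x \<in> span {U x, V x} \<and> d2 V x \<in> span {U x, V x} \<and>
        distinct [U x, V x, d2 U x, d1 V x] \<and> independent {U x, V x, d2 U x, d1 V x})"

text \<open>
  The curvature lines of the family \<open>V\<close> are the connected pieces in \<open>S\<close> of the lines on which the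
  first coordinate is fixed. They are used here rather than the full slices of \<open>S\<close>, which need not
  be connected.
\<close>

definition canal_surface ::
    "(real \<times> real) set \<Rightarrow> (real \<times> real \<Rightarrow> real^6) \<Rightarrow> (real \<times> real \<Rightarrow> real^6) \<Rightarrow> bool" where
  "canal_surface S U V \<longleftrightarrow> curvature_spheres S U V \<and>
     (\<forall>s t t'. {s} \<times> closed_segment t t' \<subseteq> S \<longrightarrow> same_sphere (V (s, t)) (V (s, t')))"

section \<open>The linear system\<close>

definition canal_system ::
    "(real \<times> real) set \<Rightarrow> (real \<times> real \<Rightarrow> real) \<Rightarrow> (real \<times> real \<Rightarrow> real) \<Rightarrow> (real \<times> real \<Rightarrow> real)
      \<Rightarrow> (real \<times> real \<Rightarrow> complex^4) \<Rightarrow> bool" where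
  "canal_system S p V W \<psi> \<longleftrightarrow>
     smooth_on S p \<and> smooth_on S V \<and> smooth_on S W \<and> smooth_on S \<psi> \<and>
     (\<forall>x\<in>S.
        d2 (d2 (d2 p)) x - 2 * W x * d2 p x - p x * d2 W x = 0 \<and> d1 W x = 0 \<and> d2 V x = 0 \<and>
        d1 (d1 \<psi>) x = (- \<i> * of_real (p x)) *s d2 \<psi> x
           + ((of_real (V x) + \<i> * of_real (d2 p x)) / 2) *s \<psi> x \<and>
        d2 (d2 \<psi>) x = (of_real (W x) / 2) *s \<psi> x)"

definition normalized_frame ::
    "complex^4 \<Rightarrow> complex^4 \<Rightarrow> complex^4 \<Rightarrow> complex^4 \<Rightarrow> bool" where
  "normalized_frame a a1 a2 a12 \<longleftrightarrow>
     herm4 a  a = 0 \<and> herm4 a a1 = 0 \<and> herm4 a a2 = 0 \<and> herm4 a a12 = -1 \<and>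
     herm4 a1 a = 0 \<and> herm4 a1 a1 = 0 \<and> herm4 a1 a2 = 1 \<and> herm4 a1 a12 = 0 \<and>
     herm4 a2 a = 0 \<and> herm4 a2 a1 = 1 \<and> herm4 a2 a2 = 0 \<and> herm4 a2 a12 = 0 \<and>
     herm4 a12 a = -1 \<and> herm4 a12 a1 = 0 \<and> herm4 a12 a2 = 0 \<and> herm4 a12 a12 = 0 \<and>
     det4 a a1 a2 a12 = 1"

definition normalized_on :: "(real \<times> real) set \<Rightarrow> (real \<times> real \<Rightarrow> complex^4) \<Rightarrow> bool" where
  "normalized_on S \<psi> \<longleftrightarrow>
     (\<forall>x\<in>S. normalized_frame (\<psi> x) (d1 \<psi> x) (d2 \<psi> x) (d1 (d2 \<psi>) x))"

definition sphere_U :: "(real \<times> real \<Rightarrow> complex^4) \<Rightarrow> real \<times> real \<Rightarrow> complex^6" where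
  "sphere_U \<psi> x = \<i> *s wedge (\<psi> x) (d1 \<psi> x) - \<i> *s cnj6 (wedge (\<psi> x) (d1 \<psi> x))"

definition sphere_V :: "(real \<times> real \<Rightarrow> complex^4) \<Rightarrow> real \<times> real \<Rightarrow> complex^6" where
  "sphere_V \<psi> x = wedge (\<psi> x) (d2 \<psi> x) + cnj6 (wedge (\<psi> x) (d2 \<psi> x))"

section \<open>Consistency of the conventions\<close>

lemma exhaust_6_from_0:
  fixes k :: 6
  shows "k = 0 \<or> k = 1 \<or> k = 2 \<or> k = 3 \<or> k = 4 \<or> k = 5"
proof (induct k)
  case (of_int z)
  then have "z = 0 \<or> z = 1 \<or> z = 2 \<or> z = 3 \<or> z = 4 \<or> z = 5" by simp arith
  then show ?case by auto
qed

lemma wedge_components: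
  "wedge a b $ 0 = ((a$0 * b$2 - a$2 * b$0) - (a$3 * b$1 - a$1 * b$3)) / 2"
  "wedge a b $ 1 = ((a$0 * b$2 - a$2 * b$0) + (a$3 * b$1 - a$1 * b$3)) / 2"
  "wedge a b $ 2 = ((a$0 * b$3 - a$3 * b$0) + (a$1 * b$2 - a$2 * b$1)) / 2"
  "wedge a b $ 3 = ((a$0 * b$3 - a$3 * b$0) - (a$1 * b$2 - a$2 * b$1)) / (2 * \<i>)"
  "wedge a b $ 4 = ((a$0 * b$1 - a$1 * b$0) - (a$2 * b$3 - a$3 * b$2)) / (2 * \<i>)"
  "wedge a b $ 5 = ((a$0 * b$1 - a$1 * b$0) + (a$2 * b$3 - a$3 * b$2)) / (2 * \<i>)"
  by (simp_all add: wedge_def)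

lemma herm6_wedge:
  "herm6 (wedge a b) (wedge A B) = (herm4 a B * herm4 b A - herm4 a A * herm4 b B) / 2"
  unfolding herm6_def herm4_def wedge_components by (simp add: field_simps)

text \<open>The spheres are real, so that passing to their real parts loses nothing.\<close>

lemma sphere_U_real: "sphere_U \<psi> x = (\<chi> k. of_real (re6 (sphere_U \<psi> x) $ k))"
  by (simp add: sphere_U_def cnj6_def re6_def vec_eq_iff complex_eq_iff)

lemma sphere_V_real: "sphere_V \<psi> x = (\<chi> k. of_real (re6 (sphere_V \<psi> x) $ k))"
  by (simp add: sphere_V_def cnj6_def re6_def vec_eq_iff complex_eq_iff)

lemma herm6_of_real:
  "herm6 (\<chi> k. of_real (u$k)) (\<chi> k. of_real (v$k)) = of_real (lie_form u v)"
  by (simp add: herm6_def lie_form_def)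

end

theory Submission
  imports Defs
begin

text \<open>
  In a normalized frame the wedge products \<open>\<psi> \<and> \<psi>\<^sub>1\<close> and \<open>\<psi> \<and> \<psi>\<^sub>2\<close> are imaginary and real,
  so that \<open>U = 2\<i> \<psi> \<and> \<psi>\<^sub>1\<close> and \<open>V = 2 \<psi> \<and> \<psi>\<^sub>2\<close>; everything in the direct part then follows by
  differentiating.

  Conversely, on a canal surface \<open>[V]\<close> is a null curve depending on \<open>R\<^sup>1\<close> only, that is, a curve of
  Lagrangian 2-planes in \<open>\<complex>\<^sup>4\<close>. A linear differential equation for the basis of the plane produces
  \<open>\<xi>, \<eta>\<close> spanning it whose second derivatives stay in the plane, and this equation preserves the
  normalization. The spheres \<open>U\<close> are orthogonal to \<open>V, V', V''\<close>, hence lie on the conic of the null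
  directions \<open>(\<xi> + \<tau> \<eta>) \<and> (\<xi>' + \<tau> \<eta>')\<close>, and \<open>\<partial>\<^sub>1 U \<in> span (U, V)\<close> forces \<open>\<tau>\<close> to depend on \<open>R\<^sup>2\<close>
  only. With \<open>\<tau>\<close> as the new second coordinate, \<open>\<psi> = \<xi> + R\<^sup>2 \<eta>\<close> solves the system with \<open>W = 0\<close>
  and \<open>p\<close> quadratic in \<open>R\<^sup>2\<close>.
\<close>

section \<open>Functions of class \<open>C\<^sup>k\<close>\<close>

text \<open>The overview asserts that the equation for the basis preserves the normalization. The
  reason: once the second derivatives stay in the isotropic plane, differentiating its vanishing
  products twice makes the products of the first derivatives vanish, so the mixed products are
  constant, and so is the determinant. Hence only one point has to be normalized. There the pairing
  of the derivatives with the plane is a skew-Hermitian 2x2 form, which a change of basis of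
  determinant 1 brings to standard shape because its own determinant is 1. This in turn follows from
  the null curve having a tangent of norm 1 at that point, which a constant rescaling achieves since
  the tangent is orthogonal to a maximal isotropic plane in signature (4,2), hence of positive norm.
  Two obstacles shape the converse. The vector V is constant only up to a factor, so it is replaced
  by its restriction to one line on which the second coordinate is fixed. And the affine parameter
  of the conic may be infinite at the base point, which is cured by exchanging the two basis
  vectors.\<close>

lemma C_on_cong:
  assumes "open S" "\<And>x. x \<in> S \<Longrightarrow> f x = g x"
  shows "C_on k S f \<longleftrightarrow> C_on k S g"
  using assms(2)
proof (induction k arbitrary: f g)
  case 0
  then show ?case using continuous_on_cong by (metis C_on.simps(1))
next
  case (Suc k)
  have *: "f differentiable (at x) \<and> C \<longleftrightarrow> g differentiable (at x) \<and> C" if "x \<in> S" for x C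
    using has_derivative_transform_within_open[OF _ \<open>open S\<close> that, of f _ UNIV g]
      has_derivative_transform_within_open[OF _ \<open>open S\<close> that, of g _ UNIV f] Suc.prems
    unfolding differentiable_def by force
  have "frechet_derivative f (at x) v = frechet_derivative g (at x) v" if "x \<in> S" for x v
  proof -
    have "(f has_derivative D) (at x) \<longleftrightarrow> (g has_derivative D) (at x)" for D
      using has_derivative_transform_within_open[OF _ \<open>open S\<close> that, of f D UNIV g]
        has_derivative_transform_within_open[OF _ \<open>open S\<close> that, of g D UNIV f] Suc.prems by force
    then show ?thesis by (simp add: frechet_derivative_def)
  qed
  then have "C_on k S (\<lambda>x. frechet_derivative f (at x) v) \<longleftrightarrow> C_on k S (\<lambda>x. frechet_derivative g (at x) v)"
    for v by (intro Suc.IH) auto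
  then show ?case using * by auto
qed

lemma smooth_on_cong:
  assumes "open S" "\<And>x. x \<in> S \<Longrightarrow> f x = g x"
  shows "smooth_on S f \<longleftrightarrow> smooth_on S g"
  unfolding smooth_on_def using C_on_cong[OF assms] by simp

lemma C_on_subset: "C_on k S f \<Longrightarrow> T \<subseteq> S \<Longrightarrow> C_on k T f"
proof (induction k arbitrary: f)
  case 0
  then show ?case by (auto intro: continuous_on_subset)
qed auto

lemma smooth_on_subset: "smooth_on S f \<Longrightarrow> T \<subseteq> S \<Longrightarrow> smooth_on T f"
  unfolding smooth_on_def using C_on_subset by blast

lemma C_on_SucD: "C_on (Suc k) S f \<Longrightarrow> C_on k S f"
proof (induction k arbitrary: f)
  case 0
  then show ?case
    by (auto intro!: differentiable_imp_continuous_on differentiable_at_imp_differentiable_on)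
qed simp

text \<open>\<open>C_on\<close> is phrased with \<open>frechet_derivative\<close>; this rule lets
  the closure lemmas below name their derivative \<open>D\<close> explicitly instead.\<close>

lemma C_on_SucI:
  assumes "open S" "\<And>x. x \<in> S \<Longrightarrow> (f has_derivative D x) (at x)" "\<And>v. C_on k S (\<lambda>x. D x v)"
  shows "C_on (Suc k) S f"
proof -
  have "C_on k S (\<lambda>x. frechet_derivative f (at x) v) \<longleftrightarrow> C_on k S (\<lambda>x. D x v)" for v
    using assms(2) by (intro C_on_cong[OF assms(1)]) (metis frechet_derivative_at)
  then show ?thesis using assms by (auto simp: differentiable_def)
qed

lemma C_on_Suc_has_derivative:
  "C_on (Suc k) S f \<Longrightarrow> x \<in> S \<Longrightarrow> (f has_derivative frechet_derivative f (at x)) (at x)"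
  by (simp add: frechet_derivative_works)

lemma smooth_on_has_derivative:
  "smooth_on S f \<Longrightarrow> x \<in> S \<Longrightarrow> (f has_derivative frechet_derivative f (at x)) (at x)"
  unfolding smooth_on_def by (metis C_on_Suc_has_derivative)

lemma smooth_on_frechet_derivative:
  "smooth_on S f \<Longrightarrow> smooth_on S (\<lambda>x. frechet_derivative f (at x) v)"
  unfolding smooth_on_def using C_on.simps(2) by blast

lemma smooth_on_imp_continuous_on: "smooth_on S f \<Longrightarrow> continuous_on S f"
  unfolding smooth_on_def by (metis C_on.simps(1))

lemma C_on_const: "open S \<Longrightarrow> C_on k S (\<lambda>x. c)"
proof (induction k arbitrary: c)
  case (Suc k)
  then show ?case by (intro C_on_SucI[where D = "\<lambda>x v. 0"]) auto
qed simp

lemma C_on_linear: "open S \<Longrightarrow> bounded_linear L \<Longrightarrow> C_on k S L"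
proof (cases k)
  case 0
  then show "bounded_linear L \<Longrightarrow> ?thesis" by (simp add: linear_continuous_on)
next
  case (Suc j)
  assume *: "open S" "bounded_linear L"
  show ?thesis unfolding Suc
    by (rule C_on_SucI[where D = "\<lambda>x. L"])
      (use * in \<open>auto intro: C_on_const bounded_linear_imp_has_derivative\<close>)
qed

lemma C_on_bounded_linear:
  assumes "open S" "bounded_linear L"
  shows "C_on k S f \<Longrightarrow> C_on k S (\<lambda>x. L (f x))"
proof (induction k arbitrary: f)
  case 0
  then show ?case using assms by (simp add: bounded_linear.continuous_on)
next
  case (Suc k)
  show ?case
    by (rule C_on_SucI[OF assms(1), where D = "\<lambda>x v. L (frechet_derivative f (at x) v)"])
      (use Suc assms in \<open>auto intro!: bounded_linear.has_derivative[OF assms(2)]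
         simp: frechet_derivative_works[symmetric]\<close>)
qed

lemma C_on_add:
  assumes "open S"
  shows "C_on k S f \<Longrightarrow> C_on k S g \<Longrightarrow> C_on k S (\<lambda>x. f x + g x)"
proof (induction k arbitrary: f g)
  case 0
  then show ?case by (simp add: continuous_on_add)
next
  case (Suc k)
  show ?case
    by (rule C_on_SucI[OF assms(1), where D = "\<lambda>x v. frechet_derivative f (at x) v + frechet_derivative g (at x) v"])
      (use Suc in \<open>auto intro!: has_derivative_add simp: frechet_derivative_works[symmetric]\<close>)
qed

lemma (in bounded_bilinear) C_on:
  assumes "open S"
  shows "C_on k S f \<Longrightarrow> C_on k S g \<Longrightarrow> C_on k S (\<lambda>x. prod (f x) (g x))"
proof (induction k arbitrary: f g)
  case 0
  then show ?case by (simp add: continuous_on)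
next
  case (Suc k)
  show ?case
    by (rule C_on_SucI[OF assms(1), where D =
          "\<lambda>x v. prod (f x) (frechet_derivative g (at x) v) + prod (frechet_derivative f (at x) v) (g x)"])
      (use Suc C_on_SucD[OF Suc.prems(1)] C_on_SucD[OF Suc.prems(2)] in
        \<open>auto intro!: FDERIV C_on_add[OF assms] simp: frechet_derivative_works[symmetric]\<close>)
qed

text \<open>The derivative of the inverse is a product of the inverse itself and the derivative of
  \<open>f\<close>, so class C^k of the inverse yields class C^(k+1).\<close>

lemma C_on_inverse:
  fixes f :: "'a::real_normed_vector \<Rightarrow> 'b::real_normed_field"
  assumes "open S" "\<And>x. x \<in> S \<Longrightarrow> f x \<noteq> 0"
  shows "C_on k S f \<Longrightarrow> C_on k S (\<lambda>x. inverse (f x))"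
proof (induction k)
  case 0
  then show ?case using assms by (simp add: continuous_on_inverse)
next
  case (Suc k)
  have i: "C_on k S (\<lambda>x. inverse (f x))" using Suc C_on_SucD by blast
  have "C_on k S (\<lambda>x. - (inverse (f x) * frechet_derivative f (at x) v * inverse (f x)))" for v
    using i Suc.prems
    by (intro C_on_bounded_linear[OF assms(1), of uminus] bounded_linear_minus bounded_linear_ident
        bounded_bilinear.C_on[OF bounded_bilinear_mult assms(1)]) auto
  then show ?case using Suc.prems assms(2)
    by (intro C_on_SucI[OF assms(1), where D = "\<lambda>x v. - (inverse (f x) * frechet_derivative f (at x) v * inverse (f x))"])
      (auto intro!: has_derivative_inverse simp: frechet_derivative_works[symmetric])
qed

section \<open>Closure properties of smooth functions\<close>

lemma smooth_on_const: "open S \<Longrightarrow> smooth_on S (\<lambda>x. c)"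
  by (simp add: smooth_on_def C_on_const)

lemma smooth_on_linear: "open S \<Longrightarrow> bounded_linear L \<Longrightarrow> smooth_on S L"
  by (simp add: smooth_on_def C_on_linear)

lemma smooth_on_bounded_linear:
  "open S \<Longrightarrow> bounded_linear L \<Longrightarrow> smooth_on S f \<Longrightarrow> smooth_on S (\<lambda>x. L (f x))"
  by (simp add: smooth_on_def C_on_bounded_linear)

lemma smooth_on_add:
  "open S \<Longrightarrow> smooth_on S f \<Longrightarrow> smooth_on S g \<Longrightarrow> smooth_on S (\<lambda>x. f x + g x)"
  by (simp add: smooth_on_def C_on_add)

lemma smooth_on_minus: "open S \<Longrightarrow> smooth_on S f \<Longrightarrow> smooth_on S (\<lambda>x. - f x)"
  by (rule smooth_on_bounded_linear[OF _ bounded_linear_minus[OF bounded_linear_ident]])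

lemma smooth_on_diff:
  "open S \<Longrightarrow> smooth_on S f \<Longrightarrow> smooth_on S g \<Longrightarrow> smooth_on S (\<lambda>x. f x - g x)"
  using smooth_on_add[OF _ _ smooth_on_minus] by fastforce

lemma (in bounded_bilinear) smooth_on:
  "open S \<Longrightarrow> smooth_on S f \<Longrightarrow> smooth_on S g \<Longrightarrow> smooth_on S (\<lambda>x. prod (f x) (g x))"
  by (simp add: smooth_on_def C_on)

lemmas smooth_on_mult = bounded_bilinear.smooth_on[OF bounded_bilinear_mult]
lemmas smooth_on_scaleR = bounded_bilinear.smooth_on[OF bounded_bilinear_scaleR]

lemma smooth_on_divide:
  fixes f g :: "'a::real_normed_vector \<Rightarrow> 'b::real_normed_field"
  assumes "open S" "smooth_on S f" "smooth_on S g" "\<And>x. x \<in> S \<Longrightarrow> g x \<noteq> 0"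
  shows "smooth_on S (\<lambda>x. f x / g x)"
  unfolding divide_inverse using assms
  by (intro smooth_on_mult) (auto simp: smooth_on_def C_on_inverse)

lemma C_on_compose_linear:
  fixes f :: "'b::real_normed_vector \<Rightarrow> 'c::real_normed_vector"
  assumes L: "bounded_linear L"
  shows "open T \<Longrightarrow> open S \<Longrightarrow> L ` T \<subseteq> S \<Longrightarrow> C_on k S f \<Longrightarrow> C_on k T (\<lambda>x. f (L x))"
proof (induction k arbitrary: f)
  case 0
  then show ?case
    using continuous_on_compose2[of S f T L] linear_continuous_on[OF L] by auto
next
  case (Suc k)
  show ?case
  proof (rule C_on_SucI[OF Suc.prems(1), where D = "\<lambda>x v. frechet_derivative f (at (L x)) (L v)"])
    fix x assume "x \<in> T"
    then have "(f has_derivative frechet_derivative f (at (L x))) (at (L x))"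
      using Suc.prems by (intro C_on_Suc_has_derivative) auto
    then show "((\<lambda>x. f (L x)) has_derivative (\<lambda>v. frechet_derivative f (at (L x)) (L v))) (at x)"
      using has_derivative_compose[OF bounded_linear_imp_has_derivative[OF L]] by blast
  next
    fix v show "C_on k T (\<lambda>x. frechet_derivative f (at (L x)) (L v))"
      using Suc.prems by (intro Suc.IH) auto
  qed
qed

lemma smooth_on_compose_linear:
  "bounded_linear L \<Longrightarrow> open T \<Longrightarrow> open S \<Longrightarrow> L ` T \<subseteq> S \<Longrightarrow> smooth_on S f \<Longrightarrow> smooth_on T (\<lambda>x. f (L x))"
  unfolding smooth_on_def by (blast intro: C_on_compose_linear)

subsection \<open>Curves\<close>

lemma smooth_on_has_vector_derivative:
  fixes f :: "real \<Rightarrow> 'a::real_normed_vector"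
  assumes "smooth_on S f" "s \<in> S"
  shows "(f has_vector_derivative vector_derivative f (at s)) (at s)"
  using assms smooth_on_has_derivative
  by (metis differentiableI_vector differentiable_def vector_derivative_works)

lemma smooth_on_vector_derivative:
  fixes f :: "real \<Rightarrow> 'a::real_normed_vector"
  assumes "open S" "smooth_on S f"
  shows "smooth_on S (\<lambda>s. vector_derivative f (at s))"
proof -
  have eq: "frechet_derivative f (at s) 1 = vector_derivative f (at s)" if "s \<in> S" for s
    using frechet_derivative_at[OF smooth_on_has_vector_derivative[OF assms(2) that, unfolded has_vector_derivative_def], symmetric]
    by simp
  show ?thesis
    by (rule iffD1[OF smooth_on_cong[OF assms(1) eq] smooth_on_frechet_derivative[OF assms(2)]])
qed

lemma C_on_SucI_vector:
  fixes f :: "real \<Rightarrow> 'a::real_normed_vector"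
  assumes "open S" "\<And>s. s \<in> S \<Longrightarrow> (f has_vector_derivative f' s) (at s)" "C_on k S f'"
  shows "C_on (Suc k) S f"
  using assms
  by (intro C_on_SucI[where D = "\<lambda>s v. v *\<^sub>R f' s"])
    (auto simp: has_vector_derivative_def intro: C_on_bounded_linear[OF _ bounded_linear_scaleR_right])

subsection \<open>Functions on the plane\<close>

text \<open>\<open>C_on\<close> controls derivatives in constant directions only, while the chain
  rule evaluates the derivative of \<open>f\<close> in a direction that varies with the point.
  Resolving this direction along the two axes turns the derivative into a sum of products to which
  the induction hypothesis applies.\<close>

lemma C_on_compose_plane:
  fixes f :: "real \<times> real \<Rightarrow> 'c::real_normed_vector"
    and g :: "'a::real_normed_vector \<Rightarrow> real \<times> real"
  assumes "open T" "open S" "g ` T \<subseteq> S"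
  shows "C_on k S f \<Longrightarrow> C_on k T g \<Longrightarrow> C_on k T (\<lambda>x. f (g x))"
proof (induction k arbitrary: f)
  case 0
  then show ?case using continuous_on_compose2[of S f T g] assms by auto
next
  case (Suc k)
  let ?D = "\<lambda>x v. fst (frechet_derivative g (at x) v) *\<^sub>R frechet_derivative f (at (g x)) (1,0)
    + snd (frechet_derivative g (at x) v) *\<^sub>R frechet_derivative f (at (g x)) (0,1)"
  show ?case
  proof (rule C_on_SucI[OF assms(1), where D = ?D])
    fix x assume x: "x \<in> T"
    then have f: "(f has_derivative frechet_derivative f (at (g x))) (at (g x))"
      using Suc.prems assms by (intro C_on_Suc_has_derivative) auto
    have g: "(g has_derivative frechet_derivative g (at x)) (at x)"
      using Suc.prems x by (intro C_on_Suc_has_derivative)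
    have D: "frechet_derivative f (at (g x)) w
      = fst w *\<^sub>R frechet_derivative f (at (g x)) (1,0) + snd w *\<^sub>R frechet_derivative f (at (g x)) (0,1)" for w
    proof -
      have "w = fst w *\<^sub>R (1,0) + snd w *\<^sub>R (0,1)" by (simp add: prod_eq_iff)
      then show ?thesis
        using linear_add[OF has_derivative_linear[OF f], of "fst w *\<^sub>R (1,0)" "snd w *\<^sub>R (0,1)"]
          linear_scale[OF has_derivative_linear[OF f], of "fst w" "(1,0)"]
          linear_scale[OF has_derivative_linear[OF f], of "snd w" "(0,1)"] by argo
    qed
    show "((\<lambda>x. f (g x)) has_derivative ?D x) (at x)"
      by (rule has_derivative_eq_rhs[OF has_derivative_compose[OF g f]]) (rule ext, rule D)
  next
    fix v
    note mult = bounded_bilinear.C_on[OF bounded_bilinear_scaleR assms(1)]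
    have g: "C_on k T g" using C_on_SucD Suc.prems(2) by blast
    have Df: "C_on k T (\<lambda>x. frechet_derivative f (at (g x)) w)" for w
      by (rule Suc.IH[OF Suc.prems(1)[unfolded C_on.simps, THEN conjunct2, THEN spec, of w] g])
    have "C_on k T (\<lambda>x. frechet_derivative g (at x) v)" using Suc.prems(2) by simp
    then have Dg: "C_on k T (\<lambda>x. fst (frechet_derivative g (at x) v))"
      "C_on k T (\<lambda>x. snd (frechet_derivative g (at x) v))"
      by (rule C_on_bounded_linear[OF assms(1) bounded_linear_fst]
          C_on_bounded_linear[OF assms(1) bounded_linear_snd])+
    show "C_on k T (\<lambda>x. ?D x v)"
      by (rule C_on_add[OF assms(1) mult[OF Dg(1) Df] mult[OF Dg(2) Df]])
  qed
qed

lemma smooth_on_compose_plane: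
  fixes f :: "real \<times> real \<Rightarrow> 'c::real_normed_vector"
    and g :: "'a::real_normed_vector \<Rightarrow> real \<times> real"
  assumes "open T" "open S" "g ` T \<subseteq> S" "smooth_on S f" "smooth_on T g"
  shows "smooth_on T (\<lambda>x. f (g x))"
  using C_on_compose_plane[OF assms(1-3)] assms(4,5) unfolding smooth_on_def by blast

lemma smooth_on_Pair:
  assumes "open S" "smooth_on S f" "smooth_on S g"
  shows "smooth_on S (\<lambda>x. (f x, g x))"
proof -
  have 1: "bounded_linear (\<lambda>y. (y, 0))" and 2: "bounded_linear (\<lambda>y. (0, y))"
    by (auto intro: bounded_linear_intros bounded_linear_Pair bounded_linear_ident bounded_linear_zero)
  show ?thesis
    using smooth_on_add[OF assms(1) smooth_on_bounded_linear[OF assms(1) 1 assms(2)]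
        smooth_on_bounded_linear[OF assms(1) 2 assms(3)]] by simp
qed

lemma smooth_on_fst_curve:
  assumes "open I" "smooth_on I f" "open S" "fst ` S \<subseteq> I"
  shows "smooth_on S (\<lambda>x. f (fst x))"
  using smooth_on_compose_linear[OF bounded_linear_fst assms(3,1,4,2)] .

lemma d1_eqI: "((\<lambda>s. f (s, snd x)) has_vector_derivative D) (at (fst x)) \<Longrightarrow> d1 f x = D"
  unfolding d1_def by (rule vector_derivative_at)

lemma d2_eqI: "((\<lambda>t. f (fst x, t)) has_vector_derivative D) (at (snd x)) \<Longrightarrow> d2 f x = D"
  unfolding d2_def by (rule vector_derivative_at)

lemma has_derivative_d1:
  assumes "(f has_derivative D) (at x)"
  shows "((\<lambda>s. f (s, snd x)) has_vector_derivative D (1,0)) (at (fst x))"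
proof -
  have "((\<lambda>s. (s, snd x)) has_derivative (\<lambda>v. (v, 0))) (at (fst x))"
    by (auto intro!: derivative_eq_intros)
  then have "((\<lambda>s. f (s, snd x)) has_derivative (\<lambda>v. D (v, 0))) (at (fst x))"
    using has_derivative_compose[of _ _ "fst x" UNIV f D] assms by simp
  moreover have "(\<lambda>v. D (v, 0)) = (\<lambda>v. v *\<^sub>R D (1,0))"
  proof
    show "D (v, 0) = v *\<^sub>R D (1,0)" for v
      using linear_scale[OF has_derivative_linear[OF assms], of v "(1,0)"] by simp
  qed
  ultimately show ?thesis by (simp only: has_vector_derivative_def)
qed

lemma has_derivative_d2:
  assumes "(f has_derivative D) (at x)"
  shows "((\<lambda>t. f (fst x, t)) has_vector_derivative D (0,1)) (at (snd x))"
proof -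
  have "((\<lambda>t. (fst x, t)) has_derivative (\<lambda>v. (0, v))) (at (snd x))"
    by (auto intro!: derivative_eq_intros)
  then have "((\<lambda>t. f (fst x, t)) has_derivative (\<lambda>v. D (0, v))) (at (snd x))"
    using has_derivative_compose[of _ _ "snd x" UNIV f D] assms by simp
  moreover have "(\<lambda>v. D (0, v)) = (\<lambda>v. v *\<^sub>R D (0,1))"
  proof
    show "D (0, v) = v *\<^sub>R D (0,1)" for v
      using linear_scale[OF has_derivative_linear[OF assms], of v "(0,1)"] by simp
  qed
  ultimately show ?thesis by (simp only: has_vector_derivative_def)
qed

lemma d1_frechet: "smooth_on S f \<Longrightarrow> x \<in> S \<Longrightarrow> d1 f x = frechet_derivative f (at x) (1,0)"
  by (intro d1_eqI has_derivative_d1 smooth_on_has_derivative)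

lemma d2_frechet: "smooth_on S f \<Longrightarrow> x \<in> S \<Longrightarrow> d2 f x = frechet_derivative f (at x) (0,1)"
  by (intro d2_eqI has_derivative_d2 smooth_on_has_derivative)

lemma smooth_on_d1: "open S \<Longrightarrow> smooth_on S f \<Longrightarrow> smooth_on S (d1 f)"
  by (rule iffD2[OF smooth_on_cong[OF _ d1_frechet] smooth_on_frechet_derivative])

lemma smooth_on_d2: "open S \<Longrightarrow> smooth_on S f \<Longrightarrow> smooth_on S (d2 f)"
  by (rule iffD2[OF smooth_on_cong[OF _ d2_frechet] smooth_on_frechet_derivative])

lemma smooth_on_has_d1:
  "smooth_on S f \<Longrightarrow> x \<in> S \<Longrightarrow> ((\<lambda>s. f (s, snd x)) has_vector_derivative d1 f x) (at (fst x))"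
  using has_derivative_d1[OF smooth_on_has_derivative] by (simp add: d1_frechet)

lemma smooth_on_has_d2:
  "smooth_on S f \<Longrightarrow> x \<in> S \<Longrightarrow> ((\<lambda>t. f (fst x, t)) has_vector_derivative d2 f x) (at (snd x))"
  using has_derivative_d2[OF smooth_on_has_derivative] by (simp add: d2_frechet)

lemma open_slices:
  fixes S :: "(real \<times> real) set"
  assumes "open S"
  shows "open {s. (s, t) \<in> S}" "open {t. (s, t) \<in> S}"
proof -
  have "{s. (s, t) \<in> S} = (\<lambda>s. (s, t)) -` S" "{t. (s, t) \<in> S} = (\<lambda>t. (s, t)) -` S" by auto
  then show "open {s. (s, t) \<in> S}" "open {t. (s, t) \<in> S}"
    by (auto intro!: open_vimage assms continuous_intros)
qed

lemma d1_cong: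
  assumes "open S" "x \<in> S" "\<And>y. y \<in> S \<Longrightarrow> f y = g y"
  shows "d1 f x = d1 g x"
  unfolding d1_def
proof (rule vector_derivative_cong_eq)
  show "\<forall>\<^sub>F s in nhds (fst x). s \<in> UNIV \<longrightarrow> f (s, snd x) = g (s, snd x)"
    using open_slices(1)[OF assms(1), of "snd x"] assms by (auto simp: eventually_nhds)
qed auto

lemma d2_cong:
  assumes "open S" "x \<in> S" "\<And>y. y \<in> S \<Longrightarrow> f y = g y"
  shows "d2 f x = d2 g x"
  unfolding d2_def
proof (rule vector_derivative_cong_eq)
  show "\<forall>\<^sub>F t in nhds (snd x). t \<in> UNIV \<longrightarrow> f (fst x, t) = g (fst x, t)"
    using open_slices(2)[OF assms(1), of "fst x"] assms by (auto simp: eventually_nhds)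
qed auto

text \<open>Symmetry by integration: \<open>f (r, u) - f (r, a)\<close> is the integral of
  \<open>d2 f\<close>, the Leibniz rule moves \<open>d1\<close> under that integral, and
  differentiating in \<open>u\<close> recovers \<open>d1 (d2 f)\<close>.\<close>

lemma d1_d2_commute:
  fixes f :: "real \<times> real \<Rightarrow> 'a::banach"
  assumes S: "open S" "x \<in> S" and f: "smooth_on S f"
  shows "d1 (d2 f) x = d2 (d1 f) x"
proof -
  obtain s t where x: "x = (s, t)" by (cases x)
  obtain A B where AB: "open A" "open B" "s \<in> A" "t \<in> B" "A \<times> B \<subseteq> S"
    using S unfolding x by (rule open_prod_elim) auto
  obtain d where d: "d > 0" "cball s d \<subseteq> A"
    using open_contains_cball AB by metis
  obtain e where e: "e > 0" "cball t e \<subseteq> B"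
    using open_contains_cball AB by metis
  define U where "U = {s-d..s+d}"
  \<comment> \<open>The lower limit lies strictly below \<open>t\<close>, so \<open>t\<close> is
    interior and derivatives within the interval are full derivatives there.\<close>
  define a where "a = t - e"
  have sub: "U \<times> {a..t+e} \<subseteq> S"
    using d e AB by (auto simp: U_def a_def cball_eq_atLeastAtMost subset_iff)
  note f2 = smooth_on_d2[OF S(1) f] and f1 = smooth_on_d1[OF S(1) f]
  note f12 = smooth_on_d1[OF S(1) f2]
  have ftc: "integral {a..u} (\<lambda>y. d2 f (r, y)) = f (r, u) - f (r, a)" if "r \<in> U" "u \<in> {a..t+e}" for r u
  proof (intro integral_unique fundamental_theorem_of_calculus)
    fix y assume "y \<in> {a..u}"
    then have "(r, y) \<in> S" using that sub by auto
    then show "((\<lambda>y. f (r, y)) has_vector_derivative d2 f (r, y)) (at y within {a..u})"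
      using smooth_on_has_d2[OF f, of "(r, y)"] by (auto intro: has_vector_derivative_at_within)
  qed (use that in auto)
  have cont: "continuous_on (U \<times> {a..t+e}) (\<lambda>(r, y). d1 (d2 f) (r, y))"
    using continuous_on_subset[OF smooth_on_imp_continuous_on[OF f12] sub] by simp
  have conty: "continuous_on {a..u} (\<lambda>y. g (r, y))"
    if "smooth_on S g" "r \<in> U" "u \<in> {a..t+e}" for g :: "real \<times> real \<Rightarrow> 'a" and r u
    using sub that
    by (intro continuous_on_compose2[OF smooth_on_imp_continuous_on[OF that(1)]] continuous_intros) auto
  have sU: "s \<in> interior U" using d by (simp add: U_def)
  have *: "integral {a..u} (\<lambda>y. d1 (d2 f) (s, y)) = d1 f (s, u) - d1 f (s, a)" if u: "u \<in> {a..t+e}" for u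
  proof -
    have "((\<lambda>r. integral (cbox a u) (\<lambda>y. d2 f (r, y))) has_vector_derivative
        integral (cbox a u) (\<lambda>y. d1 (d2 f) (s, y))) (at s within U)"
    proof (rule leibniz_rule_vector_derivative)
      fix r y assume "r \<in> U" "y \<in> cbox a u"
      then have "(r, y) \<in> S" using sub u by auto
      then show "((\<lambda>r. d2 f (r, y)) has_vector_derivative d1 (d2 f) (r, y)) (at r within U)"
        using smooth_on_has_d1[OF f2, of "(r, y)"] by (auto intro: has_vector_derivative_at_within)
    next
      fix r assume "r \<in> U"
      then show "(\<lambda>y. d2 f (r, y)) integrable_on cbox a u"
        using conty[OF f2 _ u] by (auto intro: integrable_continuous_real)
    next
      show "continuous_on (U \<times> cbox a u) (\<lambda>(r, y). d1 (d2 f) (r, y))"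
        by (rule continuous_on_subset[OF cont]) (use u in auto)
    qed (use d in \<open>auto simp: U_def\<close>)
    then have "((\<lambda>r. f (r, u) - f (r, a)) has_vector_derivative
        integral {a..u} (\<lambda>y. d1 (d2 f) (s, y))) (at s within U)"
      using ftc u d by (auto simp: U_def intro: has_vector_derivative_transform[rotated 2])
    then have "((\<lambda>r. f (r, u) - f (r, a)) has_vector_derivative
        integral {a..u} (\<lambda>y. d1 (d2 f) (s, y))) (at s)"
      using at_within_interior[OF sU] by simp
    moreover have "(s, u) \<in> S" "(s, a) \<in> S" using sub u d e by (auto simp: U_def a_def)
    then have "((\<lambda>r. f (r, u) - f (r, a)) has_vector_derivative d1 f (s, u) - d1 f (s, a)) (at s)"
      using smooth_on_has_d1[OF f] by (intro has_vector_derivative_diff) force+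
    ultimately show ?thesis by (rule vector_derivative_unique_at)
  qed
  have "((\<lambda>u. integral {a..u} (\<lambda>y. d1 (d2 f) (s, y))) has_vector_derivative d1 (d2 f) (s, t))
      (at t within {a..t+e})"
    using d e by (intro integral_has_vector_derivative conty[OF f12]) (auto simp: U_def a_def)
  then have "((\<lambda>u. d1 f (s, u) - d1 f (s, a)) has_vector_derivative d1 (d2 f) (s, t)) (at t within {a..t+e})"
    by (rule has_vector_derivative_transform[rotated 2]) (use e * in \<open>auto simp: a_def\<close>)
  moreover have "t \<in> interior {a..t+e}" using e by (simp add: a_def)
  ultimately have "((\<lambda>u. d1 f (s, u) - d1 f (s, a)) has_vector_derivative d1 (d2 f) (s, t)) (at t)"
    using at_within_interior by metis
  then have "((\<lambda>u. (d1 f (s, u) - d1 f (s, a)) + d1 f (s, a)) has_vector_derivative d1 (d2 f) (s, t) + 0) (at t)"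
    by (intro has_vector_derivative_add has_vector_derivative_const)
  then show ?thesis
    using d2_eqI[of "d1 f" x] by (simp add: x)
qed

section \<open>The wedge product in a normalized frame\<close>

lemma UNIV_4_from_0: "(UNIV :: 4 set) = {0, 1, 2, 3}"
proof -
  have "(4::4) = 0" by simp
  then have "(UNIV :: 4 set) = {1, 2, 3, 0}" using UNIV_4 by presburger
  then show ?thesis by blast
qed

lemma forall_4_from_0: "(\<forall>i::4. P i) \<longleftrightarrow> P 0 \<and> P 1 \<and> P 2 \<and> P 3"
  using UNIV_4_from_0 by (metis UNIV_I insertE singletonD)

lemma sum_4_from_0: "sum f (UNIV :: 4 set) = f 0 + f 1 + f 2 + f 3"
  unfolding UNIV_4_from_0 by (simp add: ac_simps)

lemma forall_6_from_0: "(\<forall>i::6. P i) \<longleftrightarrow> P 0 \<and> P 1 \<and> P 2 \<and> P 3 \<and> P 4 \<and> P 5"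
  using exhaust_6_from_0 by metis

lemma vec6_eqI: "(\<And>k. k \<in> {0, 1, 2, 3, 4, 5} \<Longrightarrow> u $ k = v $ k) \<Longrightarrow> u = (v :: 'a^6)"
  by (simp add: vec_eq_iff forall_6_from_0)

text \<open>Laplace expansion along the first two rows; its 2x2 minors are the ones that make up the
  wedge product.\<close>

lemma det_4:
  "det (A :: 'a::comm_ring_1^4^4) =
     (A$0$0 * A$1$1 - A$0$1 * A$1$0) * (A$2$2 * A$3$3 - A$2$3 * A$3$2)
   - (A$0$0 * A$1$2 - A$0$2 * A$1$0) * (A$2$1 * A$3$3 - A$2$3 * A$3$1)
   + (A$0$0 * A$1$3 - A$0$3 * A$1$0) * (A$2$1 * A$3$2 - A$2$2 * A$3$1)
   + (A$0$1 * A$1$2 - A$0$2 * A$1$1) * (A$2$0 * A$3$3 - A$2$3 * A$3$0)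
   - (A$0$1 * A$1$3 - A$0$3 * A$1$1) * (A$2$0 * A$3$2 - A$2$2 * A$3$0)
   + (A$0$2 * A$1$3 - A$0$3 * A$1$2) * (A$2$0 * A$3$1 - A$2$1 * A$3$0)"
proof -
  have f: "finite {1::4, 2, 3}" "0 \<notin> {1::4, 2, 3}" "finite {2::4, 3}" "1 \<notin> {2::4, 3}"
    "finite {3::4}" "2 \<notin> {3::4}"
    by auto
  show ?thesis
    unfolding det_def UNIV_4_from_0
    unfolding sum_over_permutations_insert[OF f(1,2)] sum_over_permutations_insert[OF f(3,4)]
      sum_over_permutations_insert[OF f(5,6)] permutes_sing
    by (simp add: sign_swap_id permutation_swap_id sign_compose sign_id permutation_compose
        Transposition.transpose_def algebra_simps)
qed

lemma det4_eq:
  "det4 a b c d =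
     (a$0 * b$1 - a$1 * b$0) * (c$2 * d$3 - c$3 * d$2)
   - (a$0 * b$2 - a$2 * b$0) * (c$1 * d$3 - c$3 * d$1)
   + (a$0 * b$3 - a$3 * b$0) * (c$1 * d$2 - c$2 * d$1)
   + (a$1 * b$2 - a$2 * b$1) * (c$0 * d$3 - c$3 * d$0)
   - (a$1 * b$3 - a$3 * b$1) * (c$0 * d$2 - c$2 * d$0)
   + (a$2 * b$3 - a$3 * b$2) * (c$0 * d$1 - c$1 * d$0)"
  by (simp add: det4_def det_4)

text \<open>The complex bilinear extension of \<open>lie_form\<close>, without the conjugation of
  \<open>herm6\<close>. On bivectors it is half of the determinant pairing, that is, the form of the
  Klein quadric.\<close>

definition bil6 :: "complex^6 \<Rightarrow> complex^6 \<Rightarrow> complex" where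
  "bil6 y Y = - (y$0 * Y$0) + y$1 * Y$1 + y$2 * Y$2 + y$3 * Y$3 + y$4 * Y$4 - y$5 * Y$5"

lemma herm6_eq_bil6: "herm6 y Y = bil6 y (cnj6 Y)"
  by (simp add: herm6_def bil6_def cnj6_def)

lemma bil6_commute: "bil6 y Y = bil6 Y y"
  by (simp add: bil6_def mult.commute)

lemma bil6_wedge: "bil6 (wedge a b) (wedge c d) = det4 a b c d / 2"
  unfolding bil6_def det4_eq wedge_components by (simp add: field_simps)

text \<open>Cramer's rule for bivectors: in the basis of the six wedges of \<open>a\<close>,
  \<open>b\<close>, \<open>c\<close>, \<open>d\<close>, each coefficient is, up to sign, the pairing
  \<open>B\<close> with the complementary wedge. The \<open>q\<close>s are the Pluecker coordinates
  of an arbitrary bivector, and multiplying by the determinant \<open>D\<close> makes this a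
  polynomial identity, valid also for dependent vectors.\<close>

lemma pluecker_expansion:
  fixes a b c d :: "'a::comm_ring_1^4"
  shows "let m = (\<lambda>(x::'a^4) y i j. x$i * y$j - x$j * y$i);
      B = (\<lambda>x y. q01 * m x y 2 3 + q23 * m x y 0 1 + q02 * m x y 3 1 + q31 * m x y 0 2 + q03 * m x y 1 2 + q12 * m x y 0 3);
      D = m a b 0 1 * m c d 2 3 + m a b 0 2 * m c d 3 1 + m a b 0 3 * m c d 1 2 + m a b 1 2 * m c d 0 3
        + m a b 3 1 * m c d 0 2 + m a b 2 3 * m c d 0 1;
      E = (\<lambda>i j. B c d * m a b i j - B b d * m a c i j + B b c * m a d i j + B a d * m b c i j - B a c * m b d i j + B a b * m c d i j)
   in D * q01 = E 0 1 \<and> D * q23 = E 2 3 \<and> D * q02 = E 0 2 \<and> D * q31 = E 3 1 \<and> D * q03 = E 0 3 \<and> D * q12 = E 1 2"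
  unfolding Let_def
  by (intro conjI) (simp_all add: algebra_simps)

text \<open>Complementary wedges are dual for \<open>bil6\<close> up to sign and the factor
  \<open>det4 / 2\<close>; the leading 2 compensates the half in \<open>bil6_wedge\<close>.\<close>

lemma wedge_expansion:
  "det4 a b c d *s u = 2 *s (bil6 u (wedge c d) *s wedge a b - bil6 u (wedge b d) *s wedge a c
     + bil6 u (wedge b c) *s wedge a d + bil6 u (wedge a d) *s wedge b c
     - bil6 u (wedge a c) *s wedge b d + bil6 u (wedge a b) *s wedge c d)"
  (is "_ = ?R")
proof -
  define m where "m = (\<lambda>(x::complex^4) (y::complex^4) i j. x$i * y$j - x$j * y$i)"
  \<comment> \<open>The Pluecker coordinates of \<open>u\<close>: the linear change of coordinates
    in \<open>wedge\<close>, solved backwards.\<close>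
  define q01 q02 q03 q12 q31 q23
    where q: "q01 = \<i> * (u$4 + u$5)" "q02 = u$0 + u$1" "q03 = u$2 + \<i> * u$3"
      "q12 = u$2 - \<i> * u$3" "q31 = u$1 - u$0" "q23 = \<i> * (u$5 - u$4)"
  define B where "B = (\<lambda>x y. q01 * m x y 2 3 + q23 * m x y 0 1 + q02 * m x y 3 1
    + q31 * m x y 0 2 + q03 * m x y 1 2 + q12 * m x y 0 3)"
  have w: "wedge x y $ 0 = (m x y 0 2 - m x y 3 1) / 2" "wedge x y $ 1 = (m x y 0 2 + m x y 3 1) / 2"
    "wedge x y $ 2 = (m x y 0 3 + m x y 1 2) / 2" "wedge x y $ 3 = (m x y 0 3 - m x y 1 2) / (2 * \<i>)"
    "wedge x y $ 4 = (m x y 0 1 - m x y 2 3) / (2 * \<i>)" "wedge x y $ 5 = (m x y 0 1 + m x y 2 3) / (2 * \<i>)"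
    for x y by (simp_all add: m_def wedge_components)
  have u: "u$0 = (q02 - q31) / 2" "u$1 = (q02 + q31) / 2" "u$2 = (q03 + q12) / 2"
    "u$3 = (q03 - q12) / (2 * \<i>)" "u$4 = (q01 - q23) / (2 * \<i>)" "u$5 = (q01 + q23) / (2 * \<i>)"
    unfolding q by (simp_all add: field_simps)
  have B: "bil6 u (wedge x y) = B x y / 2" for x y
    unfolding bil6_def w u B_def by (simp add: field_simps)
  have D: "det4 a b c d = m a b 0 1 * m c d 2 3 + m a b 0 2 * m c d 3 1 + m a b 0 3 * m c d 1 2
      + m a b 1 2 * m c d 0 3 + m a b 3 1 * m c d 0 2 + m a b 2 3 * m c d 0 1"
    unfolding det4_eq m_def by (simp add: algebra_simps)
  define E where "E = (\<lambda>i j. B c d * m a b i j - B b d * m a c i j + B b c * m a d i j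
    + B a d * m b c i j - B a c * m b d i j + B a b * m c d i j)"
  have E: "det4 a b c d * q01 = E 0 1" "det4 a b c d * q23 = E 2 3" "det4 a b c d * q02 = E 0 2"
    "det4 a b c d * q31 = E 3 1" "det4 a b c d * q03 = E 0 3" "det4 a b c d * q12 = E 1 2"
    using pluecker_expansion[of q01 q23 q02 q31 q03 q12 a b c d]
    unfolding Let_def D E_def B_def m_def by blast+
  have half: "x * ((y + z) / k) = (x * y + x * z) / k" "x * ((y - z) / k) = (x * y - x * z) / k"
    for x y z k :: complex by (simp_all add: field_simps)
  show ?thesis
  proof (rule vec6_eqI)
    fix k :: 6 assume "k \<in> {0, 1, 2, 3, 4, 5}"
    then show "(det4 a b c d *s u) $ k = ?R $ k"
      by (elim insertE emptyE)
        (simp_all only: vector_smult_component vector_add_component vector_minus_component B,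
         simp_all only: u w half E, simp_all add: E_def field_simps)
  qed
qed

section \<open>Linearity of the wedge product and of the forms\<close>

lemma bounded_bilinear_wedge: "bounded_bilinear wedge"
proof -
  have "wedge (a + a') b = wedge a b + wedge a' b" "wedge a (b + b') = wedge a b + wedge a b'"
    "wedge (r *\<^sub>R a) b = r *\<^sub>R wedge a b" "wedge a (r *\<^sub>R b) = r *\<^sub>R wedge a b" for a a' b b' r
    by (rule vec6_eqI; elim insertE emptyE; simp add: wedge_components field_simps scaleR_conv_of_real[where 'a=complex])+
  then show ?thesis
    unfolding bilinear_conv_bounded_bilinear[symmetric] bilinear_def
    by (auto intro!: linearI)
qed

lemma wedge_add_left: "wedge (a + a') b = wedge a b + wedge a' b"
  and wedge_add_right: "wedge a (b + b') = wedge a b + wedge a b'"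
  using bounded_bilinear_wedge
  by (auto simp: bounded_bilinear.add_left bounded_bilinear.add_right)

lemma wedge_smult_left: "wedge (c *s a) b = c *s wedge a b"
  and wedge_smult_right: "wedge a (c *s b) = c *s wedge a b"
  by (rule vec6_eqI; elim insertE emptyE; simp add: wedge_components field_simps)+

lemma wedge_self: "wedge a a = 0"
  by (rule vec6_eqI) (elim insertE emptyE; simp add: wedge_components)

lemma wedge_swap: "wedge a b = - wedge b a"
  by (rule vec6_eqI) (elim insertE emptyE; simp add: wedge_components field_simps)

lemma bounded_bilinear_herm4: "bounded_bilinear herm4"
proof -
  have "herm4 (a + a') b = herm4 a b + herm4 a' b" "herm4 a (b + b') = herm4 a b + herm4 a b'"
    "herm4 (r *\<^sub>R a) b = r *\<^sub>R herm4 a b" "herm4 a (r *\<^sub>R b) = r *\<^sub>R herm4 a b" for a a' b b' r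
    by (simp_all add: herm4_def algebra_simps)
  then show ?thesis
    unfolding bilinear_conv_bounded_bilinear[symmetric] bilinear_def
    by (auto intro!: linearI)
qed

lemma herm4_add_left: "herm4 (a + a') b = herm4 a b + herm4 a' b"
  and herm4_add_right: "herm4 a (b + b') = herm4 a b + herm4 a b'"
  by (simp_all add: herm4_def algebra_simps)

lemma herm4_smult_left: "herm4 (c *s a) b = c * herm4 a b"
  and herm4_smult_right: "herm4 a (c *s b) = cnj c * herm4 a b"
  by (simp_all add: herm4_def algebra_simps)

lemma herm4_cnj: "cnj (herm4 a b) = herm4 b a"
  by (simp add: herm4_def algebra_simps)

lemma bil6_add_left: "bil6 (y + y') z = bil6 y z + bil6 y' z"
  and bil6_add_right: "bil6 z (y + y') = bil6 z y + bil6 z y'"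
  and bil6_diff_left: "bil6 (y - y') z = bil6 y z - bil6 y' z"
  and bil6_diff_right: "bil6 z (y - y') = bil6 z y - bil6 z y'"
  and bil6_smult_left: "bil6 (c *s y) z = c * bil6 y z"
  and bil6_smult_right: "bil6 z (c *s y) = c * bil6 z y"
  and bil6_minus_left: "bil6 (- y) z = - bil6 y z"
  and bil6_minus_right: "bil6 z (- y) = - bil6 z y"
  and bil6_zero_left: "bil6 0 z = 0"
  and bil6_zero_right: "bil6 z 0 = 0"
  by (simp_all add: bil6_def algebra_simps)

lemmas bil6_linear = bil6_add_left bil6_add_right bil6_diff_left bil6_diff_right bil6_smult_left
  bil6_smult_right bil6_minus_left bil6_minus_right bil6_zero_left bil6_zero_right

text \<open>The Gram relations alone; the determinant of such a frame is only known to have modulus 1.\<close>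

definition gram_frame :: "complex^4 \<Rightarrow> complex^4 \<Rightarrow> complex^4 \<Rightarrow> complex^4 \<Rightarrow> bool" where
  "gram_frame a a1 a2 a12 \<longleftrightarrow>
     herm4 a  a = 0 \<and> herm4 a a1 = 0 \<and> herm4 a a2 = 0 \<and> herm4 a a12 = -1 \<and>
     herm4 a1 a = 0 \<and> herm4 a1 a1 = 0 \<and> herm4 a1 a2 = 1 \<and> herm4 a1 a12 = 0 \<and>
     herm4 a2 a = 0 \<and> herm4 a2 a1 = 1 \<and> herm4 a2 a2 = 0 \<and> herm4 a2 a12 = 0 \<and>
     herm4 a12 a = -1 \<and> herm4 a12 a1 = 0 \<and> herm4 a12 a2 = 0 \<and> herm4 a12 a12 = 0"

section \<open>Expansion, conjugation and pairings in a frame\<close>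

lemma normalized_frame_iff:
  "normalized_frame a a1 a2 a12 \<longleftrightarrow> gram_frame a a1 a2 a12 \<and> det4 a a1 a2 a12 = 1"
  unfolding normalized_frame_def gram_frame_def by blast

text \<open>The list \<open>- a12, a2, a1, - a\<close> is the dual basis of the frame for
  \<open>herm4\<close>. Hence the matrix \<open>A\<close> of the frame has the right inverse
  \<open>B\<close>; for square matrices this is a left inverse as well, and
  \<open>B ** A = mat 1\<close> is the expansion.\<close>

lemma gram_frame_expansion:
  assumes "gram_frame a a1 a2 a12"
  shows "u = - (herm4 u a12 *s a) + herm4 u a2 *s a1 + herm4 u a1 *s a2 - herm4 u a *s a12"
proof -
  \<comment> \<open>Conjugating and permuting the components of \<open>b\<close> turns
    \<open>herm4\<close> into a plain dot product, which matrix multiplication can express.\<close>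
  define dual :: "complex^4 \<Rightarrow> complex^4"
    where "dual b = (\<chi> k. if k = 0 then - cnj (b$3) else if k = 1 then cnj (b$2) else if k = 2 then cnj (b$1)
      else - cnj (b$0))" for b
  have dual: "herm4 x b = (\<Sum>k\<in>UNIV. x$k * dual b $ k)" for x b
    by (simp add: dual_def herm4_def sum_4_from_0)
  define A :: "complex^4^4" where "A = (\<chi> i. if i = 0 then a else if i = 1 then a1 else if i = 2 then a2 else a12)"
  define R :: "complex^4^4" where "R = (\<chi> i. if i = 0 then - a12 else if i = 1 then a2 else if i = 2 then a1 else - a)"
  define B :: "complex^4^4" where "B = (\<chi> k j. dual (R$j) $ k)"
  have minus: "herm4 x (- y) = - herm4 x y" for x y by (simp add: herm4_def algebra_simps)
  have AB: "(A ** B) $ i $ j = herm4 (A$i) (R$j)" for i j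
    by (simp add: matrix_matrix_mult_def B_def dual)
  have "A ** B = mat 1"
    unfolding vec_eq_iff AB forall_4_from_0
    using assms unfolding gram_frame_def by (simp add: A_def R_def mat_def minus)
  then have BA: "B ** A = mat 1" by (simp add: matrix_left_right_inverse)
  have "u = u v* (B ** A)" by (simp add: BA)
  also have "\<dots> = (u v* B) v* A" by (simp add: vector_matrix_mul_assoc)
  also have "\<dots> = (\<Sum>j\<in>UNIV. herm4 u (R$j) *s (A$j))"
    by (simp add: vec_eq_iff vector_matrix_mult_def B_def dual mult.commute)
  finally show ?thesis
    by (simp add: sum_4_from_0 A_def R_def minus)
qed

text \<open>Pairing a conjugated wedge by \<open>bil6\<close> is pairing the wedge itself by
  \<open>herm6\<close>, and \<open>herm6_wedge\<close> reduces this to Gram products. So all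
  coefficients of the conjugate in the basis of six wedges are known.\<close>

lemma cnj6_normalized_frame:
  assumes "normalized_frame a a1 a2 a12"
  shows "cnj6 (wedge a a1) = - wedge a a1" (is ?A) and "cnj6 (wedge a a2) = wedge a a2" (is ?B)
    and "cnj6 (wedge a a12) = wedge a1 a2" (is ?C) and "cnj6 (wedge a1 a2) = wedge a a12" (is ?D)
    and "cnj6 (wedge a1 a12) = wedge a1 a12" (is ?E) and "cnj6 (wedge a2 a12) = - wedge a2 a12" (is ?F)
proof -
  note nf = assms[unfolded normalized_frame_def]
  have e: "cnj6 z = 2 *s (herm6 (wedge a2 a12) z *s wedge a a1 - herm6 (wedge a1 a12) z *s wedge a a2
     + herm6 (wedge a1 a2) z *s wedge a a12 + herm6 (wedge a a12) z *s wedge a1 a2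
     - herm6 (wedge a a2) z *s wedge a1 a12 + herm6 (wedge a a1) z *s wedge a2 a12)" for z
    using wedge_expansion[of a a1 a2 a12 "cnj6 z"] nf
    by (simp add: herm6_eq_bil6 bil6_commute[of "cnj6 z"])
  show ?A ?B ?C ?D ?E ?F
    using nf by (simp_all add: e herm6_wedge vec_eq_iff)
qed

lemma det4_permute:
  "det4 a a b c = 0" "det4 b a a c = 0" "det4 b c a a = 0" "det4 a b a c = 0" "det4 a b c a = 0" "det4 b a c a = 0"
  by (simp_all add: det4_eq algebra_simps)

text \<open>Wedges with a common factor pair to zero by \<open>bil6_zeros\<close>, which leaves the
  complementary pairs; their signs are those of the permutations of the frame.\<close>

lemma bil6_normalized_frame:
  assumes "normalized_frame a a1 a2 a12"
  shows "bil6 (wedge a a1) (wedge a2 a12) = 1 / 2" (is ?A) and "bil6 (wedge a2 a12) (wedge a a1) = 1 / 2" (is ?B)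
    and "bil6 (wedge a a2) (wedge a1 a12) = - 1 / 2" (is ?C) and "bil6 (wedge a1 a12) (wedge a a2) = - 1 / 2" (is ?D)
    and "bil6 (wedge a a12) (wedge a1 a2) = 1 / 2" (is ?E) and "bil6 (wedge a1 a2) (wedge a a12) = 1 / 2" (is ?F)
proof -
  have d: "det4 a a1 a2 a12 = 1" using assms by (simp add: normalized_frame_def)
  have "det4 a2 a12 a a1 = det4 a a1 a2 a12" "det4 a a2 a1 a12 = - det4 a a1 a2 a12"
    "det4 a1 a12 a a2 = - det4 a a1 a2 a12" "det4 a a12 a1 a2 = det4 a a1 a2 a12"
    "det4 a1 a2 a a12 = det4 a a1 a2 a12"
    by (simp_all add: det4_eq algebra_simps)
  then show ?A ?B ?C ?D ?E ?F
    by (simp_all add: bil6_wedge d)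
qed

section \<open>From the linear system to the canal surface\<close>

lemma d1_bilinear:
  assumes "bounded_bilinear m" "smooth_on S f" "smooth_on S g" "x \<in> S"
  shows "d1 (\<lambda>x. m (f x) (g x)) x = m (f x) (d1 g x) + m (d1 f x) (g x)"
  using bounded_bilinear.has_vector_derivative[OF assms(1) smooth_on_has_d1[OF assms(2,4)] smooth_on_has_d1[OF assms(3,4)]]
  by (intro d1_eqI) simp

lemma d2_bilinear:
  assumes "bounded_bilinear m" "smooth_on S f" "smooth_on S g" "x \<in> S"
  shows "d2 (\<lambda>x. m (f x) (g x)) x = m (f x) (d2 g x) + m (d2 f x) (g x)"
  using bounded_bilinear.has_vector_derivative[OF assms(1) smooth_on_has_d2[OF assms(2,4)] smooth_on_has_d2[OF assms(3,4)]]
  by (intro d2_eqI) simp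

lemma d1_linear:
  assumes "bounded_linear L" "smooth_on S f" "x \<in> S"
  shows "d1 (\<lambda>x. L (f x)) x = L (d1 f x)"
  using bounded_linear.has_vector_derivative[OF assms(1) smooth_on_has_d1[OF assms(2,3)]]
  by (intro d1_eqI) simp

lemma d2_linear:
  assumes "bounded_linear L" "smooth_on S f" "x \<in> S"
  shows "d2 (\<lambda>x. L (f x)) x = L (d2 f x)"
  using bounded_linear.has_vector_derivative[OF assms(1) smooth_on_has_d2[OF assms(2,3)]]
  by (intro d2_eqI) simp

lemma d1_add: "smooth_on S f \<Longrightarrow> smooth_on S g \<Longrightarrow> x \<in> S \<Longrightarrow> d1 (\<lambda>x. f x + g x) x = d1 f x + d1 g x"
  by (intro d1_eqI has_vector_derivative_add smooth_on_has_d1)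

lemma d2_add: "smooth_on S f \<Longrightarrow> smooth_on S g \<Longrightarrow> x \<in> S \<Longrightarrow> d2 (\<lambda>x. f x + g x) x = d2 f x + d2 g x"
  by (intro d2_eqI has_vector_derivative_add smooth_on_has_d2)

lemma bounded_bilinear_smult: "bounded_bilinear (\<lambda>(c::complex) (v::complex^'n). c *s v)"
proof -
  have "(\<lambda>(c::complex) (v::complex^'n). c *s v) = (\<lambda>c v. \<chi> i. c * v $ i)"
    by (simp add: vector_scalar_mult_def)
  then show ?thesis
    unfolding bilinear_conv_bounded_bilinear[symmetric] bilinear_def
    by (auto intro!: linearI simp: vec_eq_iff algebra_simps)
qed

lemma bounded_linear_of_real_half: "bounded_linear (\<lambda>r. of_real r / 2 :: complex)"
  by (rule bounded_linear_compose[OF bounded_linear_divide bounded_linear_of_real])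

lemma bounded_linear_smult: "bounded_linear (\<lambda>v::complex^'n. c *s v)"
  by (rule bounded_bilinear.bounded_linear_right[OF bounded_bilinear_smult])

section \<open>Real vectors among the bivectors, and tests of independence\<close>

lemma bounded_linear_re6: "bounded_linear re6"
  unfolding linear_conv_bounded_linear[symmetric]
  by (rule linearI) (simp_all add: re6_def vec_eq_iff)

lemma re6_of_real_smult: "re6 (of_real r *s y) = r *\<^sub>R re6 y"
  by (simp add: re6_def vec_eq_iff)

lemma cnj6_simps:
  "cnj6 (y + z) = cnj6 y + cnj6 z" "cnj6 (y - z) = cnj6 y - cnj6 z"
  "cnj6 (c *s y) = cnj c *s cnj6 y" "cnj6 (- y) = - cnj6 y"
  by (simp_all add: cnj6_def vec_eq_iff)

lemma lie_form_re6:
  assumes "cnj6 y = y" "cnj6 z = z"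
  shows "of_real (lie_form (re6 y) (re6 z)) = bil6 y z"
proof -
  have "Im (y $ k) = 0" "Im (z $ k) = 0" for k
    using assms by (simp_all add: cnj6_def vec_eq_iff complex_eq_iff)
  then show ?thesis
    by (simp add: complex_eq_iff lie_form_def re6_def bil6_def)
qed

lemma bounded_bilinear_lie_form: "bounded_bilinear lie_form"
  unfolding bilinear_conv_bounded_bilinear[symmetric] bilinear_def
  by (auto intro!: linearI simp: lie_form_def algebra_simps)

lemma independent_by_dual:
  fixes B :: "'a::real_vector set"
  assumes "finite B" "\<And>b. b \<in> B \<Longrightarrow> linear (f b)"
    and "\<And>b. b \<in> B \<Longrightarrow> f b b \<noteq> (0::real)" "\<And>b c. b \<in> B \<Longrightarrow> c \<in> B \<Longrightarrow> c \<noteq> b \<Longrightarrow> f b c = 0"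
  shows "independent B"
proof (rule independent_if_scalars_zero[OF assms(1)])
  fix g b assume *: "(\<Sum>x\<in>B. g x *\<^sub>R x) = 0" "b \<in> B"
  interpret linear "f b" using assms(2) * by blast
  have "0 = f b (\<Sum>x\<in>B. g x *\<^sub>R x)" by (simp add: *)
  also have "\<dots> = (\<Sum>x\<in>B. g x * f b x)" by (simp add: sum scale)
  also have "\<dots> = (\<Sum>x\<in>B. if x = b then g b * f b b else 0)"
    using assms(4) * by (intro sum.cong) auto
  also have "\<dots> = g b * f b b" using * assms(1) by simp
  finally show "g b = 0" using assms(3) * by simp
qed

lemma independent_4_by_dual:
  assumes "lie_form u u' \<noteq> 0" "lie_form v v' \<noteq> 0" "lie_form a a' \<noteq> 0" "lie_form b b' \<noteq> 0"
    "lie_form v u' = 0" "lie_form a u' = 0" "lie_form b u' = 0"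
    "lie_form u v' = 0" "lie_form a v' = 0" "lie_form b v' = 0"
    "lie_form u a' = 0" "lie_form v a' = 0" "lie_form b a' = 0"
    "lie_form u b' = 0" "lie_form v b' = 0" "lie_form a b' = 0"
  shows "distinct [u, v, a, b] \<and> independent {u, v, a, b}"
proof
  show d: "distinct [u, v, a, b]" using assms by auto
  have lin: "linear (\<lambda>x. lie_form x y)" for y
    using bounded_bilinear.bounded_linear_left[OF bounded_bilinear_lie_form] bounded_linear.linear by blast
  define f where "f = (\<lambda>c x. lie_form x (if c = u then u' else if c = v then v' else if c = a then a' else b'))"
  show "independent {u, v, a, b}"
    by (rule independent_by_dual[where f = f])
      (use assms d in \<open>auto simp: f_def lin\<close>)
qed

lemma sphere_U_eq:
  assumes "normalized_frame (\<psi> x) (d1 \<psi> x) a2 a12"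
  shows "sphere_U \<psi> x = (2 * \<i>) *s wedge (\<psi> x) (d1 \<psi> x)"
  unfolding sphere_U_def cnj6_normalized_frame(1)[OF assms] by (simp add: vec_eq_iff)

lemma sphere_V_eq:
  assumes "normalized_frame (\<psi> x) a1 (d2 \<psi> x) a12"
  shows "sphere_V \<psi> x = 2 *s wedge (\<psi> x) (d2 \<psi> x)"
  unfolding sphere_V_def cnj6_normalized_frame(2)[OF assms] by (simp add: vec_eq_iff)

lemma bil6_zeros:
  "bil6 (wedge a b) (wedge a c) = 0" "bil6 (wedge a b) (wedge c a) = 0"
  "bil6 (wedge b a) (wedge a c) = 0" "bil6 (wedge b a) (wedge c a) = 0"
  by (simp_all add: bil6_wedge det4_permute)

section \<open>Derivatives of a solution of the system and of its two spheres\<close>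

context
  fixes \<Omega> p V W \<psi>
  assumes open_dom: "open \<Omega>" and sys: "canal_system \<Omega> p V W \<psi>" and nrm: "normalized_on \<Omega> \<psi>"
begin

private lemma sm: "smooth_on \<Omega> p" "smooth_on \<Omega> V" "smooth_on \<Omega> W" "smooth_on \<Omega> \<psi>"
  using sys by (auto simp: canal_system_def)

private lemma nf: "x \<in> \<Omega> \<Longrightarrow> normalized_frame (\<psi> x) (d1 \<psi> x) (d2 \<psi> x) (d1 (d2 \<psi>) x)"
  using nrm by (auto simp: normalized_on_def)

private lemmas sm1 = smooth_on_d1[OF open_dom] and sm2 = smooth_on_d2[OF open_dom]

private lemma psi_11: "x \<in> \<Omega> \<Longrightarrow> d1 (d1 \<psi>) x = (- \<i> * of_real (p x)) *s d2 \<psi> x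
           + ((of_real (V x) + \<i> * of_real (d2 p x)) / 2) *s \<psi> x"
  using sys by (auto simp: canal_system_def)

private lemma psi_22: "x \<in> \<Omega> \<Longrightarrow> d2 (d2 \<psi>) x = (of_real (W x) / 2) *s \<psi> x"
  using sys by (auto simp: canal_system_def)

text \<open>After commuting derivatives, the term in \<open>\<psi>\<close> drops out because
  \<open>W\<close> does not depend on the first coordinate.\<close>

private lemma psi_122: "x \<in> \<Omega> \<Longrightarrow> d2 (d1 (d2 \<psi>)) x = (of_real (W x) / 2) *s d1 \<psi> x"
proof -
  assume x: "x \<in> \<Omega>"
  have "d2 (d1 (d2 \<psi>)) x = d1 (d2 (d2 \<psi>)) x"
    using d1_d2_commute[OF open_dom x sm2[OF sm(4)]] by simp
  also have "\<dots> = d1 (\<lambda>x. (of_real (W x) / 2) *s \<psi> x) x"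
    by (rule d1_cong[OF open_dom x psi_22])
  also have "\<dots> = (of_real (W x) / 2) *s d1 \<psi> x + d1 (\<lambda>x. (of_real (W x) / 2 :: complex)) x *s \<psi> x"
  proof (rule d1_bilinear[OF bounded_bilinear_smult _ sm(4) x])
    show "smooth_on \<Omega> (\<lambda>x. (of_real (W x) / 2 :: complex))"
      by (rule smooth_on_bounded_linear[OF open_dom bounded_linear_of_real_half sm(3)])
  qed
  also have "d1 (\<lambda>x. (of_real (W x) / 2 :: complex)) x = of_real (d1 W x) / 2"
    by (rule d1_linear[OF bounded_linear_of_real_half sm(3) x])
  also have "d1 W x = 0" using sys x by (auto simp: canal_system_def)
  finally show ?thesis by simp
qed

text \<open>The coefficient \<open>k\<close> is left open because this vector will only be wedged
  with \<open>\<psi>\<close>. The other coefficient is the conjugate of the one of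
  \<open>\<psi>\<close> in the first equation: differentiating \<open>- \<i> p\<close> contributes
  \<open>- \<i> d2 p\<close>, which reverses the sign of \<open>\<i> d2 p / 2\<close>.\<close>

private lemma psi_112:
  "x \<in> \<Omega> \<Longrightarrow> \<exists>k. d1 (d1 (d2 \<psi>)) x = k *s \<psi> x + ((of_real (V x) - \<i> * of_real (d2 p x)) / 2) *s d2 \<psi> x"
proof -
  assume x: "x \<in> \<Omega>"
  have "d1 (d1 (d2 \<psi>)) x = d1 (d2 (d1 \<psi>)) x"
    by (rule d1_cong[OF open_dom x d1_d2_commute[OF open_dom _ sm(4)]])
  also have "\<dots> = d2 (d1 (d1 \<psi>)) x"
    by (rule d1_d2_commute[OF open_dom x sm1[OF sm(4)]])
  also have "\<dots> = d2 (\<lambda>x. (- \<i> * of_real (p x)) *s d2 \<psi> x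
           + ((of_real (V x) + \<i> * of_real (d2 p x)) / 2) *s \<psi> x) x"
    by (rule d2_cong[OF open_dom x psi_11])
  also have "\<dots> = ((- \<i> * of_real (p x)) *s d2 (d2 \<psi>) x + d2 (\<lambda>x. - \<i> * of_real (p x)) x *s d2 \<psi> x)
           + (((of_real (V x) + \<i> * of_real (d2 p x)) / 2) *s d2 \<psi> x
             + d2 (\<lambda>x. (of_real (V x) + \<i> * of_real (d2 p x)) / 2) x *s \<psi> x)"
  proof -
    have s1: "smooth_on \<Omega> (\<lambda>x. - \<i> * of_real (p x))"
      by (rule smooth_on_bounded_linear[OF open_dom _ sm(1)])
        (intro bounded_linear_mult_const bounded_linear_const_mult bounded_linear_of_real)
    have "smooth_on \<Omega> (\<lambda>x. of_real (V x) / 2 + \<i> / 2 * of_real (d2 p x))"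
      by (intro smooth_on_add[OF open_dom] smooth_on_bounded_linear[OF open_dom _ sm(2)]
          smooth_on_bounded_linear[OF open_dom _ sm2[OF sm(1)]] bounded_linear_const_mult bounded_linear_of_real
          bounded_linear_compose[OF bounded_linear_divide])
    then have s2: "smooth_on \<Omega> (\<lambda>x. (of_real (V x) + \<i> * of_real (d2 p x)) / 2)"
      by (simp add: add_divide_distrib)
    show ?thesis
      using s1 s2 sm(4) sm2[OF sm(4)] x
      by (subst d2_add[OF bounded_bilinear.smooth_on[OF bounded_bilinear_smult open_dom]
            bounded_bilinear.smooth_on[OF bounded_bilinear_smult open_dom] x]; (simp only: d2_bilinear[OF bounded_bilinear_smult])?)
  qed
  also have "d2 (\<lambda>x. - \<i> * of_real (p x)) x = - \<i> * of_real (d2 p x)"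
    by (rule d2_linear[OF _ sm(1) x]) (intro bounded_linear_const_mult bounded_linear_of_real)
  finally show ?thesis
    unfolding psi_22[OF x]
    by (intro exI[of _ "- \<i> * of_real (p x) * (of_real (W x) / 2) + d2 (\<lambda>x. (of_real (V x) + \<i> * of_real (d2 p x)) / 2) x"])
      (simp add: vec_eq_iff algebra_simps add_divide_distrib diff_divide_distrib)
qed

private lemma smooth_wedge:
  "smooth_on \<Omega> f \<Longrightarrow> smooth_on \<Omega> g \<Longrightarrow> smooth_on \<Omega> (\<lambda>x. wedge (f x) (g x))"
  by (rule bounded_bilinear.smooth_on[OF bounded_bilinear_wedge open_dom])

private lemma d_wedge:
  assumes "smooth_on \<Omega> f" "smooth_on \<Omega> g" "x \<in> \<Omega>"
  shows "d1 (\<lambda>x. c *s wedge (f x) (g x)) x = c *s (wedge (f x) (d1 g x) + wedge (d1 f x) (g x))"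
    "d2 (\<lambda>x. c *s wedge (f x) (g x)) x = c *s (wedge (f x) (d2 g x) + wedge (d2 f x) (g x))"
  using assms
  by (simp_all add: d1_linear[OF bounded_linear_smult smooth_wedge] d2_linear[OF bounded_linear_smult smooth_wedge]
      d1_bilinear[OF bounded_bilinear_wedge] d2_bilinear[OF bounded_bilinear_wedge])

private lemma sphere_eq:
  assumes "x \<in> \<Omega>"
  shows "sphere_U \<psi> x = (2 * \<i>) *s wedge (\<psi> x) (d1 \<psi> x)" "sphere_V \<psi> x = 2 *s wedge (\<psi> x) (d2 \<psi> x)"
  using nf[OF assms] by (auto intro: sphere_U_eq sphere_V_eq)

private lemma smooth_smult_wedge:
  "smooth_on \<Omega> f \<Longrightarrow> smooth_on \<Omega> g \<Longrightarrow> smooth_on \<Omega> (\<lambda>x. c *s wedge (f x) (g x))"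
  by (rule smooth_on_bounded_linear[OF open_dom bounded_linear_smult smooth_wedge])

private lemma smooth_sphere: "smooth_on \<Omega> (sphere_U \<psi>)" "smooth_on \<Omega> (sphere_V \<psi>)"
  using smooth_on_cong[OF open_dom sphere_eq(1)] smooth_on_cong[OF open_dom sphere_eq(2)]
    smooth_smult_wedge[OF sm(4) sm1[OF sm(4)]] smooth_smult_wedge[OF sm(4) sm2[OF sm(4)]] by simp_all

private lemma psi_21: "x \<in> \<Omega> \<Longrightarrow> d2 (d1 \<psi>) x = d1 (d2 \<psi>) x"
  using d1_d2_commute[OF open_dom _ sm(4)] by simp

private lemma sphere_d1:
  assumes x: "x \<in> \<Omega>"
  shows "d1 (sphere_U \<psi>) x = of_real (2 * p x) *s wedge (\<psi> x) (d2 \<psi> x)"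
    "d1 (sphere_V \<psi>) x = 2 *s (wedge (\<psi> x) (d1 (d2 \<psi>) x) + wedge (d1 \<psi> x) (d2 \<psi> x))"
proof -
  have "d1 (sphere_U \<psi>) x = (2 * \<i>) *s (wedge (\<psi> x) (d1 (d1 \<psi>) x) + wedge (d1 \<psi> x) (d1 \<psi> x))"
    by (simp add: d1_cong[OF open_dom x sphere_eq(1)] d_wedge(1)[OF sm(4) sm1[OF sm(4)] x])
  then show "d1 (sphere_U \<psi>) x = of_real (2 * p x) *s wedge (\<psi> x) (d2 \<psi> x)"
    unfolding psi_11[OF x] wedge_add_right wedge_smult_right wedge_self
    by (simp add: vec_eq_iff algebra_simps)
  show "d1 (sphere_V \<psi>) x = 2 *s (wedge (\<psi> x) (d1 (d2 \<psi>) x) + wedge (d1 \<psi> x) (d2 \<psi> x))"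
    by (simp add: d1_cong[OF open_dom x sphere_eq(2)] d_wedge(1)[OF sm(4) sm2[OF sm(4)] x])
qed

private lemma sphere_d2:
  assumes x: "x \<in> \<Omega>"
  shows "d2 (sphere_U \<psi>) x = (2 * \<i>) *s (wedge (\<psi> x) (d1 (d2 \<psi>) x) - wedge (d1 \<psi> x) (d2 \<psi> x))"
    "d2 (sphere_V \<psi>) x = 0"
proof -
  show "d2 (sphere_U \<psi>) x = (2 * \<i>) *s (wedge (\<psi> x) (d1 (d2 \<psi>) x) - wedge (d1 \<psi> x) (d2 \<psi> x))"
    by (simp add: d2_cong[OF open_dom x sphere_eq(1)] d_wedge(2)[OF sm(4) sm1[OF sm(4)] x] psi_21[OF x]
        wedge_swap[of "d2 \<psi> x"])
  have "d2 (sphere_V \<psi>) x = 2 *s (wedge (\<psi> x) (d2 (d2 \<psi>) x) + wedge (d2 \<psi> x) (d2 \<psi> x))"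
    by (simp add: d2_cong[OF open_dom x sphere_eq(2)] d_wedge(2)[OF sm(4) sm2[OF sm(4)] x])
  then show "d2 (sphere_V \<psi>) x = 0"
    by (simp add: psi_22[OF x] wedge_smult_right wedge_self)
qed

private lemma sphere_d11:
  assumes x: "x \<in> \<Omega>"
  shows "\<exists>k. d1 (d1 (sphere_V \<psi>)) x = 4 *s wedge (d1 \<psi> x) (d1 (d2 \<psi>) x) + k *s wedge (\<psi> x) (d2 \<psi> x)"
proof -
  obtain k where k: "d1 (d1 (d2 \<psi>)) x = k *s \<psi> x + ((of_real (V x) - \<i> * of_real (d2 p x)) / 2) *s d2 \<psi> x"
    using psi_112[OF x] by blast
  have "d1 (d1 (sphere_V \<psi>)) x = d1 (\<lambda>x. 2 *s wedge (\<psi> x) (d1 (d2 \<psi>) x) + 2 *s wedge (d1 \<psi> x) (d2 \<psi> x)) x"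
    using sphere_d1(2) by (intro d1_cong[OF open_dom x]) (simp add: vec_eq_iff algebra_simps)
  also have "\<dots> = 2 *s (wedge (\<psi> x) (d1 (d1 (d2 \<psi>)) x) + wedge (d1 \<psi> x) (d1 (d2 \<psi>) x))
      + 2 *s (wedge (d1 \<psi> x) (d1 (d2 \<psi>) x) + wedge (d1 (d1 \<psi>) x) (d2 \<psi> x))"
    by (simp only: d1_add[OF smooth_smult_wedge[OF sm(4) sm1[OF sm2[OF sm(4)]]]
          smooth_smult_wedge[OF sm1[OF sm(4)] sm2[OF sm(4)]] x]
        d_wedge(1)[OF sm(4) sm1[OF sm2[OF sm(4)]] x] d_wedge(1)[OF sm1[OF sm(4)] sm2[OF sm(4)] x])
  \<comment> \<open>The conjugate coefficients \<open>(V + \<i> d2 p) / 2\<close> and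
    \<open>(V - \<i> d2 p) / 2\<close> both land in front of the wedge of \<open>\<psi>\<close> and
    \<open>d2 \<psi>\<close>, so their imaginary parts cancel and \<open>V\<close> survives.\<close>
  finally show ?thesis
    unfolding k psi_11[OF x] wedge_add_left wedge_add_right wedge_smult_left wedge_smult_right wedge_self
    by (intro exI[of _ "of_real (2 * V x)"]) (simp add: vec_eq_iff field_simps)
qed

private lemma sphere_d22:
  assumes x: "x \<in> \<Omega>"
  shows "\<exists>k. d2 (d2 (sphere_U \<psi>)) x = (4 * \<i>) *s wedge (d2 \<psi> x) (d1 (d2 \<psi>) x) + k *s wedge (\<psi> x) (d1 \<psi> x)"
proof -
  have "d2 (d2 (sphere_U \<psi>)) x
      = d2 (\<lambda>x. (2 * \<i>) *s wedge (\<psi> x) (d1 (d2 \<psi>) x) + (- 2 * \<i>) *s wedge (d1 \<psi> x) (d2 \<psi> x)) x"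
    using sphere_d2(1) by (intro d2_cong[OF open_dom x]) (simp add: vec_eq_iff algebra_simps)
  also have "\<dots> = (2 * \<i>) *s (wedge (\<psi> x) (d2 (d1 (d2 \<psi>)) x) + wedge (d2 \<psi> x) (d1 (d2 \<psi>) x))
      + (- 2 * \<i>) *s (wedge (d1 \<psi> x) (d2 (d2 \<psi>) x) + wedge (d2 (d1 \<psi>) x) (d2 \<psi> x))"
    by (simp only: d2_add[OF smooth_smult_wedge[OF sm(4) sm1[OF sm2[OF sm(4)]]]
          smooth_smult_wedge[OF sm1[OF sm(4)] sm2[OF sm(4)]] x]
        d_wedge(2)[OF sm(4) sm1[OF sm2[OF sm(4)]] x] d_wedge(2)[OF sm1[OF sm(4)] sm2[OF sm(4)] x])
  finally show ?thesis
    unfolding psi_122[OF x] psi_21[OF x] psi_22[OF x] wedge_smult_right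
      wedge_swap[of "d1 \<psi> x" "\<psi> x"] wedge_swap[of "d1 (d2 \<psi>) x" "d2 \<psi> x"]
    by (intro exI[of _ "2 * \<i> * of_real (W x)"]) (simp add: vec_eq_iff field_simps)
qed

text \<open>With indices for derivatives, the first triple lies in the span of the wedges 0-1, 2-12
  and the difference of 0-12 and 1-2, the second in the span of 0-2, 1-12 and the sum of 0-12 and
  1-2. These are two orthogonal three-dimensional spaces, and conjugation preserves the
  second.\<close>

lemma sphere_triples_orthogonal:
  assumes x: "x \<in> \<Omega>"
    and "y \<in> {sphere_U \<psi> x, d2 (sphere_U \<psi>) x, d2 (d2 (sphere_U \<psi>)) x}"
    and "z \<in> {sphere_V \<psi> x, d1 (sphere_V \<psi>) x, d1 (d1 (sphere_V \<psi>)) x}"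
  shows "herm6 y z = 0"
proof -
  let ?a = "\<psi> x" and ?a1 = "d1 \<psi> x" and ?a2 = "d2 \<psi> x" and ?a12 = "d1 (d2 \<psi>) x"
  obtain k where k: "d1 (d1 (sphere_V \<psi>)) x = 4 *s wedge ?a1 ?a12 + k *s wedge ?a ?a2"
    using sphere_d11[OF x] by blast
  obtain l where l: "d2 (d2 (sphere_U \<psi>)) x = (4 * \<i>) *s wedge ?a2 ?a12 + l *s wedge ?a ?a1"
    using sphere_d22[OF x] by blast
  show ?thesis
    using assms(2,3)
    unfolding k l sphere_d1[OF x] sphere_d2[OF x] sphere_eq[OF x] herm6_eq_bil6
    by (elim insertE emptyE; simp add: cnj6_simps cnj6_normalized_frame[OF nf[OF x]] bil6_linear bil6_zeros
        bil6_normalized_frame[OF nf[OF x]])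
qed

lemma sphere_null:
  assumes x: "x \<in> \<Omega>"
  shows "herm6 (sphere_U \<psi> x) (sphere_U \<psi> x) = 0" "herm6 (sphere_V \<psi> x) (sphere_V \<psi> x) = 0"
  unfolding sphere_eq[OF x] herm6_eq_bil6
  by (simp_all add: cnj6_simps cnj6_normalized_frame[OF nf[OF x]] bil6_linear bil6_zeros)

lemma curvature_spheres_of_system:
  "curvature_spheres \<Omega> (\<lambda>x. re6 (sphere_U \<psi> x)) (\<lambda>x. re6 (sphere_V \<psi> x))"
  unfolding curvature_spheres_def
proof (intro conjI ballI open_dom)
  show "smooth_on \<Omega> (\<lambda>x. re6 (sphere_U \<psi> x))" "smooth_on \<Omega> (\<lambda>x. re6 (sphere_V \<psi> x))"
    by (intro smooth_on_bounded_linear[OF open_dom bounded_linear_re6] smooth_sphere)+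
  fix x assume x: "x \<in> \<Omega>"
  let ?a = "\<psi> x" and ?a1 = "d1 \<psi> x" and ?a2 = "d2 \<psi> x" and ?a12 = "d1 (d2 \<psi>) x"
  note cnj = cnj6_normalized_frame[OF nf[OF x]] and bil = bil6_normalized_frame[OF nf[OF x]]
  define U V U2 V1 where "U = sphere_U \<psi> x" "V = sphere_V \<psi> x" "U2 = d2 (sphere_U \<psi>) x" "V1 = d1 (sphere_V \<psi>) x"
  note UV = this
  have UV_eq: "U = (2 * \<i>) *s wedge ?a ?a1" "V = 2 *s wedge ?a ?a2"
    "U2 = (2 * \<i>) *s (wedge ?a ?a12 - wedge ?a1 ?a2)" "V1 = 2 *s (wedge ?a ?a12 + wedge ?a1 ?a2)"
    unfolding UV by (simp_all only: sphere_eq[OF x] sphere_d1[OF x] sphere_d2[OF x])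
  \<comment> \<open>Partners for the independence test. The null vectors \<open>U\<close> and
    \<open>V\<close> are detected by the complementary wedges \<open>F\<close> and \<open>E\<close>,
    where the factor \<open>\<i>\<close> makes \<open>F\<close> real; the derivatives
    \<open>U2\<close> and \<open>V1\<close> are not null and detect themselves.\<close>
  define E F where EF: "E = wedge ?a1 ?a12" "F = \<i> *s wedge ?a2 ?a12"
  have real: "cnj6 U = U" "cnj6 V = V" "cnj6 U2 = U2" "cnj6 V1 = V1" "cnj6 E = E" "cnj6 F = F"
    unfolding UV_eq EF by (simp_all add: cnj6_simps cnj vec_eq_iff)
  have lie: "lie_form (re6 y) (re6 z) = 0 \<longleftrightarrow> bil6 y z = 0"
    if "cnj6 y = y" "cnj6 z = z" for y z
    using lie_form_re6[OF that] by (metis of_real_eq_0_iff)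
  note zeros = bil6_linear bil6_zeros bil UV_eq EF
  show "lie_form (re6 (sphere_U \<psi> x)) (re6 (sphere_U \<psi> x)) = 0"
    "lie_form (re6 (sphere_U \<psi> x)) (re6 (sphere_V \<psi> x)) = 0"
    "lie_form (re6 (sphere_V \<psi> x)) (re6 (sphere_V \<psi> x)) = 0"
    unfolding UV[symmetric] by (simp_all only: lie real) (simp_all add: zeros)
  have d: "d1 (\<lambda>x. re6 (f x)) x = re6 (d1 f x)" "d2 (\<lambda>x. re6 (f x)) x = re6 (d2 f x)" if "smooth_on \<Omega> f" for f
    using that x by (simp_all add: d1_linear[OF bounded_linear_re6] d2_linear[OF bounded_linear_re6])
  have "d1 (sphere_U \<psi>) x = of_real (p x) *s V"
    unfolding sphere_d1[OF x] UV_eq by (simp add: vec_eq_iff)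
  then have "d1 (\<lambda>x. re6 (sphere_U \<psi> x)) x = p x *\<^sub>R re6 V"
    by (simp add: d smooth_sphere re6_of_real_smult)
  then show "d1 (\<lambda>x. re6 (sphere_U \<psi> x)) x \<in> span {re6 (sphere_U \<psi> x), re6 (sphere_V \<psi> x)}"
    by (simp add: UV span_base span_mul)
  have "d2 (\<lambda>x. re6 (sphere_V \<psi> x)) x = 0"
    by (simp add: d smooth_sphere sphere_d2[OF x]) (simp add: re6_def vec_eq_iff)
  then show "d2 (\<lambda>x. re6 (sphere_V \<psi> x)) x \<in> span {re6 (sphere_U \<psi> x), re6 (sphere_V \<psi> x)}"
    by (simp add: span_zero)
  have "distinct [re6 U, re6 V, re6 U2, re6 V1] \<and> independent {re6 U, re6 V, re6 U2, re6 V1}"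
    by (rule independent_4_by_dual[where u' = "re6 F" and v' = "re6 E" and a' = "re6 U2" and b' = "re6 V1"])
      (simp_all add: lie real, simp_all add: zeros)
  then show "distinct [re6 (sphere_U \<psi> x), re6 (sphere_V \<psi> x), d2 (\<lambda>x. re6 (sphere_U \<psi> x)) x, d1 (\<lambda>x. re6 (sphere_V \<psi> x)) x]"
    "independent {re6 (sphere_U \<psi> x), re6 (sphere_V \<psi> x), d2 (\<lambda>x. re6 (sphere_U \<psi> x)) x, d1 (\<lambda>x. re6 (sphere_V \<psi> x)) x}"
    unfolding UV by (simp_all add: d smooth_sphere)
qed

lemma d2_sphere_V: "x \<in> \<Omega> \<Longrightarrow> d2 (sphere_V \<psi>) x = 0"
  by (rule sphere_d2(2))

lemma canal_surface_of_system:
  "canal_surface \<Omega> (\<lambda>x. re6 (sphere_U \<psi> x)) (\<lambda>x. re6 (sphere_V \<psi> x))"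
  unfolding canal_surface_def
proof (intro conjI allI impI curvature_spheres_of_system)
  fix s t t' assume seg: "{s} \<times> closed_segment t t' \<subseteq> \<Omega>"
  have "\<exists>c. \<forall>u \<in> closed_segment t t'. sphere_V \<psi> (s, u) = c"
  proof (rule has_vector_derivative_zero_constant[OF convex_closed_segment])
    fix u assume "u \<in> closed_segment t t'"
    then have "(s, u) \<in> \<Omega>" using seg by auto
    then show "((\<lambda>u. sphere_V \<psi> (s, u)) has_vector_derivative 0) (at u within closed_segment t t')"
      using smooth_on_has_d2[OF smooth_sphere(2), of "(s, u)"] d2_sphere_V
      by (auto intro: has_vector_derivative_at_within)
  qed blast
  then have "sphere_V \<psi> (s, t) = sphere_V \<psi> (s, t')" by auto
  then show "same_sphere (re6 (sphere_V \<psi> (s, t))) (re6 (sphere_V \<psi> (s, t')))"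
    unfolding same_sphere_def by (intro exI[of _ 1]) simp
qed

end

section \<open>Linear differential equations\<close>

text \<open>Picard iteration with a Lipschitz constant valid for all values, as linear equations
  have it, so that only the time interval has to be shrunk. Continuity is asked for along continuous
  curves, which is the form in which the integral operator meets \<open>f\<close>.\<close>

lemma global_lipschitz_ode_solution:
  fixes f :: "real \<Rightarrow> 'a::banach \<Rightarrow> 'a"
  assumes "open I" "s0 \<in> I"
    and cont: "\<And>y. continuous_on UNIV y \<Longrightarrow> continuous_on I (\<lambda>s. f s (y s))"
    and lip: "\<And>s x y. s \<in> I \<Longrightarrow> norm (f s x - f s y) \<le> K * norm (x - y)"
  obtains e x where "e > 0" "ball s0 e \<subseteq> I" "x s0 = x0"
    "\<And>s. s \<in> ball s0 e \<Longrightarrow> (x has_vector_derivative f s (x s)) (at s)"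
proof -
  obtain r where r: "r > 0" "cball s0 r \<subseteq> I"
    using open_contains_cball assms(1,2) by metis
  define L where "L = \<bar>K\<bar> + 1"
  have L: "L > 0" "norm (f s x - f s y) \<le> L * norm (x - y)" if "s \<in> I" for s x y
    using order_trans[OF lip[OF that, of x y] mult_right_mono[of K L "norm (x - y)"]] by (auto simp: L_def)
  have L0: "L > 0" by (simp add: L_def)
  \<comment> \<open>A half-length of at most \<open>1 / (2 * L)\<close> makes the integral operator
    a contraction with factor 1/2.\<close>
  define e where "e = min r (1 / (2 * L))"
  have e: "e > 0" "e \<le> r" "e * L \<le> 1 / 2"
    using r L0 by (auto simp: e_def min_def field_simps)
  define a b where ab: "a = s0 - e" "b = s0 + e"
  have s0: "s0 \<in> {a..b}" using e by (simp add: ab)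
  have abI: "{a..b} \<subseteq> I" using r e by (auto simp: ab cball_eq_atLeastAtMost)
  \<comment> \<open>The difference of two integrals from \<open>a\<close> stands for the integral
    from \<open>s0\<close> to \<open>t\<close>, whichever of the two is larger.\<close>
  define F where "F = (\<lambda>(y :: real \<Rightarrow> 'a) t. x0 + (integral {a..t} (\<lambda>s. f s (y s)) - integral {a..s0} (\<lambda>s. f s (y s))))"
  have cf: "continuous_on {a..b} (\<lambda>s. f s (apply_bcontfun y s))" for y
    using continuous_on_subset[OF cont abI] by simp
  have int: "(\<lambda>s. f s (apply_bcontfun y s)) integrable_on {a..t}" if "t \<in> {a..b}" for y t
    using that by (intro integrable_continuous_real continuous_on_subset[OF cf]) auto
  \<comment> \<open>The fixed point is sought among bounded continuous functions on the whole line,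
    so the image under \<open>F\<close> is extended by constants outside the interval; this is what
    \<open>clamp\<close> does.\<close>
  have "\<exists>g :: real \<Rightarrow>\<^sub>C 'a. \<forall>t. apply_bcontfun g t = F (apply_bcontfun y) (clamp a b t)" for y
  proof -
    have "continuous_on (cbox a b) (F (apply_bcontfun y))"
      unfolding F_def using indefinite_integral_continuous_1[OF int[of b y]] e
      by (auto intro!: continuous_intros simp: ab)
    then show ?thesis by (rule continuous_on_cbox_bcontfunE) metis
  qed
  then obtain T :: "(real \<Rightarrow>\<^sub>C 'a) \<Rightarrow> (real \<Rightarrow>\<^sub>C 'a)"
    where T: "\<And>y t. apply_bcontfun (T y) t = F (apply_bcontfun y) (clamp a b t)" by metis
  have diff: "norm (F (apply_bcontfun y) t - F (apply_bcontfun z) t) \<le> 1 / 2 * dist y z" if t: "t \<in> {a..b}" for y z t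
  proof -
    let ?h = "\<lambda>s. f s (apply_bcontfun y s) - f s (apply_bcontfun z s)"
    have ih: "?h integrable_on {u..v}" if "{u..v} \<subseteq> {a..b}" for u v
      using that by (intro integrable_continuous_real continuous_on_subset[OF continuous_on_diff[OF cf cf]])
    have bd: "norm (integral {u..v} ?h) \<le> (L * dist y z) * (v - u)" if "{u..v} \<subseteq> {a..b}" "u \<le> v" for u v
    proof (rule integral_bound)
      show "continuous_on {u..v} ?h" using that continuous_on_subset[OF continuous_on_diff[OF cf cf]] by blast
      show "norm (?h s) \<le> L * dist y z" if "s \<in> {u..v}" for s
      proof -
        from \<open>s \<in> {u..v}\<close> have "s \<in> I" using \<open>{u..v} \<subseteq> {a..b}\<close> abI by auto
        then have "norm (?h s) \<le> L * norm (apply_bcontfun y s - apply_bcontfun z s)" by (rule L)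
        also have "\<dots> \<le> L * dist y z"
          using dist_bounded[of y s z] L0 by (simp add: dist_norm)
        finally show "norm (?h s) \<le> L * dist y z" .
      qed
    qed (use that in auto)
    have n: "p + q = w \<Longrightarrow> norm (p - w) = norm q" "p + q = w \<Longrightarrow> norm (w - p) = norm q" for p q w :: 'a
      by (auto simp: algebra_simps)
    have eq: "F (apply_bcontfun y) t - F (apply_bcontfun z) t = integral {a..t} ?h - integral {a..s0} ?h"
      using int[OF t] int[OF s0] by (simp add: F_def integral_diff)
    have "norm (integral {a..t} ?h - integral {a..s0} ?h) \<le> (L * dist y z) * e"
    proof (cases "t \<le> s0")
      case True
      then have "integral {a..t} ?h + integral {t..s0} ?h = integral {a..s0} ?h"
        using t s0 by (intro Henstock_Kurzweil_Integration.integral_combine ih) auto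
      then have "norm (integral {a..t} ?h - integral {a..s0} ?h) = norm (integral {t..s0} ?h)"
        by (rule n(1))
      also have "\<dots> \<le> (L * dist y z) * (s0 - t)" using True t s0 by (intro bd) auto
      also have "\<dots> \<le> (L * dist y z) * e" using t L0 by (intro mult_left_mono) (auto simp: ab)
      finally show ?thesis .
    next
      case False
      then have "integral {a..s0} ?h + integral {s0..t} ?h = integral {a..t} ?h"
        using t s0 by (intro Henstock_Kurzweil_Integration.integral_combine ih) auto
      then have "norm (integral {a..t} ?h - integral {a..s0} ?h) = norm (integral {s0..t} ?h)"
        by (rule n(2))
      also have "\<dots> \<le> (L * dist y z) * (t - s0)" using False t s0 by (intro bd) auto
      also have "\<dots> \<le> (L * dist y z) * e" using t L0 by (intro mult_left_mono) (auto simp: ab)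
      finally show ?thesis .
    qed
    also have "\<dots> = (e * L) * dist y z" by simp
    also have "\<dots> \<le> 1 / 2 * dist y z" using e by (intro mult_right_mono) auto
    finally show ?thesis unfolding eq .
  qed
  have "dist (T y) (T z) \<le> 1 / 2 * dist y z" for y z
  proof (rule dist_bound)
    fix t
    have "clamp a b t \<in> cbox a b" using e by (intro clamp_in_interval) (auto simp: ab)
    then show "dist (apply_bcontfun (T y) t) (apply_bcontfun (T z) t) \<le> 1 / 2 * dist y z"
      using diff[of "clamp a b t" y z] by (simp add: T dist_norm)
  qed
  then have "\<exists>!y. T y = y" by (intro banach_fix_type[of "1/2"]) auto
  then obtain y where "T y = y" by blast
  then have y: "apply_bcontfun y t = F (apply_bcontfun y) t" if "t \<in> {a..b}" for t
    using T[of y t] that clamp_cancel_cbox[of t a b] by (metis box_real(2))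
  show thesis
  proof
    show "e > 0" "ball s0 e \<subseteq> I" using e r by auto
    show "apply_bcontfun y s0 = x0" by (simp add: y[OF s0]) (simp add: F_def)
    fix s assume s: "s \<in> ball s0 e"
    then have "s \<in> interior {a..b}" by (auto simp: ab dist_real_def abs_less_iff)
    then have sab: "s \<in> {a..b}" and at: "at s within {a..b} = at s"
      using interior_subset at_within_interior by blast+
    have "(F (apply_bcontfun y) has_vector_derivative f s (apply_bcontfun y s)) (at s within {a..b})"
      unfolding F_def
      by (auto intro!: derivative_eq_intros integral_has_vector_derivative[OF cf sab])
    then have "(apply_bcontfun y has_vector_derivative f s (apply_bcontfun y s)) (at s within {a..b})"
      by (rule has_vector_derivative_transform[OF sab y, rotated])
    then show "(apply_bcontfun y has_vector_derivative f s (apply_bcontfun y s)) (at s)"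
      unfolding at .
  qed
qed

text \<open>Coefficients are bounded on a compact ball, which yields the Lipschitz constant.
  Smoothness is a bootstrap: if the solution is of class C^k, so is the right-hand side, hence the
  solution is of class C^(k+1).\<close>

lemma linear_system_smooth_solution:
  fixes a b c d :: "real \<Rightarrow> complex"
  assumes I: "open I" "s0 \<in> I"
    and sm: "smooth_on I a" "smooth_on I b" "smooth_on I c" "smooth_on I d"
  obtains e x y where "e > 0" "ball s0 e \<subseteq> I" "x s0 = x0" "y s0 = y0"
    "smooth_on (ball s0 e) x" "smooth_on (ball s0 e) y"
    "\<And>s. s \<in> ball s0 e \<Longrightarrow> (x has_vector_derivative a s * x s + b s * y s) (at s)"
    "\<And>s. s \<in> ball s0 e \<Longrightarrow> (y has_vector_derivative c s * x s + d s * y s) (at s)"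
proof -
  obtain r where r: "r > 0" "cball s0 r \<subseteq> I"
    using open_contains_cball I by metis
  have bnd: "\<exists>B. \<forall>s\<in>cball s0 r. norm (g s) \<le> B" if "smooth_on I g" for g :: "real \<Rightarrow> complex"
    using compact_imp_bounded[OF compact_continuous_image[OF continuous_on_subset[OF
            smooth_on_imp_continuous_on[OF that] r(2)] compact_cball]]
    unfolding bounded_iff by auto
  obtain A B C D where bd: "\<And>s. s \<in> cball s0 r \<Longrightarrow> norm (a s) \<le> A" "\<And>s. s \<in> cball s0 r \<Longrightarrow> norm (b s) \<le> B"
    "\<And>s. s \<in> cball s0 r \<Longrightarrow> norm (c s) \<le> C" "\<And>s. s \<in> cball s0 r \<Longrightarrow> norm (d s) \<le> D"
    using bnd[OF sm(1)] bnd[OF sm(2)] bnd[OF sm(3)] bnd[OF sm(4)] by metis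
  define f where "f = (\<lambda>s (z :: complex \<times> complex). (a s * fst z + b s * snd z, c s * fst z + d s * snd z))"
  have lip: "norm (f s z - f s w) \<le> (A + B + C + D) * norm (z - w)" if s: "s \<in> ball s0 r" for s z w
  proof -
    define u where "u = z - w"
    have u: "norm (fst u) \<le> norm u" "norm (snd u) \<le> norm u"
      using norm_fst_le[of "fst u" "snd u"] norm_snd_le[of "snd u" "fst u"] by simp_all
    have s': "s \<in> cball s0 r" using s by auto
    have m: "norm (p * q) \<le> P * norm u" if "norm p \<le> P" "norm q \<le> norm u" for p q :: complex and P
      using that by (simp add: norm_mult mult_mono')
    have "f s z - f s w = (a s * fst u + b s * snd u, c s * fst u + d s * snd u)"
      by (simp add: f_def u_def algebra_simps)
    then have "norm (f s z - f s w) \<le> norm (a s * fst u + b s * snd u) + norm (c s * fst u + d s * snd u)"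
      using norm_Pair_le by metis
    also have "\<dots> \<le> (norm (a s * fst u) + norm (b s * snd u)) + (norm (c s * fst u) + norm (d s * snd u))"
      by (intro add_mono norm_triangle_ineq)
    also have "\<dots> \<le> (A * norm u + B * norm u) + (C * norm u + D * norm u)"
      by (intro add_mono m bd u s')
    finally show ?thesis by (simp add: u_def algebra_simps)
  qed
  have br: "ball s0 r \<subseteq> I" using r by auto
  note c0 = continuous_on_subset[OF smooth_on_imp_continuous_on br]
  have cont: "continuous_on (ball s0 r) (\<lambda>s. f s (z s))" if "continuous_on UNIV z" for z
    unfolding f_def
    by (intro continuous_intros c0 sm continuous_on_subset[OF that subset_UNIV])
  obtain e z where e: "e > 0" "ball s0 e \<subseteq> ball s0 r" "z s0 = (x0, y0)"
    and z: "\<And>s. s \<in> ball s0 e \<Longrightarrow> (z has_vector_derivative f s (z s)) (at s)"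
    using global_lipschitz_ode_solution[OF open_ball _ cont lip] r by (metis centre_in_ball)
  define x y where xy: "x = (\<lambda>s. fst (z s))" "y = (\<lambda>s. snd (z s))"
  have dx: "(x has_vector_derivative a s * x s + b s * y s) (at s)"
    and dy: "(y has_vector_derivative c s * x s + d s * y s) (at s)" if "s \<in> ball s0 e" for s
    using bounded_linear.has_vector_derivative[OF bounded_linear_fst z[OF that]]
      bounded_linear.has_vector_derivative[OF bounded_linear_snd z[OF that]]
    by (simp_all add: xy f_def)
  have eI: "ball s0 e \<subseteq> I" using e br by auto
  have smo: "C_on k (ball s0 e) g" if "smooth_on I g" for g :: "real \<Rightarrow> complex" and k
    using smooth_on_subset[OF that eI] by (simp add: smooth_on_def)
  have "C_on k (ball s0 e) x \<and> C_on k (ball s0 e) y" for k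
  proof (induction k)
    case 0
    show ?case using dx dy
      by (auto intro!: continuous_at_imp_continuous_on has_vector_derivative_continuous)
  next
    case (Suc k)
    note m = bounded_bilinear.C_on[OF bounded_bilinear_mult open_ball]
    have x: "C_on k (ball s0 e) x" and y: "C_on k (ball s0 e) y" using Suc by auto
    show ?case
      using C_on_SucI_vector[OF open_ball dx C_on_add[OF open_ball m[OF smo[OF sm(1)] x] m[OF smo[OF sm(2)] y]]]
        C_on_SucI_vector[OF open_ball dy C_on_add[OF open_ball m[OF smo[OF sm(3)] x] m[OF smo[OF sm(4)] y]]]
      by blast
  qed
  then have "smooth_on (ball s0 e) x" "smooth_on (ball s0 e) y" by (auto simp: smooth_on_def)
  then show thesis using that[OF e(1) eI _ _ _ _ dx dy] e(3) by (simp add: xy)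
qed

section \<open>Lifting null vectors and frames\<close>

definition cvec6 :: "real^6 \<Rightarrow> complex^6" where
  "cvec6 v = (\<chi> k. of_real (v $ k))"

lemma cnj6_cvec6: "cnj6 (cvec6 v) = cvec6 v"
  by (simp add: cnj6_def cvec6_def vec_eq_iff)

lemma re6_cvec6: "re6 (cvec6 v) = v"
  by (simp add: re6_def cvec6_def vec_eq_iff)

lemma bil6_cvec6: "bil6 (cvec6 u) (cvec6 v) = of_real (lie_form u v)"
  by (simp add: bil6_def cvec6_def lie_form_def)

lemma bounded_linear_cvec6: "bounded_linear cvec6"
  unfolding linear_conv_bounded_linear[symmetric]
  by (rule linearI) (simp_all add: cvec6_def vec_eq_iff scaleR_conv_of_real[where 'a=complex])

lemma cvec6_re6: "cnj6 y = y \<Longrightarrow> cvec6 (re6 y) = y"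
  by (simp add: cvec6_def re6_def cnj6_def vec_eq_iff complex_eq_iff)

definition vec4 :: "complex \<Rightarrow> complex \<Rightarrow> complex \<Rightarrow> complex \<Rightarrow> complex^4" where
  "vec4 x0 x1 x2 x3 = (\<chi> i. if i = 0 then x0 else if i = 1 then x1 else if i = 2 then x2 else x3)"

lemma vec4_nth: "vec4 x0 x1 x2 x3 $ 0 = x0" "vec4 x0 x1 x2 x3 $ 1 = x1"
  "vec4 x0 x1 x2 x3 $ 2 = x2" "vec4 x0 x1 x2 x3 $ 3 = x3"
  by (simp_all add: vec4_def)

text \<open>For decomposable \<open>v\<close> the columns of the skew matrix of its Pluecker coordinates span the
  2-plane of \<open>v\<close>; two columns with a nonzero common minor form a basis of it.\<close>

lemma null_vector_decomposition:
  assumes "lie_form v0 v0 = 0" "v0 \<noteq> 0"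
  obtains f g :: "real^6 \<Rightarrow> complex^4" and q :: "real^6 \<Rightarrow> complex"
  where "bounded_linear f" "bounded_linear g" "bounded_linear q" "q v0 \<noteq> 0"
    "\<And>v. lie_form v v = 0 \<Longrightarrow> wedge (f v) (g v) = q v *s cvec6 v"
    "\<And>v. lie_form v v = 0 \<Longrightarrow> herm4 (f v) (f v) = 0"
    "\<And>v. lie_form v v = 0 \<Longrightarrow> herm4 (f v) (g v) = 0"
    "\<And>v. lie_form v v = 0 \<Longrightarrow> herm4 (g v) (g v) = 0"
proof -
  \<comment> \<open>Pluecker coordinates recovered from the hexaspherical ones; the Lie form is
    their Pluecker relation, see \<open>pl\<close>.\<close>
  define p01 p02 p03 p12 p31 p23 :: "real^6 \<Rightarrow> complex"
    where p: "p01 = (\<lambda>v. \<i> * of_real (v$4 + v$5))" "p02 = (\<lambda>v. of_real (v$0 + v$1))"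
      "p03 = (\<lambda>v. of_real (v$2) + \<i> * of_real (v$3))" "p12 = (\<lambda>v. of_real (v$2) - \<i> * of_real (v$3))"
      "p31 = (\<lambda>v. of_real (v$1 - v$0))" "p23 = (\<lambda>v. \<i> * of_real (v$5 - v$4))"
  define c0 c1 c2 c3 where c:
    "c0 = (\<lambda>v. vec4 0 (- p01 v) (- p02 v) (- p03 v))" "c1 = (\<lambda>v. vec4 (p01 v) 0 (- p12 v) (p31 v))"
    "c2 = (\<lambda>v. vec4 (p02 v) (p12 v) 0 (- p23 v))" "c3 = (\<lambda>v. vec4 (p03 v) (- p31 v) (p23 v) 0)"
  have linp: "bounded_linear p01" "bounded_linear p02" "bounded_linear p31" "bounded_linear p23"
    unfolding linear_conv_bounded_linear[symmetric]
    by (rule linearI; simp add: p algebra_simps scaleR_conv_of_real[where 'a=complex])+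
  have linc: "bounded_linear c0" "bounded_linear c1" "bounded_linear c2" "bounded_linear c3"
    unfolding linear_conv_bounded_linear[symmetric]
    by (rule linearI; simp add: c p vec_eq_iff forall_4_from_0 vec4_nth algebra_simps scaleR_conv_of_real[where 'a=complex])+
  have cv: "cvec6 v $ 0 = (p02 v - p31 v) / 2" "cvec6 v $ 1 = (p02 v + p31 v) / 2"
    "cvec6 v $ 2 = (p03 v + p12 v) / 2" "cvec6 v $ 3 = (p03 v - p12 v) / (2 * \<i>)"
    "cvec6 v $ 4 = (p01 v - p23 v) / (2 * \<i>)" "cvec6 v $ 5 = (p01 v + p23 v) / (2 * \<i>)" for v
    by (simp_all add: cvec6_def p field_simps)
  have pl: "p01 v * p23 v = - (p02 v * p31 v) - p03 v * p12 v" if "lie_form v v = 0" for v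
  proof -
    have "p01 v * p23 v + p02 v * p31 v + p03 v * p12 v = of_real (lie_form v v)"
      by (simp add: p lie_form_def algebra_simps)
    then show ?thesis using that by (simp add: algebra_simps eq_neg_iff_add_eq_0)
  qed
  have wI: "wedge a b = k *s cvec6 v"
    if "a$0 * b$1 - a$1 * b$0 = k * p01 v" "a$0 * b$2 - a$2 * b$0 = k * p02 v"
      "a$0 * b$3 - a$3 * b$0 = k * p03 v" "a$1 * b$2 - a$2 * b$1 = k * p12 v"
      "a$3 * b$1 - a$1 * b$3 = k * p31 v" "a$2 * b$3 - a$3 * b$2 = k * p23 v" for a b k v
    unfolding vec_eq_iff forall_6_from_0 wedge_components that vector_smult_component cv
    by (simp add: field_simps)
  have w: "wedge (c0 v) (c1 v) = p01 v *s cvec6 v" "wedge (c0 v) (c2 v) = p02 v *s cvec6 v"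
    "wedge (c3 v) (c1 v) = p31 v *s cvec6 v" "wedge (c2 v) (c3 v) = p23 v *s cvec6 v"
    if "lie_form v v = 0" for v
    by (rule wI; simp add: c vec4_nth; use pl[OF that] in algebra)+
  have h: "herm4 (c0 v) (c0 v) = 0" "herm4 (c0 v) (c1 v) = 0" "herm4 (c1 v) (c1 v) = 0"
    "herm4 (c0 v) (c2 v) = 0" "herm4 (c2 v) (c2 v) = 0" "herm4 (c3 v) (c1 v) = 0"
    "herm4 (c3 v) (c3 v) = 0" "herm4 (c2 v) (c3 v) = 0" if "lie_form v v = 0" for v
    by (simp_all add: herm4_def vec4_nth c p complex_eq_iff algebra_simps)
  \<comment> \<open>Four of the six coordinates suffice: if they all vanish, the Lie form of
    \<open>v0\<close> reduces to a sum of two squares, and a null \<open>v0\<close> would be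
    zero.\<close>
  have "p01 v0 \<noteq> 0 \<or> p02 v0 \<noteq> 0 \<or> p31 v0 \<noteq> 0 \<or> p23 v0 \<noteq> 0"
  proof (rule ccontr)
    assume "\<not> ?thesis"
    then have z: "v0$0 = 0" "v0$1 = 0" "v0$4 = 0" "v0$5 = 0"
      by (simp_all add: p complex_eq_iff)
    then have "v0$2 * v0$2 + v0$3 * v0$3 = 0" using assms(1) by (simp add: lie_form_def)
    then have "v0$2 = 0" "v0$3 = 0" by (simp_all add: sum_squares_eq_zero_iff)
    then have "v0 = 0" using z by (simp add: vec_eq_iff forall_6_from_0)
    then show False using assms(2) by simp
  qed
  then show thesis
    using that[OF linc(1,2) linp(1) _ w(1) h(1,2,3)] that[OF linc(1,3) linp(2) _ w(2) h(1,4,5)]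
      that[OF linc(4,2) linp(3) _ w(3) h(7,6,3)] that[OF linc(3,4) linp(4) _ w(4) h(5,8,7)]
    by blast
qed

text \<open>\<open>Q\<close> has the skew-Hermitian matrix with rows \<open>\<i> g0, h\<close> and
  \<open>- cnj h, \<i> g1\<close>, of determinant 1. So \<open>- \<i> Q\<close> is Hermitian of
  determinant -1, hence indefinite, and has two independent null vectors; suitably scaled they form
  the basis.\<close>

lemma skew_hermitian_basis:
  fixes g0 g1 :: real and h :: complex
  defines "Q \<equiv> \<lambda>c0 c1 d0 d1. \<i> * of_real g0 * c0 * cnj d0 + h * c0 * cnj d1
    - cnj h * c1 * cnj d0 + \<i> * of_real g1 * c1 * cnj d1"
  assumes det: "h * cnj h - of_real g0 * of_real g1 = 1"
  obtains c0 c1 e0 e1 where "c0 * e1 - c1 * e0 = 1" "Q c0 c1 c0 c1 = 0" "Q e0 e1 e0 e1 = 0" "Q c0 c1 e0 e1 = 1"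
proof (cases "g0 = 0")
  case True
  \<comment> \<open>Here the first coordinate vector is already null. A square root \<open>z\<close>
    of \<open>cnj h\<close>, which has modulus 1, gives \<open>h * z * z = 1\<close>, and the entry
    \<open>e0\<close> is chosen to cancel the term in \<open>g1\<close> in the norm of the second
    vector.\<close>
  define z where "z = csqrt (cnj h)"
  have h1: "h * cnj h = 1" using det True by simp
  have z2: "z * z = cnj h" by (metis z_def power2_csqrt power2_eq_square)
  have "(cmod h)\<^sup>2 = 1"
    using arg_cong[OF h1, of cmod] by (simp add: norm_mult power2_eq_square)
  then have "cmod h = 1" using norm_ge_zero[of h] by (auto simp: power2_eq_1_iff)
  then have "cmod z * cmod z = 1"
    using arg_cong[OF z2, of cmod] by (simp add: norm_mult)
  then have zz: "z * cnj z = 1" by (simp add: complex_norm_square[symmetric] power2_eq_square)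
  have hz: "h * z * z = 1" using h1 z2 by (simp add: mult.assoc)
  have hz': "cnj h * cnj z * cnj z = 1" using arg_cong[OF hz, of cnj] by simp
  show thesis
  proof (rule that[of z "cnj z" 0 "- \<i> * g1 / 2 * cnj h * cnj z"])
    have "h * (- \<i> * g1 / 2 * cnj h * cnj z) * z = - \<i> * g1 / 2 * (h * cnj h) * (z * cnj z)" by (simp add: mult_ac)
    moreover have "cnj h * cnj z * cnj (- \<i> * g1 / 2 * cnj h * cnj z) = \<i> * g1 / 2 * (h * cnj h) * (z * cnj z)" by (simp add: mult_ac)
    ultimately show "Q (- \<i> * g1 / 2 * cnj h * cnj z) (cnj z) (- \<i> * g1 / 2 * cnj h * cnj z) (cnj z) = 0"
      using zz unfolding Q_def by (simp add: True h1 mult.assoc)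
  qed (use zz hz in \<open>simp_all add: Q_def True mult_ac\<close>)
next
  case False
  define g where "g = complex_of_real g0"
  have g: "g \<noteq> 0" "cnj g = g" using False by (simp_all add: g_def)
  \<comment> \<open>Completing the square, \<open>Q\<close> on the vector \<open>(x, 1)\<close>
    equals \<open>\<i> g (|x - w|^2 - 1 / g^2)\<close>, so the null directions form a circle with
    centre \<open>w\<close>. The opposite points \<open>w + 1 / g\<close> and
    \<open>w - 1 / g\<close> are taken.\<close>
  define w where "w = - \<i> * cnj h / g"
  have w: "cnj w = \<i> * h / g" by (simp add: w_def g)
  have g1: "of_real g1 = (h * cnj h - 1) / g"
    using det g by (simp add: g_def field_simps)
  show thesis
  \<comment> \<open>Without the factors \<open>g (1 + \<i>) / 4\<close> and \<open>1 - \<i>\<close>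
    the determinant would be \<open>2 / g\<close> and the mixed product \<open>- 2 \<i> / g\<close>;
    these factors turn both into 1.\<close>
  proof (rule that[of "g * (1 + \<i>) / 4 * (w + 1 / g)" "1 - \<i>" "g * (1 + \<i>) / 4" "(1 - \<i>) * (w - 1 / g)"])
    show "g * (1 + \<i>) / 4 * (w + 1 / g) * (1 - \<i>) - g * (1 + \<i>) / 4 * ((1 - \<i>) * (w - 1 / g)) = 1"
      using g by (simp add: field_simps)
    show "Q (g * (1 + \<i>) / 4 * (w + 1 / g)) (g * (1 + \<i>) / 4) (g * (1 + \<i>) / 4 * (w + 1 / g)) (g * (1 + \<i>) / 4) = 0"
      unfolding Q_def g1 g_def[symmetric] by (simp add: g w) (use g in \<open>simp add: w_def field_simps\<close>)
    show "Q ((1 - \<i>) * (w - 1 / g)) (1 - \<i>) ((1 - \<i>) * (w - 1 / g)) (1 - \<i>) = 0"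
      unfolding Q_def g1 g_def[symmetric] by (simp add: g w) (use g in \<open>simp add: w_def field_simps\<close>)
    show "Q (g * (1 + \<i>) / 4 * (w + 1 / g)) (g * (1 + \<i>) / 4) ((1 - \<i>) * (w - 1 / g)) (1 - \<i>) = 1"
      unfolding Q_def g1 g_def[symmetric] by (simp add: g w) (use g in \<open>simp add: w_def field_simps\<close>)
  qed
qed

section \<open>Signature and inverse functions\<close>

lemma independent_3D:
  assumes "distinct [u, v, w]" "independent {u, v, w}" "a *\<^sub>R u + b *\<^sub>R v + c *\<^sub>R w = 0"
  shows "a = 0 \<and> b = 0 \<and> c = 0"
proof -
  define g where "g = (\<lambda>x. if x = u then a else if x = v then b else c)"
  have "(\<Sum>x\<in>{u, v, w}. g x *\<^sub>R x) = 0"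
    using assms(1,3) by (auto simp: g_def add.assoc)
  then have "\<forall>x\<in>{u, v, w}. g x = 0"
    using assms(2) independentD[of "{u,v,w}" "{u,v,w}" g] by auto
  then show ?thesis using assms(1) by (auto simp: g_def)
qed

text \<open>In signature (4,2) the isotropic plane of \<open>u\<close> and \<open>v\<close> projects
  injectively to the two negative coordinates 0 and 5. A vector of the plane can therefore remove
  these coordinates from a multiple of \<open>w\<close>; this leaves the norm of that multiple
  unchanged and exhibits it as a sum of squares.\<close>

lemma lie_form_pos:
  assumes null: "lie_form u u = 0" "lie_form u v = 0" "lie_form v v = 0"
    and w: "lie_form u w = 0" "lie_form v w = 0"
    and ind: "distinct [u, v, w]" "independent {u, v, w}"
  shows "lie_form w w > 0"
proof -
  note ind3 = independent_3D[OF ind]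
  interpret bounded_bilinear lie_form by (rule bounded_bilinear_lie_form)
  have comm: "lie_form x y = lie_form y x" for x y by (simp add: lie_form_def mult.commute)
  have squares: "lie_form z z \<ge> 0" "lie_form z z = 0 \<Longrightarrow> z = 0" if "z$0 = 0" "z$5 = 0" for z
  proof -
    have l: "lie_form z z = (z$1)\<^sup>2 + (z$2)\<^sup>2 + (z$3)\<^sup>2 + (z$4)\<^sup>2"
      using that by (simp add: lie_form_def power2_eq_square)
    show "lie_form z z \<ge> 0" unfolding l by simp
    assume "lie_form z z = 0"
    then have "z$1 = 0" "z$2 = 0" "z$3 = 0" "z$4 = 0"
      unfolding l by (simp_all add: add_nonneg_eq_0_iff)
    then show "z = 0" using that by (simp add: vec_eq_iff forall_6_from_0)
  qed
  have plane: "lie_form (a *\<^sub>R u + b *\<^sub>R v) (a *\<^sub>R u + b *\<^sub>R v) = 0" for a b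
    using null comm[of v u] by (simp add: add_left add_right scaleR_left scaleR_right)
  have inj: "a = 0 \<and> b = 0" if "(a *\<^sub>R u + b *\<^sub>R v)$0 = 0" "(a *\<^sub>R u + b *\<^sub>R v)$5 = 0" for a b
    using squares(2)[OF that plane] ind3[of a b 0] by simp
  define d where "d = u$0 * v$5 - u$5 * v$0"
  have d: "d \<noteq> 0"
  proof
    assume d0: "d = 0"
    have "v$0 = 0 \<and> - u$0 = 0" by (rule inj) (use d0 in \<open>simp_all add: d_def algebra_simps\<close>)
    moreover have "v$5 = 0 \<and> - u$5 = 0" by (rule inj) (use d0 in \<open>simp_all add: d_def algebra_simps\<close>)
    ultimately have "(1::real) = 0 \<and> (0::real) = 0" by (intro inj) simp_all
    then show False by simp
  qed
  \<comment> \<open>Cramer's rule with cleared denominators, \<open>d\<close> being the determinant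
    of the coordinates 0 and 5 of \<open>u\<close> and \<open>v\<close>.\<close>
  define a b where ab: "a = - (w$0 * v$5 - w$5 * v$0)" "b = - (u$0 * w$5 - u$5 * w$0)"
  define z where "z = a *\<^sub>R u + b *\<^sub>R v + d *\<^sub>R w"
  have z: "z$0 = 0" "z$5 = 0" by (simp_all add: z_def ab d_def algebra_simps)
  have "z \<noteq> 0" using ind3[of a b d] d by (auto simp: z_def)
  then have "lie_form z z > 0" using squares[OF z] by force
  moreover have "lie_form z z = d * d * lie_form w w"
    using null w comm[of v u] comm[of w u] comm[of w v]
    by (simp add: z_def add_left add_right scaleR_left scaleR_right)
  ultimately show ?thesis using d by (simp add: zero_less_mult_iff)
qed

text \<open>The line is embedded in the plane by \<open>r \<mapsto> (r, 0)\<close>, which reduces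
  the claim to composition in the plane.\<close>

lemma C_on_compose_real:
  fixes f :: "real \<Rightarrow> 'c::real_normed_vector" and g :: "'a::real_normed_vector \<Rightarrow> real"
  assumes "open T" "open S" "g ` T \<subseteq> S" "C_on k S f" "C_on k T g"
  shows "C_on k T (\<lambda>x. f (g x))"
proof -
  have op: "open (S \<times> (UNIV :: real set))" using assms(2) by (simp add: open_Times)
  have f: "C_on k (S \<times> UNIV) (\<lambda>y :: real \<times> real. f (fst y))"
    by (rule C_on_compose_linear[OF bounded_linear_fst op assms(2) _ assms(4)]) auto
  have "bounded_linear (\<lambda>r::real. (r, 0::real))"
    by (intro bounded_linear_Pair bounded_linear_ident bounded_linear_zero)
  then have g: "C_on k T (\<lambda>x. (g x, 0::real))"
    by (rule C_on_bounded_linear[OF assms(1) _ assms(5)])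
  have "(\<lambda>x. (g x, 0::real)) ` T \<subseteq> S \<times> UNIV" using assms(3) by auto
  from C_on_compose_plane[OF assms(1) op this f g] show ?thesis by simp
qed

text \<open>Rolle's theorem gives injectivity, invariance of domain the openness of the image, and
  the formula for the derivative of the inverse bootstraps its smoothness.\<close>

lemma smooth_inverse_function:
  fixes f :: "real \<Rightarrow> real"
  assumes J: "open J" "connected J" and f: "smooth_on J f"
    and nz: "\<And>t. t \<in> J \<Longrightarrow> vector_derivative f (at t) \<noteq> 0"
  shows "inj_on f J" "open (f ` J)" "connected (f ` J)" "smooth_on (f ` J) (inv_into J f)"
    "\<And>r. r \<in> f ` J \<Longrightarrow> (inv_into J f has_real_derivative
       inverse (vector_derivative f (at (inv_into J f r)))) (at r)"
proof -
  have df: "(f has_real_derivative vector_derivative f (at t)) (at t)" if "t \<in> J" for t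
    using smooth_on_has_vector_derivative[OF f that]
    by (simp add: has_real_derivative_iff_has_vector_derivative)
  have "f a \<noteq> f b" if ab: "a \<in> J" "b \<in> J" "a < b" for a b
  proof
    assume eq: "f a = f b"
    have sub: "{a..b} \<subseteq> J"
      using connected_contains_Icc[OF J(2)] ab by auto
    have "\<exists>z>a. z < b \<and> DERIV f z :> 0"
    proof (rule Rolle[OF ab(3) eq])
      show "continuous_on {a..b} f"
        using continuous_on_subset[OF smooth_on_imp_continuous_on[OF f] sub] .
      show "f differentiable (at x)" if "a < x" "x < b" for x
        using df[of x] sub that by (auto simp: real_differentiable_def subset_iff)
    qed
    then obtain z where z: "a < z" "z < b" "DERIV f z :> 0" by blast
    then have "z \<in> J" using sub by auto
    then show False using DERIV_unique[OF z(3) df] nz by metis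
  qed
  then show inj: "inj_on f J" by (metis linorder_neqE inj_onI)
  show op: "open (f ` J)"
    by (rule invariance_of_domain[OF smooth_on_imp_continuous_on[OF f] J(1) inj])
  show "connected (f ` J)"
    by (rule connected_continuous_image[OF smooth_on_imp_continuous_on[OF f] J(2)])
  show dinv: "(inv_into J f has_real_derivative
       inverse (vector_derivative f (at (inv_into J f r)))) (at r)" if "r \<in> f ` J" for r
  proof -
    obtain t where t: "t \<in> J" "r = f t" using \<open>r \<in> f ` J\<close> by blast
    have "(inv_into J f has_real_derivative inverse (vector_derivative f (at t))) (at (f t))"
      unfolding has_field_derivative_def
      by (rule has_derivative_inverse_strong[OF J(1) t(1) smooth_on_imp_continuous_on[OF f] _
            df[OF t(1), unfolded has_field_derivative_def]])
        (use nz[OF t(1)] inj in \<open>auto simp: inv_into_f_f\<close>)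
    then show ?thesis using t inj by (simp add: inv_into_f_f)
  qed
  have "C_on k (f ` J) (inv_into J f)" for k
  proof (induction k)
    case 0
    show ?case by (simp, intro continuous_at_imp_continuous_on ballI, rule DERIV_isCont[OF dinv])
  next
    case (Suc k)
    have nz': "vector_derivative f (at (inv_into J f r)) \<noteq> 0" if "r \<in> f ` J" for r
      using that by (intro nz inv_into_into)
    have "C_on k (f ` J) (\<lambda>r. vector_derivative f (at (inv_into J f r)))"
      using smooth_on_vector_derivative[OF J(1) f]
      by (intro C_on_compose_real[OF op J(1) _ _ Suc]) (auto simp: smooth_on_def inv_into_into)
    then have "C_on k (f ` J) (\<lambda>r. inverse (vector_derivative f (at (inv_into J f r))))"
      by (rule C_on_inverse[OF op, rotated]) (rule nz')
    then show ?case
      using dinv by (intro C_on_SucI_vector[OF op]) (simp_all add: has_real_derivative_iff_has_vector_derivative)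
  qed
  then show "smooth_on (f ` J) (inv_into J f)" by (simp add: smooth_on_def)
qed

section \<open>The spin lift of a null curve\<close>

abbreviation vd :: "(real \<Rightarrow> 'a::real_normed_vector) \<Rightarrow> real \<Rightarrow> 'a" where
  "vd f s \<equiv> vector_derivative f (at s)"

lemma vd_bilinear:
  assumes "bounded_bilinear m" "smooth_on S f" "smooth_on S g" "s \<in> S"
  shows "vd (\<lambda>s. m (f s) (g s)) s = m (f s) (vd g s) + m (vd f s) (g s)"
  using bounded_bilinear.has_vector_derivative[OF assms(1) smooth_on_has_vector_derivative[OF assms(2,4)]
      smooth_on_has_vector_derivative[OF assms(3,4)]]
  by (rule vector_derivative_at)

lemma vd_linear:
  assumes "bounded_linear L" "smooth_on S f" "s \<in> S"
  shows "vd (\<lambda>s. L (f s)) s = L (vd f s)"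
  using bounded_linear.has_vector_derivative[OF assms(1) smooth_on_has_vector_derivative[OF assms(2,3)]]
  by (rule vector_derivative_at)

lemma vd_add: "smooth_on S f \<Longrightarrow> smooth_on S g \<Longrightarrow> s \<in> S \<Longrightarrow> vd (\<lambda>s. f s + g s) s = vd f s + vd g s"
  by (intro vector_derivative_at has_vector_derivative_add smooth_on_has_vector_derivative)

lemma vd_cong:
  assumes "open S" "s \<in> S" "\<And>r. r \<in> S \<Longrightarrow> f r = g r"
  shows "vd f s = vd g s"
proof (rule vector_derivative_cong_eq)
  show "\<forall>\<^sub>F r in nhds s. r \<in> UNIV \<longrightarrow> f r = g r"
    using assms by (auto simp: eventually_nhds)
qed auto

lemma vd_zero:
  assumes "open S" "s \<in> S" "\<And>r. r \<in> S \<Longrightarrow> f r = 0"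
  shows "vd f s = 0"
  using vd_cong[OF assms(1,2), of f "\<lambda>_. 0"] assms(3) by simp

lemma vd_zero_constant:
  assumes "convex S" "smooth_on S f" "\<And>s. s \<in> S \<Longrightarrow> vd f s = 0" "s0 \<in> S" "s \<in> S"
  shows "f s = f s0"
proof -
  have "\<exists>c. \<forall>s\<in>S. f s = c"
  proof (rule has_vector_derivative_zero_constant[OF assms(1)])
    fix r assume "r \<in> S"
    then show "(f has_vector_derivative 0) (at r within S)"
      using smooth_on_has_vector_derivative[OF assms(2)] assms(3)
      by (metis has_vector_derivative_at_within)
  qed blast
  then show ?thesis using assms(4,5) by auto
qed

lemma bounded_bilinear_bil6: "bounded_bilinear bil6"
  unfolding bilinear_conv_bounded_bilinear[symmetric] bilinear_def
  by (auto intro!: linearI simp: bil6_def algebra_simps scaleR_conv_of_real[where 'a=complex])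

lemma herm4_derivatives:
  assumes "open S" "smooth_on S X" "smooth_on S Y" "s \<in> S"
    and "\<And>s. s \<in> S \<Longrightarrow> herm4 (X s) (Y s) = 0"
  shows "herm4 (X s) (vd Y s) + herm4 (vd X s) (Y s) = 0"
    "herm4 (X s) (vd (vd Y) s) + 2 * herm4 (vd X s) (vd Y s) + herm4 (vd (vd X) s) (Y s) = 0"
proof -
  have 1: "herm4 (X s) (vd Y s) + herm4 (vd X s) (Y s) = 0" if "s \<in> S" for s
    using vd_zero[OF assms(1) that assms(5)] vd_bilinear[OF bounded_bilinear_herm4 assms(2,3) that] by simp
  show "herm4 (X s) (vd Y s) + herm4 (vd X s) (Y s) = 0" by (rule 1[OF assms(4)])
  note sm = smooth_on_vector_derivative[OF assms(1,2)] smooth_on_vector_derivative[OF assms(1,3)]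
  note h = bounded_bilinear.smooth_on[OF bounded_bilinear_herm4 assms(1)]
  have "vd (\<lambda>s. herm4 (X s) (vd Y s) + herm4 (vd X s) (Y s)) s = 0"
    by (rule vd_zero[OF assms(1,4) 1])
  then show "herm4 (X s) (vd (vd Y) s) + 2 * herm4 (vd X s) (vd Y s) + herm4 (vd (vd X) s) (Y s) = 0"
    by (simp add: vd_add[OF h[OF assms(2) sm(2)] h[OF sm(1) assms(3)] assms(4)]
        vd_bilinear[OF bounded_bilinear_herm4 assms(2) sm(2) assms(4)]
        vd_bilinear[OF bounded_bilinear_herm4 sm(1) assms(3) assms(4)] add.assoc add.left_commute)
qed

text \<open>As second derivatives are orthogonal to the plane, differentiating
  \<open>herm4 (A s) (B s) = 0\<close> twice leaves \<open>herm4 (vd A s) (vd B s) = 0\<close>, and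
  then \<open>herm4 (vd A s) (B s)\<close> has zero derivative. The determinant needs an argument of
  its own, since the Gram relations fix only its modulus.\<close>

lemma normalized_frame_propagates:
  assumes S: "open S" "convex S" "s0 \<in> S"
    and sm: "smooth_on S X" "smooth_on S Y"
    and null: "\<And>s. s \<in> S \<Longrightarrow> herm4 (X s) (X s) = 0" "\<And>s. s \<in> S \<Longrightarrow> herm4 (X s) (Y s) = 0"
      "\<And>s. s \<in> S \<Longrightarrow> herm4 (Y s) (Y s) = 0"
    and par: "\<And>s. s \<in> S \<Longrightarrow> herm4 (vd (vd X) s) (X s) = 0" "\<And>s. s \<in> S \<Longrightarrow> herm4 (vd (vd X) s) (Y s) = 0"
      "\<And>s. s \<in> S \<Longrightarrow> herm4 (vd (vd Y) s) (X s) = 0" "\<And>s. s \<in> S \<Longrightarrow> herm4 (vd (vd Y) s) (Y s) = 0"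
    and init: "herm4 (vd X s0) (X s0) = 0" "herm4 (vd Y s0) (Y s0) = 0" "herm4 (vd X s0) (Y s0) = 1"
      "det4 (X s0) (vd X s0) (Y s0) (vd Y s0) = 1"
    and s: "s \<in> S"
  shows "normalized_frame (X s) (vd X s) (Y s) (vd Y s)"
proof -
  note sm1 = smooth_on_vector_derivative[OF S(1)]
  note hs = bounded_bilinear.smooth_on[OF bounded_bilinear_herm4 S(1)]
  have swap: "herm4 a b = 0 \<longleftrightarrow> herm4 b a = 0" for a b
    using herm4_cnj by (metis complex_cnj_zero_iff)
  have dd: "herm4 (vd A s) (vd B s) = 0" and const: "herm4 (vd A s) (B s) = herm4 (vd A s0) (B s0)"
    if AB: "smooth_on S A" "smooth_on S B" "\<And>s. s \<in> S \<Longrightarrow> herm4 (A s) (B s) = 0"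
      "\<And>s. s \<in> S \<Longrightarrow> herm4 (vd (vd A) s) (B s) = 0" "\<And>s. s \<in> S \<Longrightarrow> herm4 (vd (vd B) s) (A s) = 0" "s \<in> S" for A B s
  proof -
    have dd: "herm4 (vd A s) (vd B s) = 0" if "s \<in> S" for s
      using herm4_derivatives(2)[OF S(1) AB(1,2) that AB(3)] AB(4,5)[OF that] swap[of "A s" "vd (vd B) s"] by simp
    show "herm4 (vd A s) (vd B s) = 0" by (rule dd[OF AB(6)])
    have "vd (\<lambda>s. herm4 (vd A s) (B s)) s = 0" if "s \<in> S" for s
      using vd_bilinear[OF bounded_bilinear_herm4 sm1[OF AB(1)] AB(2) that] dd[OF that] AB(4)[OF that] by simp
    then show "herm4 (vd A s) (B s) = herm4 (vd A s0) (B s0)"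
      by (rule vd_zero_constant[OF S(2) hs[OF sm1[OF AB(1)] AB(2)] _ S(3) AB(6)])
  qed
  have null': "herm4 (Y s) (X s) = 0" if "s \<in> S" for s using null(2)[OF that] swap by blast
  have gram: "gram_frame (X s) (vd X s) (Y s) (vd Y s)" if s: "s \<in> S" for s
  proof -
    have xx: "herm4 (vd X s) (X s) = 0" using const[OF sm(1,1) null(1) par(1,1) s] init by simp
    have yy: "herm4 (vd Y s) (Y s) = 0" using const[OF sm(2,2) null(3) par(4,4) s] init by simp
    have xy: "herm4 (vd X s) (Y s) = 1" using const[OF sm null(2) par(2,3) s] init by simp
    have yx: "herm4 (Y s) (vd X s) = 1" using arg_cong[OF xy, of cnj] by (simp add: herm4_cnj)
    have xy': "herm4 (X s) (vd Y s) = -1"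
      using herm4_derivatives(1)[OF S(1) sm s null(2)] xy by (simp add: eq_neg_iff_add_eq_0)
    then have yx': "herm4 (vd Y s) (X s) = -1"
      by (metis herm4_cnj complex_cnj_minus complex_cnj_one)
    show ?thesis
      unfolding gram_frame_def
      using xy' yx' null null' s xx yy xy yx swap dd[OF sm(1,1) null(1) par(1,1) s] dd[OF sm(2,2) null(3) par(4,4) s]
        dd[OF sm null(2) par(2,3) s] by auto
  qed
  \<comment> \<open>The determinant is twice the pairing of \<open>A\<close> and \<open>F\<close>.
    The derivatives of both are multiples of \<open>wedge (X s) (Y s)\<close>, which shares a factor
    with each of them, so the pairing is constant.\<close>
  define A where "A = (\<lambda>s. wedge (X s) (vd X s))"
  define F where "F = (\<lambda>s. wedge (Y s) (vd Y s))"
  note ws = bounded_bilinear.smooth_on[OF bounded_bilinear_wedge S(1)]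
  have smA: "smooth_on S A" "smooth_on S F"
    unfolding A_def F_def using ws sm sm1 by blast+
  have "vd (\<lambda>s. bil6 (A s) (F s)) s = 0" if s: "s \<in> S" for s
  proof -
    have "vd (vd X) s = (- herm4 (vd (vd X) s) (vd Y s)) *s X s + herm4 (vd (vd X) s) (vd X s) *s Y s"
      using gram_frame_expansion[OF gram[OF s], of "vd (vd X) s"] par(1,2)[OF s] by (simp add: vec_eq_iff)
    then obtain k l where X2: "vd (vd X) s = k *s X s + l *s Y s" by blast
    have "vd (vd Y) s = (- herm4 (vd (vd Y) s) (vd Y s)) *s X s + herm4 (vd (vd Y) s) (vd X s) *s Y s"
      using gram_frame_expansion[OF gram[OF s], of "vd (vd Y) s"] par(3,4)[OF s] by (simp add: vec_eq_iff)
    then obtain k' l' where Y2: "vd (vd Y) s = k' *s X s + l' *s Y s" by blast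
    have A: "vd A s = l *s wedge (X s) (Y s)"
      unfolding A_def vd_bilinear[OF bounded_bilinear_wedge sm(1) sm1[OF sm(1)] s] X2
      by (simp add: wedge_self wedge_add_right wedge_smult_right)
    have F: "vd F s = k' *s wedge (Y s) (X s)"
      unfolding F_def vd_bilinear[OF bounded_bilinear_wedge sm(2) sm1[OF sm(2)] s] Y2
      by (simp add: wedge_self wedge_add_right wedge_smult_right)
    have "bil6 (A s) (vd F s) = 0"
      unfolding F by (simp add: A_def bil6_linear bil6_zeros)
    moreover have "bil6 (vd A s) (F s) = 0"
      unfolding A by (simp add: F_def bil6_linear bil6_zeros)
    ultimately show ?thesis
      using vd_bilinear[OF bounded_bilinear_bil6 smA s] by simp
  qed
  then have "bil6 (A s) (F s) = bil6 (A s0) (F s0)"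
    by (rule vd_zero_constant[OF S(2) bounded_bilinear.smooth_on[OF bounded_bilinear_bil6 S(1) smA] _ S(3) s])
  then have "det4 (X s) (vd X s) (Y s) (vd Y s) = 1"
    using init by (simp add: A_def F_def bil6_wedge)
  then show ?thesis using gram[OF s] by (simp add: normalized_frame_iff)
qed

lemma vd_combination:
  fixes x y :: "real \<Rightarrow> complex" and \<xi> \<eta> :: "real \<Rightarrow> complex^'n"
  assumes S: "open S" "s \<in> S" and sm: "smooth_on S x" "smooth_on S y" "smooth_on S \<xi>" "smooth_on S \<eta>"
  shows "vd (\<lambda>s. x s *s \<xi> s + y s *s \<eta> s) s = (x s *s vd \<xi> s + y s *s vd \<eta> s) + (vd x s *s \<xi> s + vd y s *s \<eta> s)" (is ?A)
    and "vd (vd (\<lambda>s. x s *s \<xi> s + y s *s \<eta> s)) s = (x s *s vd (vd \<xi>) s + y s *s vd (vd \<eta>) s)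
      + 2 *s (vd x s *s vd \<xi> s + vd y s *s vd \<eta> s) + (vd (vd x) s *s \<xi> s + vd (vd y) s *s \<eta> s)" (is ?B)
proof -
  note bs = bounded_bilinear.smooth_on[OF bounded_bilinear_smult S(1)]
  have 1: "vd (\<lambda>s. x s *s \<xi> s + y s *s \<eta> s) s = (x s *s vd \<xi> s + y s *s vd \<eta> s) + (vd x s *s \<xi> s + vd y s *s \<eta> s)"
    if "s \<in> S" "smooth_on S x" "smooth_on S y" "smooth_on S \<xi>" "smooth_on S \<eta>"
    for s x y and \<xi> \<eta> :: "real \<Rightarrow> complex^'n"
    using that by (simp add: vd_add[OF bs bs] vd_bilinear[OF bounded_bilinear_smult])
  note sm1 = smooth_on_vector_derivative[OF S(1)]
  note c = smooth_on_add[OF S(1) bs bs]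
  show ?A
    by (rule 1[OF S(2) sm])
  have "vd (vd (\<lambda>s. x s *s \<xi> s + y s *s \<eta> s)) s
      = vd (\<lambda>s. (x s *s vd \<xi> s + y s *s vd \<eta> s) + (vd x s *s \<xi> s + vd y s *s \<eta> s)) s"
    by (rule vd_cong[OF S 1[OF _ sm]])
  also have "\<dots> = vd (\<lambda>s. x s *s vd \<xi> s + y s *s vd \<eta> s) s + vd (\<lambda>s. vd x s *s \<xi> s + vd y s *s \<eta> s) s"
    by (rule vd_add[OF c[OF sm(1) sm1[OF sm(3)] sm(2) sm1[OF sm(4)]] c[OF sm1[OF sm(1)] sm(3) sm1[OF sm(2)] sm(4)] S(2)])
  finally show ?B
    unfolding 1[OF S(2) sm(1,2) sm1[OF sm(3)] sm1[OF sm(4)]] 1[OF S(2) sm1[OF sm(1)] sm1[OF sm(2)] sm(3,4)]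
    by (simp add: vec_eq_iff algebra_simps)
qed

text \<open>Along a null curve a Lagrangian basis is moved by \<open>GL(2, \<complex>)\<close> so that its second
  derivatives stay in the 2-plane; this is a linear equation for the coefficients.\<close>

lemma spin_lift_normalized:
  fixes v :: "real \<Rightarrow> real^6"
  assumes I: "open I" "s0 \<in> I" and v: "smooth_on I v" and null: "\<And>s. s \<in> I \<Longrightarrow> lie_form (v s) (v s) = 0"
    and v0: "v s0 \<noteq> 0" and v1: "lie_form (vd v s0) (vd v s0) = 1"
  obtains e X Y where "e > 0" "ball s0 e \<subseteq> I" "smooth_on (ball s0 e) X" "smooth_on (ball s0 e) Y"
    "\<And>s. s \<in> ball s0 e \<Longrightarrow> normalized_frame (X s) (vd X s) (Y s) (vd Y s)"
    "\<And>s. s \<in> ball s0 e \<Longrightarrow> herm4 (vd (vd X) s) (X s) = 0 \<and> herm4 (vd (vd X) s) (Y s) = 0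
       \<and> herm4 (vd (vd Y) s) (X s) = 0 \<and> herm4 (vd (vd Y) s) (Y s) = 0"
    "\<And>s. s \<in> ball s0 e \<Longrightarrow> \<exists>k. wedge (X s) (Y s) = k *s cvec6 (v s)"
proof -
  obtain f g q where lin: "bounded_linear f" "bounded_linear g" "bounded_linear q"
    and q0: "q (v s0) \<noteq> 0"
    and fg: "\<And>v. lie_form v v = 0 \<Longrightarrow> wedge (f v) (g v) = q v *s cvec6 v"
    "\<And>v. lie_form v v = 0 \<Longrightarrow> herm4 (f v) (f v) = 0"
    "\<And>v. lie_form v v = 0 \<Longrightarrow> herm4 (f v) (g v) = 0"
    "\<And>v. lie_form v v = 0 \<Longrightarrow> herm4 (g v) (g v) = 0"
    by (rule null_vector_decomposition[OF null[OF I(2)] v0]) (rule that, assumption+)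
  have qv: "smooth_on I (\<lambda>s. q (v s))" by (rule smooth_on_bounded_linear[OF I(1) lin(3) v])
  define S where "S = {s \<in> I. q (v s) \<noteq> 0}"
  have "S = I \<inter> (\<lambda>s. q (v s)) -` (- {0})" by (auto simp: S_def)
  then have S: "open S" "s0 \<in> S" "S \<subseteq> I"
    using continuous_on_open_vimage[OF I(1), THEN iffD1, OF smooth_on_imp_continuous_on[OF qv]] I q0
    by (auto simp: S_def open_Compl Int_commute)
  \<comment> \<open>Dividing by \<open>q\<close> makes the wedge of the basis equal to
    \<open>cvec6 (v s)\<close> itself, so the tangent of \<open>v\<close> is expressed by the basis
    and its derivatives.\<close>
  define \<xi> \<eta> where "\<xi> = (\<lambda>s. f (v s))" "\<eta> = (\<lambda>s. (1 / q (v s)) *s g (v s))"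
  note \<xi>\<eta> = this
  note vS = smooth_on_subset[OF v S(3)]
  have sm: "smooth_on S \<xi>" "smooth_on S \<eta>"
    unfolding \<xi>\<eta>
    by (rule smooth_on_bounded_linear[OF S(1) lin(1) vS],
        rule bounded_bilinear.smooth_on[OF bounded_bilinear_smult S(1)
          smooth_on_divide[OF S(1) smooth_on_const[OF S(1)] smooth_on_bounded_linear[OF S(1) lin(3) vS]]
          smooth_on_bounded_linear[OF S(1) lin(2) vS]])
      (simp add: S_def)
  have lag: "herm4 (\<xi> s) (\<xi> s) = 0" "herm4 (\<xi> s) (\<eta> s) = 0" "herm4 (\<eta> s) (\<xi> s) = 0" "herm4 (\<eta> s) (\<eta> s) = 0"
    and w\<xi>\<eta>: "wedge (\<xi> s) (\<eta> s) = cvec6 (v s)" if "s \<in> S" for s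
  proof -
    have n: "lie_form (v s) (v s) = 0" "q (v s) \<noteq> 0" using null that by (auto simp: S_def)
    show "herm4 (\<xi> s) (\<xi> s) = 0" "herm4 (\<xi> s) (\<eta> s) = 0" "herm4 (\<eta> s) (\<eta> s) = 0"
      unfolding \<xi>\<eta> herm4_smult_left herm4_smult_right using fg[OF n(1)] by simp_all
    then show "herm4 (\<eta> s) (\<xi> s) = 0" by (metis herm4_cnj complex_cnj_zero)
    show "wedge (\<xi> s) (\<eta> s) = cvec6 (v s)"
      unfolding \<xi>\<eta> wedge_smult_right fg(1)[OF n(1)] using n by (simp add: vec_eq_iff)
  qed
  note sm1 = smooth_on_vector_derivative[OF S(1)]
  note hs = bounded_bilinear.smooth_on[OF bounded_bilinear_herm4 S(1)]
  \<comment> \<open>\<open>G\<close> and \<open>M\<close> collect the products of the first and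
    second derivatives with the basis. They are what matters because the Lagrangian plane is its own
    orthogonal complement.\<close>
  define G00 G01 G10 G11 where G: "G00 = (\<lambda>s. herm4 (vd \<xi> s) (\<xi> s))" "G01 = (\<lambda>s. herm4 (vd \<xi> s) (\<eta> s))"
    "G10 = (\<lambda>s. herm4 (vd \<eta> s) (\<xi> s))" "G11 = (\<lambda>s. herm4 (vd \<eta> s) (\<eta> s))"
  define M00 M01 M10 M11 where M: "M00 = (\<lambda>s. herm4 (vd (vd \<xi>) s) (\<xi> s))" "M01 = (\<lambda>s. herm4 (vd (vd \<xi>) s) (\<eta> s))"
    "M10 = (\<lambda>s. herm4 (vd (vd \<eta>) s) (\<xi> s))" "M11 = (\<lambda>s. herm4 (vd (vd \<eta>) s) (\<eta> s))"
  have smG: "smooth_on S G00" "smooth_on S G01" "smooth_on S G10" "smooth_on S G11"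
    unfolding G using hs sm sm1 by blast+
  have smM: "smooth_on S M00" "smooth_on S M01" "smooth_on S M10" "smooth_on S M11"
    unfolding M using hs sm sm1 by blast+
  define D where "D = (\<lambda>s. G00 s * G11 s - G01 s * G10 s)"
  have smD: "smooth_on S D"
    unfolding D_def by (intro smooth_on_diff smooth_on_mult smG S)
  have skew: "herm4 (\<xi> s0) (vd \<xi> s0) = - G00 s0" "herm4 (\<xi> s0) (vd \<eta> s0) = - G01 s0"
    "herm4 (\<eta> s0) (vd \<xi> s0) = - G10 s0" "herm4 (\<eta> s0) (vd \<eta> s0) = - G11 s0"
    using herm4_derivatives(1)[OF S(1) sm(1) sm(1) S(2) lag(1)] herm4_derivatives(1)[OF S(1) sm(1) sm(2) S(2) lag(2)]
      herm4_derivatives(1)[OF S(1) sm(2) sm(1) S(2) lag(3)] herm4_derivatives(1)[OF S(1) sm(2) sm(2) S(2) lag(4)]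
    by (simp_all add: G eq_neg_iff_add_eq_0)
  have cnjG: "cnj (G00 s0) = - G00 s0" "cnj (G01 s0) = - G10 s0" "cnj (G10 s0) = - G01 s0" "cnj (G11 s0) = - G11 s0"
    using skew by (simp_all add: G herm4_cnj)
  have dv: "cvec6 (vd v s0) = wedge (\<xi> s0) (vd \<eta> s0) + wedge (vd \<xi> s0) (\<eta> s0)"
    using vd_cong[OF S(1,2) w\<xi>\<eta>] vd_bilinear[OF bounded_bilinear_wedge sm S(2)]
      vd_linear[OF bounded_linear_cvec6 vS S(2)] by simp
  have dets: "det4 p q r t = det4 p r t q" "det4 r t p q = det4 p r t q" for p q r t
    by (simp_all add: det4_eq algebra_simps)
  \<comment> \<open>The real unit vector \<open>vd v s0\<close> is measured twice:
    \<open>bil6\<close> yields the determinant of the frame, \<open>herm6\<close> the determinant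
    \<open>D\<close> of the products in \<open>G\<close>.\<close>
  have "bil6 (cvec6 (vd v s0)) (cvec6 (vd v s0)) = 1" by (simp add: bil6_cvec6 v1)
  then have "det4 (\<xi> s0) (vd \<eta> s0) (vd \<xi> s0) (\<eta> s0) / 2 + det4 (vd \<xi> s0) (\<eta> s0) (\<xi> s0) (vd \<eta> s0) / 2 = 1"
    unfolding dv bil6_add_left bil6_add_right bil6_wedge by (simp add: det4_permute add.commute)
  then have det: "det4 (\<xi> s0) (vd \<xi> s0) (\<eta> s0) (vd \<eta> s0) = 1"
    using dets(1)[of "\<xi> s0" "vd \<eta> s0" "vd \<xi> s0" "\<eta> s0"] dets(2)[of "vd \<xi> s0" "\<eta> s0" "\<xi> s0" "vd \<eta> s0"]
    by simp
  have "herm6 (cvec6 (vd v s0)) (cvec6 (vd v s0)) = 1" by (simp add: herm6_eq_bil6 cnj6_cvec6 bil6_cvec6 v1)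
  then have "4 * D s0 = 4 * 1"
    unfolding dv herm6_eq_bil6 cnj6_simps bil6_add_left bil6_add_right
    unfolding herm6_eq_bil6[symmetric] herm6_wedge
    using lag[OF S(2)] skew by (simp add: D_def G field_simps)
  then have D0: "D s0 = 1" by (simp only: mult_cancel_left) simp
  define T where "T = {s \<in> S. D s \<noteq> 0}"
  have "T = S \<inter> D -` (- {0})" by (auto simp: T_def)
  then have T: "open T" "s0 \<in> T" "T \<subseteq> S"
    using continuous_on_open_vimage[OF S(1), THEN iffD1, OF smooth_on_imp_continuous_on[OF smD]] S D0
    by (auto simp: T_def open_Compl Int_commute)
  \<comment> \<open>Cramer's rule for the derivatives of \<open>x\<close> and \<open>y\<close> in
    the requirement that the second derivative of \<open>x *s \<xi> + y *s \<eta>\<close> be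
    orthogonal to \<open>\<xi>\<close> and \<open>\<eta>\<close>. The 2 is the factor of the cross
    term in that second derivative.\<close>
  define a b c d where abcd:
    "a = (\<lambda>s. (G10 s * M01 s - G11 s * M00 s) / (2 * D s))" "b = (\<lambda>s. (G10 s * M11 s - G11 s * M10 s) / (2 * D s))"
    "c = (\<lambda>s. (G01 s * M00 s - G00 s * M01 s) / (2 * D s))" "d = (\<lambda>s. (G01 s * M10 s - G00 s * M11 s) / (2 * D s))"
  note toT = smooth_on_subset[OF _ T(3)]
  have smabcd: "smooth_on T a" "smooth_on T b" "smooth_on T c" "smooth_on T d"
    unfolding abcd
    by (intro smooth_on_divide smooth_on_diff smooth_on_mult T(1) toT smG smM smD smooth_on_const[OF S(1)];
        simp add: T_def)+
  have cnjh: "cnj (G01 s0) = - G10 s0" "G00 s0 = \<i> * of_real (Im (G00 s0))" "G11 s0 = \<i> * of_real (Im (G11 s0))"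
    using cnjG by (simp_all add: complex_eq_iff)
  \<comment> \<open>Differentiating the coefficients only adds vectors of the isotropic plane, so
    \<open>Q\<close> gives the initial products of \<open>vd X\<close> and \<open>vd Y\<close> with
    \<open>X\<close> and \<open>Y\<close> in terms of the initial coefficients.\<close>
  define Q where "Q = (\<lambda>c0 c1 d0 d1. \<i> * of_real (Im (G00 s0)) * c0 * cnj d0 + G01 s0 * c0 * cnj d1
    - cnj (G01 s0) * c1 * cnj d0 + \<i> * of_real (Im (G11 s0)) * c1 * cnj d1)"
  have Q: "herm4 (c0 *s vd \<xi> s0 + c1 *s vd \<eta> s0) (d0 *s \<xi> s0 + d1 *s \<eta> s0) = Q c0 c1 d0 d1" for c0 c1 d0 d1
    unfolding Q_def cnjh(2,3)[symmetric] cnjh(1)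
    by (simp add: herm4_add_left herm4_add_right herm4_smult_left herm4_smult_right G algebra_simps)
  have "G01 s0 * cnj (G01 s0) - of_real (Im (G00 s0)) * of_real (Im (G11 s0)) = 1"
  proof -
    have "G00 s0 * G11 s0 = - (of_real (Im (G00 s0)) * of_real (Im (G11 s0)))"
      using cnjh by (metis (no_types, opaque_lifting) mult.assoc mult.left_commute i_squared mult_minus1 power2_eq_square power2_i)
    then show ?thesis using D0 unfolding D_def cnjG(2) by algebra
  qed
  then obtain c0 c1 e0 e1 where ce: "c0 * e1 - c1 * e0 = 1" "Q c0 c1 c0 c1 = 0" "Q e0 e1 e0 e1 = 0" "Q c0 c1 e0 e1 = 1"
    by (rule skew_hermitian_basis) (rule that; simp only: Q_def)
  obtain r1 x y where xy: "r1 > 0" "ball s0 r1 \<subseteq> T" "x s0 = c0" "y s0 = c1"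
    "smooth_on (ball s0 r1) x" "smooth_on (ball s0 r1) y"
    "\<And>s. s \<in> ball s0 r1 \<Longrightarrow> (x has_vector_derivative a s * x s + b s * y s) (at s)"
    "\<And>s. s \<in> ball s0 r1 \<Longrightarrow> (y has_vector_derivative c s * x s + d s * y s) (at s)"
    by (rule linear_system_smooth_solution[OF T(1,2) smabcd, of c0 c1]) (rule that, assumption+)
  obtain r2 z w where zw: "r2 > 0" "ball s0 r2 \<subseteq> T" "z s0 = e0" "w s0 = e1"
    "smooth_on (ball s0 r2) z" "smooth_on (ball s0 r2) w"
    "\<And>s. s \<in> ball s0 r2 \<Longrightarrow> (z has_vector_derivative a s * z s + b s * w s) (at s)"
    "\<And>s. s \<in> ball s0 r2 \<Longrightarrow> (w has_vector_derivative c s * z s + d s * w s) (at s)"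
    by (rule linear_system_smooth_solution[OF T(1,2) smabcd, of e0 e1]) (rule that, assumption+)
  define B where "B = ball s0 (min r1 r2)"
  have B: "open B" "convex B" "s0 \<in> B" "B \<subseteq> ball s0 r1" "B \<subseteq> ball s0 r2"
    "B \<subseteq> T" "B \<subseteq> S" "B \<subseteq> I"
  proof -
    show B1: "open B" "convex B" "s0 \<in> B" "B \<subseteq> ball s0 r1" "B \<subseteq> ball s0 r2"
      using xy(1) zw(1) by (auto simp: B_def)
    show "B \<subseteq> T" using B1(4) xy(2) by (rule order_trans)
    then show "B \<subseteq> S" using T(3) by (rule order_trans)
    then show "B \<subseteq> I" using S(3) by (rule order_trans)
  qed
  have par: "herm4 (vd (vd (\<lambda>s. x s *s \<xi> s + y s *s \<eta> s)) s) (\<xi> s) = 0"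
    "herm4 (vd (vd (\<lambda>s. x s *s \<xi> s + y s *s \<eta> s)) s) (\<eta> s) = 0"
    if "s \<in> B" "smooth_on B x" "smooth_on B y"
      "(x has_vector_derivative a s * x s + b s * y s) (at s)"
      "(y has_vector_derivative c s * x s + d s * y s) (at s)" for s x y
  proof -
    have D: "D s \<noteq> 0" using that(1) B(6) by (auto simp: T_def)
    have ds: "vd x s = a s * x s + b s * y s" "vd y s = c s * x s + d s * y s"
      using that(4,5) by (auto intro: vector_derivative_at)
    note lag' = lag[OF subsetD[OF B(7) that(1)]]
    have "G00 s * G11 s = D s + G01 s * G10 s" by (simp add: D_def)
    then have "(x s * M00 s + y s * M10 s) + 2 * (vd x s * G00 s + vd y s * G10 s) = 0"
      "(x s * M01 s + y s * M11 s) + 2 * (vd x s * G01 s + vd y s * G11 s) = 0"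
      unfolding ds abcd using D by (simp_all add: field_simps) (simp_all add: D_def algebra_simps)
    then show "herm4 (vd (vd (\<lambda>s. x s *s \<xi> s + y s *s \<eta> s)) s) (\<xi> s) = 0"
      "herm4 (vd (vd (\<lambda>s. x s *s \<xi> s + y s *s \<eta> s)) s) (\<eta> s) = 0"
      unfolding vd_combination(2)[OF B(1) that(1-3) smooth_on_subset[OF sm(1) B(7)] smooth_on_subset[OF sm(2) B(7)]]
        herm4_add_left herm4_smult_left lag' by (simp_all add: G M)
  qed
  define X Y where "X = (\<lambda>s. x s *s \<xi> s + y s *s \<eta> s)" "Y = (\<lambda>s. z s *s \<xi> s + w s *s \<eta> s)"
  note XY = this
  note smB = smooth_on_subset[OF sm(1) B(7)] smooth_on_subset[OF sm(2) B(7)]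
    smooth_on_subset[OF xy(5) B(4)] smooth_on_subset[OF xy(6) B(4)]
    smooth_on_subset[OF zw(5) B(5)] smooth_on_subset[OF zw(6) B(5)]
  note bs = bounded_bilinear.smooth_on[OF bounded_bilinear_smult B(1)]
  have smXY: "smooth_on B X" "smooth_on B Y"
    unfolding XY by (rule smooth_on_add[OF B(1) bs bs]; rule smB)+
  have par': "herm4 (vd (vd X) s) (X s) = 0" "herm4 (vd (vd X) s) (Y s) = 0"
    "herm4 (vd (vd Y) s) (X s) = 0" "herm4 (vd (vd Y) s) (Y s) = 0" if "s \<in> B" for s
    using par[OF that smB(3,4) xy(7,8)] par[OF that smB(5,6) zw(7,8)] that B(4,5)
    by (auto simp: XY herm4_add_right herm4_smult_right)
  have null': "herm4 (X s) (X s) = 0" "herm4 (X s) (Y s) = 0" "herm4 (Y s) (Y s) = 0" if "s \<in> B" for s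
    using lag[OF subsetD[OF B(7) that]]
    by (simp_all add: XY herm4_add_left herm4_add_right herm4_smult_left herm4_smult_right)
  have d0: "vd X s0 = (c0 *s vd \<xi> s0 + c1 *s vd \<eta> s0) + (vd x s0 *s \<xi> s0 + vd y s0 *s \<eta> s0)"
    "vd Y s0 = (e0 *s vd \<xi> s0 + e1 *s vd \<eta> s0) + (vd z s0 *s \<xi> s0 + vd w s0 *s \<eta> s0)"
    unfolding XY vd_combination(1)[OF B(1,3) smB(3,4,1,2)] vd_combination(1)[OF B(1,3) smB(5,6,1,2)]
    by (simp_all add: xy zw)
  have lag0: "herm4 (p *s \<xi> s0 + q *s \<eta> s0) (p' *s \<xi> s0 + q' *s \<eta> s0) = 0" for p q p' q'
    using lag[OF S(2)] by (simp add: herm4_add_left herm4_add_right herm4_smult_left herm4_smult_right)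
  have XY0: "X s0 = c0 *s \<xi> s0 + c1 *s \<eta> s0" "Y s0 = e0 *s \<xi> s0 + e1 *s \<eta> s0"
    by (simp_all add: XY xy zw)
  have init: "herm4 (vd X s0) (X s0) = 0" "herm4 (vd Y s0) (Y s0) = 0" "herm4 (vd X s0) (Y s0) = 1"
    unfolding d0 herm4_add_left[of "_ + _"] XY0 Q lag0 using ce by simp_all
  \<comment> \<open>One factor comes from the wedge of \<open>X\<close> and \<open>Y\<close>, the
    other from the wedge of their derivatives, whose components involving the plane pair to zero
    with \<open>wedge \<xi> \<eta>\<close>.\<close>
  have "det4 (X s0) (vd X s0) (Y s0) (vd Y s0)
      = (c0 * e1 - c1 * e0) * (c0 * e1 - c1 * e0) * det4 (\<xi> s0) (vd \<xi> s0) (\<eta> s0) (vd \<eta> s0)"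
  proof -
    have sw: "det4 p q r t = - 2 * bil6 (wedge p r) (wedge q t)" for p q r t
      by (simp add: bil6_wedge det4_eq algebra_simps)
    have "wedge (X s0) (Y s0) = (c0 * e1 - c1 * e0) *s wedge (\<xi> s0) (\<eta> s0)"
      by (simp add: XY0 wedge_add_left wedge_add_right wedge_smult_left wedge_smult_right wedge_self
          wedge_swap[of "\<eta> s0" "\<xi> s0"] vec_eq_iff algebra_simps)
    moreover have "bil6 (wedge (\<xi> s0) (\<eta> s0)) (wedge (vd X s0) (vd Y s0))
        = (c0 * e1 - c1 * e0) * bil6 (wedge (\<xi> s0) (\<eta> s0)) (wedge (vd \<xi> s0) (vd \<eta> s0))"
      by (simp add: d0 wedge_add_left wedge_add_right wedge_smult_left wedge_smult_right wedge_self
          wedge_swap[of "vd \<eta> s0" "vd \<xi> s0"] bil6_linear bil6_zeros algebra_simps)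
    ultimately show ?thesis unfolding sw by (simp only: bil6_smult_left mult.assoc mult.left_commute)
  qed
  then have det1: "det4 (X s0) (vd X s0) (Y s0) (vd Y s0) = 1" using ce(1) det by simp
  note nf = normalized_frame_propagates[OF B(1-3) smXY null' par' init det1]
  have "\<exists>k. wedge (X s) (Y s) = k *s cvec6 (v s)" if "s \<in> B" for s
    unfolding w\<xi>\<eta>[OF subsetD[OF B(7) that], symmetric]
    by (intro exI[of _ "x s * w s - y s * z s"])
      (simp add: XY wedge_add_left wedge_add_right wedge_smult_left wedge_smult_right wedge_self
        wedge_swap[of "\<eta> s"] vec_eq_iff algebra_simps)
  then show thesis
    using that[of "min r1 r2" X Y] xy(1) zw(1) B(8) smXY nf par' unfolding B_def by simp
qed

text \<open>Only the null line of \<open>v\<close> enters the conclusion, so a constant rescaling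
  reduces to a tangent of norm 1 at \<open>s0\<close>.\<close>

lemma spin_lift:
  fixes v :: "real \<Rightarrow> real^6"
  assumes I: "open I" "s0 \<in> I" and v: "smooth_on I v" and null: "\<And>s. s \<in> I \<Longrightarrow> lie_form (v s) (v s) = 0"
    and v0: "v s0 \<noteq> 0" and v1: "lie_form (vd v s0) (vd v s0) > 0"
  obtains e X Y where "e > 0" "ball s0 e \<subseteq> I" "smooth_on (ball s0 e) X" "smooth_on (ball s0 e) Y"
    "\<And>s. s \<in> ball s0 e \<Longrightarrow> normalized_frame (X s) (vd X s) (Y s) (vd Y s)"
    "\<And>s. s \<in> ball s0 e \<Longrightarrow> herm4 (vd (vd X) s) (X s) = 0 \<and> herm4 (vd (vd X) s) (Y s) = 0
       \<and> herm4 (vd (vd Y) s) (X s) = 0 \<and> herm4 (vd (vd Y) s) (Y s) = 0"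
    "\<And>s. s \<in> ball s0 e \<Longrightarrow> \<exists>k. wedge (X s) (Y s) = k *s cvec6 (v s)"
proof -
  interpret lie: bounded_bilinear lie_form by (rule bounded_bilinear_lie_form)
  define r where "r = 1 / sqrt (lie_form (vd v s0) (vd v s0))"
  have r: "r \<noteq> 0" "r * r * lie_form (vd v s0) (vd v s0) = 1"
    using v1 by (simp_all add: r_def)
  define w where "w = (\<lambda>s. r *\<^sub>R v s)"
  have w: "smooth_on I w" unfolding w_def
    by (rule smooth_on_bounded_linear[OF I(1) bounded_linear_scaleR_right v])
  have dw: "vd w s0 = r *\<^sub>R vd v s0" unfolding w_def
    by (rule vd_linear[OF bounded_linear_scaleR_right v I(2)])
  have nullw: "lie_form (w s) (w s) = 0" if "s \<in> I" for s
    using null[OF that] by (simp add: w_def lie.scaleR_left lie.scaleR_right)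
  have w0: "w s0 \<noteq> 0" using v0 r by (simp add: w_def)
  have w1: "lie_form (vd w s0) (vd w s0) = 1"
    using r by (simp add: dw lie.scaleR_left lie.scaleR_right mult.assoc)
  obtain e X Y where *: "e > 0" "ball s0 e \<subseteq> I" "smooth_on (ball s0 e) X" "smooth_on (ball s0 e) Y"
    "\<And>s. s \<in> ball s0 e \<Longrightarrow> normalized_frame (X s) (vd X s) (Y s) (vd Y s)"
    "\<And>s. s \<in> ball s0 e \<Longrightarrow> herm4 (vd (vd X) s) (X s) = 0 \<and> herm4 (vd (vd X) s) (Y s) = 0
       \<and> herm4 (vd (vd Y) s) (X s) = 0 \<and> herm4 (vd (vd Y) s) (Y s) = 0"
    "\<And>s. s \<in> ball s0 e \<Longrightarrow> \<exists>k. wedge (X s) (Y s) = k *s cvec6 (w s)"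
    by (rule spin_lift_normalized[OF I w nullw w0 w1]) (assumption | rule that)+
  have cw: "cvec6 (w s) = of_real r *s cvec6 (v s)" for s
    by (simp add: w_def cvec6_def vec_eq_iff)
  have "\<exists>k. wedge (X s) (Y s) = k *s cvec6 (v s)" if "s \<in> ball s0 e" for s
    using *(7)[OF that] unfolding cw by (metis vector_smult_assoc)
  then show thesis using that[OF *(1-6)] by blast
qed

section \<open>The conic of spheres touching a null curve\<close>

lemma scaleR_eq_smult: "r *\<^sub>R (x :: complex^'n) = of_real r *s x"
  by (simp add: vec_eq_iff scaleR_conv_of_real[where 'a=complex])

text \<open>It matters that \<open>r\<close> is real: the product of the two shifted vectors is
  \<open>r - cnj r\<close>.\<close>

lemma normalized_frame_shift:
  assumes "normalized_frame a a1 b b1"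
  shows "normalized_frame (a + r *\<^sub>R b) (a1 + r *\<^sub>R b1) b b1"
proof -
  have "det4 (a + of_real r *s b) (a1 + of_real r *s b1) b b1 = det4 a a1 b b1"
    by (simp add: det4_eq algebra_simps)
  then show ?thesis
    using assms unfolding normalized_frame_def scaleR_eq_smult
    by (simp add: herm4_add_left herm4_add_right herm4_smult_left herm4_smult_right)
qed

text \<open>Exchanges the values 0 and infinity of the conic parameter; the minus signs restore the
  Gram relations.\<close>

lemma normalized_frame_swap:
  assumes "normalized_frame a a1 b b1"
  shows "normalized_frame b b1 (- a) (- a1)"
proof -
  have "det4 b b1 (- a) (- a1) = det4 a a1 b b1" by (simp add: det4_eq algebra_simps)
  moreover have "herm4 x (- y) = - herm4 x y" "herm4 (- x) y = - herm4 x y" for x y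
    by (simp_all add: herm4_def algebra_simps)
  ultimately show ?thesis using assms unfolding normalized_frame_def by simp
qed

text \<open>The real null vectors orthogonal to the osculating plane of the curve form a conic; here \<open>t\<close>
  is its affine parameter.\<close>

lemma touching_null_vector:
  assumes nf: "normalized_frame a a1 b b1"
    and orth: "bil6 u (wedge a b) = 0" "bil6 u (wedge a b1 + wedge a1 b) = 0" "bil6 u (wedge a1 b1) = 0"
    and null: "bil6 u u = 0"
  shows "bil6 u (wedge b b1) * bil6 u (wedge a a1) = bil6 u (wedge a1 b) * bil6 u (wedge a1 b)"
    "bil6 u (wedge b b1) \<noteq> 0 \<Longrightarrow> t = bil6 u (wedge a1 b) / bil6 u (wedge b b1) \<Longrightarrow>
      u = (2 * bil6 u (wedge b b1)) *s wedge (a + t *s b) (a1 + t *s b1)"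
    "bil6 u (wedge b b1) = 0 \<Longrightarrow> bil6 u (wedge a a1) = 0 \<Longrightarrow> u = 0"
proof -
  \<comment> \<open>The three coordinates of \<open>u\<close> left free by orthogonality. That
    \<open>u\<close> is null becomes the conic \<open>f * g = d * d\<close>, with affine parameter
    \<open>d / f\<close>.\<close>
  define f d g where "f = bil6 u (wedge b b1)" "d = bil6 u (wedge a1 b)" "g = bil6 u (wedge a a1)"
  note fdg = this
  have c: "bil6 u (wedge a b1) = - d"
    using orth(2) by (simp add: bil6_add_right fdg eq_neg_iff_add_eq_0)
  have "det4 a a1 b b1 = 1" using nf by (simp add: normalized_frame_def)
  then have u: "u = 2 *s (f *s wedge a a1 + d *s wedge a b1 - d *s wedge a1 b + g *s wedge b b1)"
    using wedge_expansion[of a a1 b b1 u] orth(1,3) c by (simp add: fdg vec_eq_iff)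
  have "bil6 u u = 2 * (f * g + d * bil6 u (wedge a b1) - d * d + g * f)"
    by (subst (2) u) (simp add: bil6_linear fdg)
  then have fg: "f * g = d * d" using null c by (simp add: algebra_simps)
  then show "bil6 u (wedge b b1) * bil6 u (wedge a a1) = bil6 u (wedge a1 b) * bil6 u (wedge a1 b)"
    by (simp add: fdg)
  { assume "bil6 u (wedge b b1) \<noteq> 0" and t: "t = bil6 u (wedge a1 b) / bil6 u (wedge b b1)"
    then have f: "f \<noteq> 0" "d = t * f" by (simp_all add: fdg)
    then have "f * g = f * (t * t * f)" using fg by (simp add: mult_ac)
    then have "d = t * f" "g = t * t * f" using f by simp_all
    then have "u = (2 * f) *s (wedge a a1 + t *s (wedge a b1 - wedge a1 b) + (t * t) *s wedge b b1)"
      by (subst u) (simp add: vec_eq_iff algebra_simps)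
    then show "u = (2 * bil6 u (wedge b b1)) *s wedge (a + t *s b) (a1 + t *s b1)"
      by (simp add: fdg(1)[symmetric] wedge_add_left wedge_add_right wedge_smult_left wedge_smult_right
          wedge_swap[of b a1] vec_eq_iff algebra_simps) }
  { assume "bil6 u (wedge b b1) = 0" "bil6 u (wedge a a1) = 0"
    then have "f = 0" "g = 0" "d = 0" using fg by (simp_all add: fdg)
    then show "u = 0" by (subst u) (simp add: vec_eq_iff) }
qed

lemma bil6_cnj: "cnj (bil6 y z) = bil6 (cnj6 y) (cnj6 z)"
  by (simp add: bil6_def cnj6_def)

text \<open>Numerator and denominator are both imaginary: conjugation negates
  \<open>wedge b b1\<close> and maps \<open>wedge a1 b\<close> to \<open>wedge a b1\<close>, whose
  pairing with \<open>u\<close> is the opposite one by orthogonality.\<close>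

lemma touching_parameter_real:
  assumes nf: "normalized_frame a a1 b b1" and u: "cnj6 u = u" and orth: "bil6 u (wedge a b1 + wedge a1 b) = 0"
  shows "of_real (Re (bil6 u (wedge a1 b) / bil6 u (wedge b b1))) = bil6 u (wedge a1 b) / bil6 u (wedge b b1)"
proof -
  have c: "bil6 u (wedge a b1) = - bil6 u (wedge a1 b)"
    using orth by (simp add: bil6_add_right eq_neg_iff_add_eq_0)
  have "cnj (bil6 u (wedge a1 b)) = - bil6 u (wedge a1 b)" "cnj (bil6 u (wedge b b1)) = - bil6 u (wedge b b1)"
    by (simp_all add: bil6_cnj u cnj6_normalized_frame[OF nf] bil6_linear c)
  then have "cnj (bil6 u (wedge a1 b) / bil6 u (wedge b b1)) = bil6 u (wedge a1 b) / bil6 u (wedge b b1)" by simp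
  then show ?thesis by (metis Reals_cnj_iff complex_is_Real_iff of_real_Re)
qed

lemma wedge_normalized_frame_nonzero: "normalized_frame a a1 b b1 \<Longrightarrow> wedge a b \<noteq> 0"
  using bil6_normalized_frame(3)[of a a1 b b1] by (auto simp: bil6_linear)

lemma cvec6_smult_real:
  assumes "cvec6 a = k *s z" "cnj6 z = z"
  shows "a = Re k *\<^sub>R re6 z"
proof -
  have "a = re6 (k *s cvec6 (re6 z))" using assms by (metis cvec6_re6 re6_cvec6)
  then show ?thesis by (simp add: re6_def cvec6_def vec_eq_iff)
qed

text \<open>In the quantified form, rescaling one of the vectors by a nonzero factor is immediate;
  \<open>distinct\<close> guards against coincidences that the set would hide.\<close>

lemma independent_4_iff:
  fixes a b c d :: "'a::real_vector"
  shows "distinct [a, b, c, d] \<and> independent {a, b, c, d} \<longleftrightarrow>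
    (\<forall>x y z w. x *\<^sub>R a + y *\<^sub>R b + z *\<^sub>R c + w *\<^sub>R d = 0 \<longrightarrow> x = 0 \<and> y = 0 \<and> z = 0 \<and> w = 0)"
    (is "?L \<longleftrightarrow> ?R")
proof
  assume L: ?L
  show ?R
  proof (intro allI impI)
    fix x y z w assume s: "x *\<^sub>R a + y *\<^sub>R b + z *\<^sub>R c + w *\<^sub>R d = 0"
    define g where "g = (\<lambda>v. if v = a then x else if v = b then y else if v = c then z else w)"
    have "(\<Sum>v\<in>{a, b, c, d}. g v *\<^sub>R v) = 0"
      using L s by (auto simp: g_def add.assoc)
    then have "\<forall>v\<in>{a, b, c, d}. g v = 0"
      using L independentD[of "{a,b,c,d}" "{a,b,c,d}" g] by auto
    then show "x = 0 \<and> y = 0 \<and> z = 0 \<and> w = 0" using L by (auto simp: g_def)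
  qed
next
  assume R: ?R
  have d: "distinct [a, b, c, d]"
    using R[rule_format, of 1 "-1" 0 0] R[rule_format, of 1 0 "-1" 0] R[rule_format, of 1 0 0 "-1"]
      R[rule_format, of 0 1 "-1" 0] R[rule_format, of 0 1 0 "-1"] R[rule_format, of 0 0 1 "-1"]
    by auto
  moreover have "independent {a, b, c, d}"
  proof (rule independent_if_scalars_zero)
    fix g v assume g: "(\<Sum>v\<in>{a, b, c, d}. g v *\<^sub>R v) = 0" "v \<in> {a, b, c, d}"
    then have "g a *\<^sub>R a + g b *\<^sub>R b + g c *\<^sub>R c + g d *\<^sub>R d = 0"
      using d by (simp add: add.assoc)
    then show "g v = 0" using R[rule_format, of "g a" "g b" "g c" "g d"] g(2) by auto
  qed simp
  ultimately show ?L by blast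
qed

section \<open>From the canal surface to the linear system\<close>

text \<open>Both sides of the first equation are polynomials in the second coordinate with values in
  the span of \<open>X\<close> and \<open>Y\<close>. Comparing coefficients with the expansions of
  the second derivatives determines \<open>V\<close> and the quadratic \<open>p\<close>, whose third
  derivative vanishes.\<close>

lemma canal_system_of_spin_curve:
  assumes I: "open I" "open K"
    and sm: "smooth_on I X" "smooth_on I Y"
    and nf: "\<And>s. s \<in> I \<Longrightarrow> normalized_frame (X s) (vd X s) (Y s) (vd Y s)"
    and par: "\<And>s. s \<in> I \<Longrightarrow> herm4 (vd (vd X) s) (X s) = 0 \<and> herm4 (vd (vd X) s) (Y s) = 0
       \<and> herm4 (vd (vd Y) s) (X s) = 0 \<and> herm4 (vd (vd Y) s) (Y s) = 0"
    and \<psi>_def: "\<psi> = (\<lambda>x. X (fst x) + snd x *\<^sub>R Y (fst x))"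
  obtains p V W where "canal_system (I \<times> K) p V W \<psi>" "normalized_on (I \<times> K) \<psi>"
    "\<And>x. x \<in> I \<times> K \<Longrightarrow> d1 \<psi> x = vd X (fst x) + snd x *\<^sub>R vd Y (fst x)" "\<And>x. d2 \<psi> x = Y (fst x)"
proof -
  let ?S = "I \<times> K"
  have S: "open ?S" using I by (rule open_Times)
  note sm1 = smooth_on_vector_derivative[OF I(1)]
  note has = smooth_on_has_vector_derivative
  have lift: "smooth_on ?S (\<lambda>x. f (fst x))" if "smooth_on I f" for f :: "real \<Rightarrow> 'a::real_normed_vector"
    by (rule smooth_on_fst_curve[OF I(1) that S]) auto
  have snd: "smooth_on ?S (\<lambda>x. snd x)" by (rule smooth_on_linear[OF S bounded_linear_snd])
  have sm\<psi>: "smooth_on ?S \<psi>"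
    unfolding \<psi>_def by (intro smooth_on_add[OF S] smooth_on_scaleR[OF S] lift sm snd)
  have d1: "d1 (\<lambda>x. f (fst x) + snd x *\<^sub>R g (fst x)) x = vd f (fst x) + snd x *\<^sub>R vd g (fst x)"
    if "smooth_on I f" "smooth_on I g" "x \<in> ?S" for f g :: "real \<Rightarrow> complex^4" and x
  proof -
    have "fst x \<in> I" using that(3) by auto
    then show ?thesis
      using has_vector_derivative_add[OF has[OF that(1)]
          bounded_linear.has_vector_derivative[OF bounded_linear_scaleR_right has[OF that(2)]]]
      by (intro d1_eqI) simp
  qed
  have d1\<psi>: "d1 \<psi> x = vd X (fst x) + snd x *\<^sub>R vd Y (fst x)" if "x \<in> ?S" for x
    unfolding \<psi>_def by (rule d1[OF sm that])
  have d2\<psi>: "d2 \<psi> x = Y (fst x)" for x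
    unfolding \<psi>_def by (rule d2_eqI) (auto intro!: derivative_eq_intros)
  have d11: "d1 (d1 \<psi>) x = vd (vd X) (fst x) + snd x *\<^sub>R vd (vd Y) (fst x)" if "x \<in> ?S" for x
    using d1_cong[OF S that d1\<psi>] d1[OF sm1[OF sm(1)] sm1[OF sm(2)] that] by simp
  have d22: "d2 (d2 \<psi>) x = 0" for x
    unfolding d2\<psi>[abs_def] by (rule d2_eqI) simp
  have d12: "d1 (d2 \<psi>) x = vd Y (fst x)" if "x \<in> ?S" for x
    unfolding d2\<psi>[abs_def] using that by (intro d1_eqI) (auto intro: has[OF sm(2)])
  \<comment> \<open>\<open>\<alpha>\<close> is the coefficient of \<open>X\<close> in its own second
    derivative; its real part gives \<open>V\<close> and its imaginary part the linear coefficient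
    \<open>b\<close> of \<open>p\<close>. The other two, \<open>a\<close> and \<open>c\<close>, come
    from the coefficient of \<open>Y\<close> in the second derivative of \<open>X\<close> and vice
    versa.\<close>
  define \<alpha> where "\<alpha> = (\<lambda>s. - herm4 (vd (vd X) s) (vd Y s))"
  define a b c where abc: "a = (\<lambda>s. - Im (herm4 (vd (vd X) s) (vd X s)))" "b = (\<lambda>s. 2 * Im (\<alpha> s))"
    "c = (\<lambda>s. Im (- herm4 (vd (vd Y) s) (vd Y s)))"
  note hs = bounded_bilinear.smooth_on[OF bounded_bilinear_herm4 I(1)]
  have sm\<alpha>: "smooth_on I \<alpha>"
    unfolding \<alpha>_def by (intro smooth_on_minus[OF I(1)] hs sm1 sm)
  have smabc: "smooth_on I a" "smooth_on I b" "smooth_on I c"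
    unfolding abc
    by (intro smooth_on_minus[OF I(1)] smooth_on_mult[OF I(1)] smooth_on_const[OF I(1)]
        smooth_on_bounded_linear[OF I(1) bounded_linear_Im] hs sm1 sm sm\<alpha>)+
  define p where "p = (\<lambda>x. a (fst x) + b (fst x) * snd x + c (fst x) * (snd x * snd x))"
  define V where "V = (\<lambda>x :: real \<times> real. 2 * Re (\<alpha> (fst x)))"
  define W where "W = (\<lambda>x :: real \<times> real. 0 :: real)"
  have smpVW: "smooth_on ?S p" "smooth_on ?S V" "smooth_on ?S W"
    unfolding p_def V_def W_def
    by (intro smooth_on_add[OF S] smooth_on_mult[OF S] smooth_on_const[OF S] lift smabc snd
        smooth_on_bounded_linear[OF S bounded_linear_Re] sm\<alpha>)+
  have d2p: "d2 p x = b (fst x) + 2 * c (fst x) * snd x" for x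
    unfolding p_def by (rule d2_eqI) (auto intro!: derivative_eq_intros simp: has_real_derivative_iff_has_vector_derivative[symmetric])
  have d22p: "d2 (d2 p) x = 2 * c (fst x)" for x
    unfolding d2p[abs_def] by (rule d2_eqI) (auto intro!: derivative_eq_intros simp: has_real_derivative_iff_has_vector_derivative[symmetric])
  have d222p: "d2 (d2 (d2 p)) x = 0" for x
    unfolding d22p[abs_def] by (rule d2_eqI) simp
  have dW: "d1 W x = 0" "d2 W x = 0" "d2 V x = 0" for x
    unfolding W_def V_def by (auto intro!: d1_eqI d2_eqI)
  \<comment> \<open>The products of first derivatives vanish identically. Differentiating these
    relations makes the two cross coefficients imaginary and the two diagonal ones conjugate to each
    other.\<close>
  have eqs: "vd (vd X) s = \<alpha> s *s X s + (- \<i> * of_real (a s)) *s Y s"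
    "vd (vd Y) s = (\<i> * of_real (c s)) *s X s + cnj (\<alpha> s) *s Y s" if s: "s \<in> I" for s
  proof -
    note g = nf[OF s, unfolded normalized_frame_iff, THEN conjunct1]
    have z: "herm4 (vd X r) (vd X r) = 0" "herm4 (vd X r) (vd Y r) = 0" "herm4 (vd Y r) (vd Y r) = 0"
      if "r \<in> I" for r
      using nf[OF that] by (auto simp: normalized_frame_def)
    have "herm4 (vd X s) (vd (vd X) s) + herm4 (vd (vd X) s) (vd X s) = 0"
      by (rule herm4_derivatives(1)[OF I(1) sm1[OF sm(1)] sm1[OF sm(1)] s z(1)])
    then have "herm4 (vd (vd X) s) (vd X s) = - cnj (herm4 (vd (vd X) s) (vd X s))"
      by (simp add: herm4_cnj eq_neg_iff_add_eq_0 add.commute)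
    then have a: "herm4 (vd (vd X) s) (vd X s) = - \<i> * of_real (a s)"
      by (simp add: abc complex_eq_iff)
    have "herm4 (vd Y s) (vd (vd Y) s) + herm4 (vd (vd Y) s) (vd Y s) = 0"
      by (rule herm4_derivatives(1)[OF I(1) sm1[OF sm(2)] sm1[OF sm(2)] s z(3)])
    then have "herm4 (vd (vd Y) s) (vd Y s) = - cnj (herm4 (vd (vd Y) s) (vd Y s))"
      by (simp add: herm4_cnj eq_neg_iff_add_eq_0 add.commute)
    then have c: "- herm4 (vd (vd Y) s) (vd Y s) = \<i> * of_real (c s)"
      by (simp add: abc complex_eq_iff)
    have "herm4 (vd X s) (vd (vd Y) s) + herm4 (vd (vd X) s) (vd Y s) = 0"
      by (rule herm4_derivatives(1)[OF I(1) sm1[OF sm(1)] sm1[OF sm(2)] s z(2)])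
    then have "herm4 (vd X s) (vd (vd Y) s) = \<alpha> s" by (simp add: \<alpha>_def eq_neg_iff_add_eq_0)
    then have \<alpha>: "herm4 (vd (vd Y) s) (vd X s) = cnj (\<alpha> s)" by (metis herm4_cnj)
    show "vd (vd X) s = \<alpha> s *s X s + (- \<i> * of_real (a s)) *s Y s"
      using gram_frame_expansion[OF g, of "vd (vd X) s"] par[OF s] unfolding a[symmetric] \<alpha>_def
      by (simp add: vec_eq_iff)
    show "vd (vd Y) s = (\<i> * of_real (c s)) *s X s + cnj (\<alpha> s) *s Y s"
      using gram_frame_expansion[OF g, of "vd (vd Y) s"] par[OF s] unfolding c[symmetric] \<alpha>[symmetric]
      by (simp add: vec_eq_iff)
  qed
  have "canal_system ?S p V W \<psi>"
    unfolding canal_system_def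
  proof (intro conjI ballI smpVW sm\<psi>)
    fix x assume x: "x \<in> ?S"
    define s r where "s = fst x" "r = snd x"
    then have s: "s \<in> I" using x by auto
    have \<alpha>: "\<alpha> s = of_real (Re (\<alpha> s)) + \<i> * of_real (Im (\<alpha> s))" "cnj (\<alpha> s) = of_real (Re (\<alpha> s)) - \<i> * of_real (Im (\<alpha> s))"
      by (simp_all add: complex_eq_iff)
    show "d2 (d2 (d2 p)) x - 2 * W x * d2 p x - p x * d2 W x = 0"
      by (simp add: d222p dW) (simp add: W_def)
    show "d1 W x = 0" "d2 V x = 0" by (rule dW)+
    show "d1 (d1 \<psi>) x = (- \<i> * of_real (p x)) *s d2 \<psi> x
        + ((of_real (V x) + \<i> * of_real (d2 p x)) / 2) *s \<psi> x"
      unfolding d11[OF x] d2\<psi> d2p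
      unfolding \<psi>_def p_def V_def s_r_def[symmetric] eqs[OF s]
      unfolding \<alpha>(2) by (subst (1) \<alpha>(1)) (simp add: vec_eq_iff abc(2) scaleR_conv_of_real[where 'a=complex] field_simps)
    show "d2 (d2 \<psi>) x = (of_real (W x) / 2) *s \<psi> x"
      unfolding d22 W_def by (simp add: vec_eq_iff)
  qed
  moreover have "normalized_on ?S \<psi>"
    unfolding normalized_on_def
  proof
    fix x assume x: "x \<in> ?S"
    then have "fst x \<in> I" by auto
    then show "normalized_frame (\<psi> x) (d1 \<psi> x) (d2 \<psi> x) (d1 (d2 \<psi>) x)"
      unfolding d1\<psi>[OF x] d2\<psi> d12[OF x] unfolding \<psi>_def by (intro normalized_frame_shift nf)
  qed
  ultimately show thesis using d1\<psi> d2\<psi> by (rule that)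
qed

text \<open>Only the second coordinate changes: \<open>d1\<close> is untouched, and
  \<open>d2\<close> is multiplied by the nonzero derivative of \<open>\<beta>\<close>, which spans
  and independence tolerate.\<close>

lemma curvature_spheres_reparametrized:
  assumes cs: "curvature_spheres S U V" and I: "open I" "open K" and sub: "(\<lambda>x. (fst x, \<beta> (snd x))) ` (I \<times> K) \<subseteq> S"
    and \<beta>: "smooth_on K \<beta>" and d\<beta>: "\<And>r. r \<in> K \<Longrightarrow> vd \<beta> r \<noteq> 0"
  shows "curvature_spheres (I \<times> K) (U \<circ> (\<lambda>x. (fst x, \<beta> (snd x)))) (V \<circ> (\<lambda>x. (fst x, \<beta> (snd x))))"
proof -
  define \<phi> where "\<phi> = (\<lambda>x. (fst x, \<beta> (snd x)) :: real \<times> real)"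
  have S: "open S" and smUV: "smooth_on S U" "smooth_on S V" using cs by (auto simp: curvature_spheres_def)
  have O: "open (I \<times> K)" using I by (rule open_Times)
  have "smooth_on (I \<times> K) (\<lambda>x. \<beta> (snd x))"
    by (rule smooth_on_compose_linear[OF bounded_linear_snd O I(2) _ \<beta>]) auto
  then have sm\<phi>: "smooth_on (I \<times> K) \<phi>"
    unfolding \<phi>_def by (rule smooth_on_Pair[OF O smooth_on_linear[OF O bounded_linear_fst]])
  have d: "d1 (f \<circ> \<phi>) x = d1 f (\<phi> x)" "d2 (f \<circ> \<phi>) x = vd \<beta> (snd x) *\<^sub>R d2 f (\<phi> x)"
    if "smooth_on S f" "x \<in> I \<times> K" for f :: "real \<times> real \<Rightarrow> real^6" and x
  proof -
    show "d1 (f \<circ> \<phi>) x = d1 f (\<phi> x)" by (simp add: d1_def \<phi>_def)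
    have "\<phi> x \<in> S" using sub that(2) by (auto simp: \<phi>_def)
    then have "((\<lambda>t. f (fst x, t)) has_vector_derivative d2 f (\<phi> x)) (at (\<beta> (snd x)))"
      using smooth_on_has_d2[OF that(1), of "\<phi> x"] by (simp add: \<phi>_def)
    moreover have "(\<beta> has_vector_derivative vd \<beta> (snd x)) (at (snd x))"
      using that(2) by (intro smooth_on_has_vector_derivative[OF \<beta>]) auto
    ultimately have "((\<lambda>t. f (fst x, t)) \<circ> \<beta> has_vector_derivative vd \<beta> (snd x) *\<^sub>R d2 f (\<phi> x)) (at (snd x))"
      by (intro vector_diff_chain_at)
    then show "d2 (f \<circ> \<phi>) x = vd \<beta> (snd x) *\<^sub>R d2 f (\<phi> x)"
      by (intro d2_eqI) (simp add: \<phi>_def o_def)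
  qed
  have "curvature_spheres (I \<times> K) (U \<circ> \<phi>) (V \<circ> \<phi>)"
    unfolding curvature_spheres_def
  proof (intro conjI ballI O)
    show "smooth_on (I \<times> K) (U \<circ> \<phi>)" "smooth_on (I \<times> K) (V \<circ> \<phi>)"
      unfolding o_def using smooth_on_compose_plane[OF O S _ _ sm\<phi>] smUV sub by (simp_all add: \<phi>_def)
    fix x assume x: "x \<in> I \<times> K"
    have \<phi>x: "\<phi> x \<in> S" using sub x by (auto simp: \<phi>_def)
    have nz: "vd \<beta> (snd x) \<noteq> 0" using x d\<beta> by auto
    note c = cs[unfolded curvature_spheres_def, THEN conjunct2, THEN conjunct2, THEN conjunct2, rule_format, OF \<phi>x]
    show "lie_form ((U \<circ> \<phi>) x) ((U \<circ> \<phi>) x) = 0" "lie_form ((U \<circ> \<phi>) x) ((V \<circ> \<phi>) x) = 0"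
      "lie_form ((V \<circ> \<phi>) x) ((V \<circ> \<phi>) x) = 0" using c by simp_all
    show "d1 (U \<circ> \<phi>) x \<in> span {(U \<circ> \<phi>) x, (V \<circ> \<phi>) x}"
      "d2 (V \<circ> \<phi>) x \<in> span {(U \<circ> \<phi>) x, (V \<circ> \<phi>) x}"
      using c by (simp_all add: d[OF smUV(1) x] d[OF smUV(2) x] span_mul)
    have "distinct [U (\<phi> x), V (\<phi> x), d2 U (\<phi> x), d1 V (\<phi> x)] \<and> independent {U (\<phi> x), V (\<phi> x), d2 U (\<phi> x), d1 V (\<phi> x)}"
      using c by blast
    then have "distinct [U (\<phi> x), V (\<phi> x), vd \<beta> (snd x) *\<^sub>R d2 U (\<phi> x), d1 V (\<phi> x)] \<and>
        independent {U (\<phi> x), V (\<phi> x), vd \<beta> (snd x) *\<^sub>R d2 U (\<phi> x), d1 V (\<phi> x)}"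
      unfolding independent_4_iff scaleR_scaleR using nz by (metis mult_eq_0_iff)
    then show "distinct [(U \<circ> \<phi>) x, (V \<circ> \<phi>) x, d2 (U \<circ> \<phi>) x, d1 (V \<circ> \<phi>) x]"
      "independent {(U \<circ> \<phi>) x, (V \<circ> \<phi>) x, d2 (U \<circ> \<phi>) x, d1 (V \<circ> \<phi>) x}"
      by (simp_all add: d[OF smUV(1) x] d[OF smUV(2) x])
  qed
  then show ?thesis by (simp add: \<phi>_def)
qed

section \<open>Spin curves and the spheres in contact with them\<close>

lemma gram_frame_span:
  assumes "gram_frame a a1 b b1" "herm4 u a = 0" "herm4 u b = 0"
  shows "\<exists>k l. u = k *s a + l *s b"
  using gram_frame_expansion[OF assms(1), of u] assms(2,3)
  by (intro exI[of _ "- herm4 u b1"] exI[of _ "herm4 u a1"]) (simp add: vec_eq_iff)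

lemma span_pair: "x \<in> span {a, b} \<Longrightarrow> \<exists>k l. x = k *\<^sub>R a + l *\<^sub>R b"
  by (auto simp: span_insert span_singleton) (metis diff_add_cancel add.commute)

lemma lie_form_commute: "lie_form x y = lie_form y x"
  by (simp add: lie_form_def mult.commute)

text \<open>The isotropic plane is its own orthogonal complement, so the four vanishing products say
  that the second derivatives lie in it. The complex factor \<open>k\<close> is left open because
  only the null line of \<open>v s\<close> matters.\<close>

definition spin_curve :: "real set \<Rightarrow> (real \<Rightarrow> real^6) \<Rightarrow> (real \<Rightarrow> complex^4) \<Rightarrow> (real \<Rightarrow> complex^4) \<Rightarrow> bool" where
  "spin_curve B v X Y \<longleftrightarrow> smooth_on B X \<and> smooth_on B Y \<and>
    (\<forall>s\<in>B. normalized_frame (X s) (vd X s) (Y s) (vd Y s) \<and>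
      herm4 (vd (vd X) s) (X s) = 0 \<and> herm4 (vd (vd X) s) (Y s) = 0 \<and>
      herm4 (vd (vd Y) s) (X s) = 0 \<and> herm4 (vd (vd Y) s) (Y s) = 0 \<and>
      (\<exists>k. wedge (X s) (Y s) = k *s cvec6 (v s)))"

text \<open>\<open>X, Y\<close> and \<open>Y, - X\<close> have the same wedge and so lift the same
  null curve; the swap serves to bring a point at infinity of the conic to a finite place.\<close>

lemma spin_curve_swap:
  assumes "open B" "spin_curve B v X Y"
  shows "spin_curve B v Y (\<lambda>s. - X s)"
proof -
  have sm: "smooth_on B X" "smooth_on B Y" using assms(2) by (auto simp: spin_curve_def)
  have d: "vd (\<lambda>s. - f s) s = - vd f s" if "smooth_on B f" "s \<in> B" for f :: "real \<Rightarrow> complex^4" and s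
    by (rule vd_linear[OF bounded_linear_minus[OF bounded_linear_ident] that])
  have d1: "vd (\<lambda>s. - X s) s = - vd X s" if "s \<in> B" for s by (rule d[OF sm(1) that])
  have d2: "vd (vd (\<lambda>s. - X s)) s = - vd (vd X) s" if "s \<in> B" for s
    using vd_cong[OF assms(1) that d1] d[OF smooth_on_vector_derivative[OF assms(1) sm(1)] that] by simp
  have m: "herm4 x (- y) = - herm4 x y" "herm4 (- x) y = - herm4 x y" for x y
    by (simp_all add: herm4_def algebra_simps)
  have w: "wedge y (- x) = wedge x y" for x y
    by (rule vec6_eqI) (elim insertE emptyE; simp add: wedge_components field_simps)
  show ?thesis
    unfolding spin_curve_def
    using assms(2) by (auto simp: spin_curve_def d1 d2 m w normalized_frame_swap smooth_on_minus[OF assms(1) sm(1)])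
qed

text \<open>Along the first coordinate, \<open>u\<close> moves within the span of \<open>u\<close> and the null curve, hence the
  coordinates of \<open>u\<close> with respect to the lifted frame are multiplied by a common factor.\<close>

lemma spin_curve_coordinates:
  assumes B: "open B" and sc: "spin_curve B v X Y" and smu: "smooth_on B u"
    and null: "\<And>s. s \<in> B \<Longrightarrow> bil6 (u s) (cvec6 (v s)) = 0"
    and du: "\<And>s. s \<in> B \<Longrightarrow> \<exists>k l. vd u s = k *s u s + l *s cvec6 (v s)"
    and s: "s \<in> B"
  shows "bil6 (u s) (wedge (X s) (Y s)) = 0"
    "bil6 (u s) (wedge (X s) (vd Y s) + wedge (vd X s) (Y s)) = 0"
    "bil6 (u s) (wedge (vd X s) (vd Y s)) = 0"
    "\<exists>k. vd (\<lambda>s. bil6 (u s) (wedge (Y s) (vd Y s))) s = k * bil6 (u s) (wedge (Y s) (vd Y s)) \<and>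
      vd (\<lambda>s. bil6 (u s) (wedge (vd X s) (Y s))) s = k * bil6 (u s) (wedge (vd X s) (Y s))"
    (is ?D)
proof -
  have sm: "smooth_on B X" "smooth_on B Y" using sc by (auto simp: spin_curve_def)
  note sm1 = smooth_on_vector_derivative[OF B]
  note ws = bounded_bilinear.smooth_on[OF bounded_bilinear_wedge B]
  note bs = vd_bilinear[OF bounded_bilinear_bil6 smu]
  note dw = vd_bilinear[OF bounded_bilinear_wedge]
  have nf: "normalized_frame (X s) (vd X s) (Y s) (vd Y s)" if "s \<in> B" for s
    using sc that by (auto simp: spin_curve_def)
  note gf = nf[unfolded normalized_frame_iff, THEN conjunct1]
  have X2: "\<exists>k l. vd (vd X) s = k *s X s + l *s Y s" and Y2: "\<exists>k l. vd (vd Y) s = k *s X s + l *s Y s" if "s \<in> B" for s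
    using sc that by (auto simp: spin_curve_def intro!: gram_frame_span[OF gf])
  have wk: "\<exists>k. wedge (X s) (Y s) = k *s cvec6 (v s)" if "s \<in> B" for s
    using sc that by (auto simp: spin_curve_def)
  have du': "\<exists>k l. vd u s = k *s u s + l *s wedge (X s) (Y s)" if "s \<in> B" for s
  proof -
    obtain m where m: "wedge (X s) (Y s) = m *s cvec6 (v s)" using wk[OF \<open>s \<in> B\<close>] by blast
    have "m \<noteq> 0" using wedge_normalized_frame_nonzero[OF nf[OF \<open>s \<in> B\<close>]] m by auto
    then have "cvec6 (v s) = (1 / m) *s wedge (X s) (Y s)" unfolding m by (simp add: vec_eq_iff)
    then show ?thesis using du[OF \<open>s \<in> B\<close>] by (metis vector_smult_assoc)
  qed
  have o1: "bil6 (u s) (wedge (X s) (Y s)) = 0" if "s \<in> B" for s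
    using wk[OF that] null[OF that] by (auto simp: bil6_linear)
  have o2: "bil6 (u s) (wedge (X s) (vd Y s) + wedge (vd X s) (Y s)) = 0" if "s \<in> B" for s
  proof -
    obtain k l where kl: "vd u s = k *s u s + l *s wedge (X s) (Y s)" using du'[OF \<open>s \<in> B\<close>] by blast
    have "vd (\<lambda>s. bil6 (u s) (wedge (X s) (Y s))) s = 0" by (rule vd_zero[OF B \<open>s \<in> B\<close> o1])
    then show ?thesis
      unfolding bs[OF ws[OF sm] \<open>s \<in> B\<close>] dw[OF sm \<open>s \<in> B\<close>] kl
      by (simp add: bil6_linear bil6_zeros o1[OF \<open>s \<in> B\<close>])
  qed
  \<comment> \<open>This is the derivative of \<open>o2\<close>: second derivatives add only
    multiples of the wedge of \<open>X\<close> and \<open>Y\<close>, and \<open>vd u\<close> adds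
    only terms that vanish by \<open>o1\<close>, \<open>o2\<close> and shared factors. Twice the
    wedge of the first derivatives remains.\<close>
  have o3: "bil6 (u s) (wedge (vd X s) (vd Y s)) = 0" if "s \<in> B" for s
  proof -
    obtain k l where kl: "vd u s = k *s u s + l *s wedge (X s) (Y s)" using du'[OF \<open>s \<in> B\<close>] by blast
    obtain a b where ab: "vd (vd X) s = a *s X s + b *s Y s" using X2[OF \<open>s \<in> B\<close>] by blast
    obtain c d where cd: "vd (vd Y) s = c *s X s + d *s Y s" using Y2[OF \<open>s \<in> B\<close>] by blast
    have w1: "smooth_on B (\<lambda>s. wedge (X s) (vd Y s))" "smooth_on B (\<lambda>s. wedge (vd X s) (Y s))"
      using ws sm sm1 by blast+
    have "vd (\<lambda>s. wedge (X s) (vd Y s) + wedge (vd X s) (Y s)) s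
        = 2 *s wedge (vd X s) (vd Y s) + (a + d) *s wedge (X s) (Y s)"
      unfolding vd_add[OF w1 \<open>s \<in> B\<close>] dw[OF sm(1) sm1[OF sm(2)] \<open>s \<in> B\<close>] dw[OF sm1[OF sm(1)] sm(2) \<open>s \<in> B\<close>] ab cd
        wedge_add_left wedge_add_right wedge_smult_left wedge_smult_right wedge_self
      by (simp add: vec_eq_iff algebra_simps)
    moreover have "vd (\<lambda>s. bil6 (u s) (wedge (X s) (vd Y s) + wedge (vd X s) (Y s))) s = 0"
      by (rule vd_zero[OF B \<open>s \<in> B\<close> o2])
    ultimately show ?thesis
      unfolding bs[OF smooth_on_add[OF B w1] \<open>s \<in> B\<close>] kl
      using o1[OF \<open>s \<in> B\<close>] o2[OF \<open>s \<in> B\<close>]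
      by (simp add: bil6_linear bil6_zeros distrib_left[symmetric])
  qed
  show "bil6 (u s) (wedge (X s) (Y s)) = 0" "bil6 (u s) (wedge (X s) (vd Y s) + wedge (vd X s) (Y s)) = 0"
    "bil6 (u s) (wedge (vd X s) (vd Y s)) = 0"
    by (rule o1[OF s] o2[OF s] o3[OF s])+
  \<comment> \<open>The common factor is the coefficient of \<open>u\<close> in its own derivative;
    the remaining terms vanish by \<open>o1\<close>, \<open>o3\<close> and shared factors.\<close>
  obtain k l where kl: "vd u s = k *s u s + l *s wedge (X s) (Y s)" using du'[OF s] by blast
  obtain a b where ab: "vd (vd X) s = a *s X s + b *s Y s" using X2[OF s] by blast
  obtain c d where cd: "vd (vd Y) s = c *s X s + d *s Y s" using Y2[OF s] by blast
  have "vd (\<lambda>s. bil6 (u s) (wedge (Y s) (vd Y s))) s = k * bil6 (u s) (wedge (Y s) (vd Y s))"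
    unfolding bs[OF ws[OF sm(2) sm1[OF sm(2)]] s] dw[OF sm(2) sm1[OF sm(2)] s] kl cd
    using o1[OF s]
    by (simp add: bil6_linear bil6_zeros wedge_add_right wedge_smult_right wedge_self wedge_swap[of "Y s" "X s"])
  moreover have "vd (\<lambda>s. bil6 (u s) (wedge (vd X s) (Y s))) s = k * bil6 (u s) (wedge (vd X s) (Y s))"
    unfolding bs[OF ws[OF sm1[OF sm(1)] sm(2)] s] dw[OF sm1[OF sm(1)] sm(2) s] kl ab
    using o1[OF s] o3[OF s]
    by (simp add: bil6_linear bil6_zeros wedge_add_left wedge_smult_left wedge_self)
  ultimately show ?D by blast
qed

text \<open>The scale of \<open>V\<close> may vary along its curvature lines, so the slice
  \<open>v\<close> through \<open>t0\<close> represents the null line on a whole box. The tangent of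
  \<open>v\<close> at \<open>s0\<close> is orthogonal to the isotropic plane of \<open>U\<close> and
  \<open>v\<close> and independent of it, so the signature makes its norm positive.\<close>

lemma canal_surface_box:
  assumes can: "canal_surface S U V" and x0: "(s0, t0) \<in> S"
    and v_def: "v = (\<lambda>s. V (s, t0))"
  obtains r where "r > 0" "ball s0 r \<times> ball t0 r \<subseteq> S" "smooth_on (ball s0 r) v"
    "\<And>s. s \<in> ball s0 r \<Longrightarrow> lie_form (v s) (v s) = 0"
    "v s0 \<noteq> 0" "lie_form (vd v s0) (vd v s0) > 0"
    "\<And>s t. s \<in> ball s0 r \<Longrightarrow> t \<in> ball t0 r \<Longrightarrow> lie_form (U (s, t)) (v s) = 0"
    "\<And>s t. s \<in> ball s0 r \<Longrightarrow> t \<in> ball t0 r \<Longrightarrow> \<exists>k l. d1 U (s, t) = k *\<^sub>R U (s, t) + l *\<^sub>R v s"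
    "\<And>s t. s \<in> ball s0 r \<Longrightarrow> t \<in> ball t0 r \<Longrightarrow> \<exists>c. c \<noteq> 0 \<and> V (s, t) = c *\<^sub>R v s"
proof -
  interpret lie: bounded_bilinear lie_form by (rule bounded_bilinear_lie_form)
  have cs: "curvature_spheres S U V" using can by (simp add: canal_surface_def)
  then have S: "open S" and sm: "smooth_on S U" "smooth_on S V"
    and pt: "\<And>x. x \<in> S \<Longrightarrow> lie_form (U x) (U x) = 0 \<and> lie_form (U x) (V x) = 0 \<and> lie_form (V x) (V x) = 0 \<and>
        d1 U x \<in> span {U x, V x} \<and> d2 V x \<in> span {U x, V x} \<and>
        distinct [U x, V x, d2 U x, d1 V x] \<and> independent {U x, V x, d2 U x, d1 V x}"
    by (simp_all add: curvature_spheres_def)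
  obtain A B where AB: "open A" "open B" "s0 \<in> A" "t0 \<in> B" "A \<times> B \<subseteq> S"
    using S x0 by (rule open_prod_elim) auto
  obtain ra where ra: "ra > 0" "ball s0 ra \<subseteq> A" using AB open_contains_ball by metis
  obtain rb where rb: "rb > 0" "ball t0 rb \<subseteq> B" using AB open_contains_ball by metis
  define r where "r = min ra rb"
  have r: "r > 0" using ra rb by (simp add: r_def)
  have box: "ball s0 r \<times> ball t0 r \<subseteq> S"
    using AB(5) ra(2) rb(2) by (fastforce simp: r_def)
  have inS: "(s, t) \<in> S" if "s \<in> ball s0 r" "t \<in> ball t0 r" for s t using box that by blast
  have s0: "s0 \<in> ball s0 r" and t0: "t0 \<in> ball t0 r" using r by simp_all
  have sl: "smooth_on (ball s0 r) (\<lambda>s. (s, t0))"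
    by (intro smooth_on_Pair smooth_on_const smooth_on_linear open_ball bounded_linear_ident)
  have "(\<lambda>s. (s, t0)) ` ball s0 r \<subseteq> S" using inS t0 by blast
  note slice = smooth_on_compose_plane[OF open_ball S this _ sl]
  have smv: "smooth_on (ball s0 r) v" unfolding v_def by (rule slice[OF sm(2)])
  have smu: "smooth_on (ball s0 r) (\<lambda>s. U (s, t0))" by (rule slice[OF sm(1)])
  have scale: "\<exists>c. c \<noteq> 0 \<and> V (s, t) = c *\<^sub>R v s" if "s \<in> ball s0 r" "t \<in> ball t0 r" for s t
  proof -
    \<comment> \<open>\<open>canal_surface\<close> compares spheres along segments inside
      \<open>S\<close>; in a box the segment from \<open>t\<close> to \<open>t0\<close>
      qualifies.\<close>
    have "closed_segment t t0 \<subseteq> ball t0 r" using that(2) t0 by (simp add: closed_segment_subset)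
    then have "{s} \<times> closed_segment t t0 \<subseteq> S" using inS[OF that(1)] by blast
    then show ?thesis using can unfolding canal_surface_def same_sphere_def v_def by blast
  qed
  have Uv: "lie_form (U (s, t)) (v s) = 0" if "s \<in> ball s0 r" "t \<in> ball t0 r" for s t
  proof -
    note st = that
    obtain c where "c \<noteq> 0" "V (s, t) = c *\<^sub>R v s" using scale[OF st] by blast
    then show ?thesis using pt[OF inS[OF st]] by (simp add: lie.scaleR_right)
  qed
  have dU: "\<exists>k l. d1 U (s, t) = k *\<^sub>R U (s, t) + l *\<^sub>R v s" if "s \<in> ball s0 r" "t \<in> ball t0 r" for s t
  proof -
    note st = that
    obtain c where c: "V (s, t) = c *\<^sub>R v s" using scale[OF st] by blast
    obtain k l where "d1 U (s, t) = k *\<^sub>R U (s, t) + l *\<^sub>R V (s, t)"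
      using span_pair pt[OF inS[OF st]] by blast
    then show ?thesis unfolding c by (metis scaleR_scaleR)
  qed
  have nullv: "lie_form (v s) (v s) = 0" if "s \<in> ball s0 r" for s
    using pt[OF inS[OF that t0]] by (simp add: v_def)
  have ind: "distinct [U (s0, t0), v s0, d2 U (s0, t0), vd v s0]"
    "independent {U (s0, t0), v s0, d2 U (s0, t0), vd v s0}"
    using pt[OF x0] by (simp_all add: v_def d1_def)
  have v0: "v s0 \<noteq> 0"
  proof
    assume "v s0 = 0"
    then have "0 \<in> {U (s0, t0), v s0, d2 U (s0, t0), vd v s0}" by simp
    then have "dependent {U (s0, t0), v s0, d2 U (s0, t0), vd v s0}" by (rule dependent_zero)
    then show False using ind(2) by contradiction
  qed
  have vv': "lie_form (v s0) (vd v s0) = 0"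
  proof -
    have "vd (\<lambda>s. lie_form (v s) (v s)) s0 = 0" by (rule vd_zero[OF open_ball s0 nullv])
    then have "lie_form (v s0) (vd v s0) + lie_form (vd v s0) (v s0) = 0"
      unfolding vd_bilinear[OF bounded_bilinear_lie_form smv smv s0] .
    then show ?thesis unfolding lie_form_commute[of "vd v s0" "v s0"] by simp
  qed
  obtain k l where kl: "d1 U (s0, t0) = k *\<^sub>R U (s0, t0) + l *\<^sub>R v s0" using dU[OF s0 t0] by blast
  then have "vd (\<lambda>s. U (s, t0)) s0 = k *\<^sub>R U (s0, t0) + l *\<^sub>R v s0" by (simp add: d1_def)
  then have Uv': "lie_form (U (s0, t0)) (vd v s0) = 0"
  proof -
    assume dU0: "vd (\<lambda>s. U (s, t0)) s0 = k *\<^sub>R U (s0, t0) + l *\<^sub>R v s0"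
    have "vd (\<lambda>s. lie_form (U (s, t0)) (v s)) s0 = 0"
      by (rule vd_zero[OF open_ball s0 Uv[OF _ t0]])
    then have "lie_form (U (s0, t0)) (vd v s0) + lie_form (vd (\<lambda>s. U (s, t0)) s0) (v s0) = 0"
      unfolding vd_bilinear[OF bounded_bilinear_lie_form smu smv s0] .
    then show ?thesis
      unfolding dU0 lie.add_left lie.scaleR_left nullv[OF s0] Uv[OF s0 t0] by simp
  qed
  have pos: "lie_form (vd v s0) (vd v s0) > 0"
  proof (rule lie_form_pos)
    show "lie_form (U (s0, t0)) (U (s0, t0)) = 0" using pt[OF x0] by simp
    show "distinct [U (s0, t0), v s0, vd v s0]" using ind(1) by simp
    show "independent {U (s0, t0), v s0, vd v s0}" using ind(2) by (rule independent_mono) auto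
  qed (use Uv[OF s0 t0] nullv[OF s0] Uv' vv' in auto)
  show thesis by (rule that[OF r box smv nullv v0 pos Uv dU scale])
qed

text \<open>The nonzero product says that the affine parameter of \<open>U\<close> on the conic is
  finite at the base point. Otherwise the swapped lift is taken: if both failed,
  \<open>touching_null_vector\<close> would give \<open>U = 0\<close>.\<close>

lemma canal_surface_spin_curve:
  assumes can: "canal_surface S U V" and x0: "(s0, t0) \<in> S"
    and v_def: "v = (\<lambda>s. V (s, t0))"
  obtains e X Y where "e > 0" "ball s0 e \<times> ball t0 e \<subseteq> S"
    "spin_curve (ball s0 e) v X Y"
    "bil6 (cvec6 (U (s0, t0))) (wedge (Y s0) (vd Y s0)) \<noteq> 0"
    "\<And>s t. s \<in> ball s0 e \<Longrightarrow> t \<in> ball t0 e \<Longrightarrow> lie_form (U (s, t)) (v s) = 0"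
    "\<And>s t. s \<in> ball s0 e \<Longrightarrow> t \<in> ball t0 e \<Longrightarrow> \<exists>k l. d1 U (s, t) = k *\<^sub>R U (s, t) + l *\<^sub>R v s"
    "\<And>s t. s \<in> ball s0 e \<Longrightarrow> t \<in> ball t0 e \<Longrightarrow> \<exists>c. c \<noteq> 0 \<and> V (s, t) = c *\<^sub>R v s"
proof -
  obtain r where r: "r > 0" "ball s0 r \<times> ball t0 r \<subseteq> S" "smooth_on (ball s0 r) v"
    "\<And>s. s \<in> ball s0 r \<Longrightarrow> lie_form (v s) (v s) = 0"
    "v s0 \<noteq> 0" "lie_form (vd v s0) (vd v s0) > 0"
    "\<And>s t. s \<in> ball s0 r \<Longrightarrow> t \<in> ball t0 r \<Longrightarrow> lie_form (U (s, t)) (v s) = 0"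
    "\<And>s t. s \<in> ball s0 r \<Longrightarrow> t \<in> ball t0 r \<Longrightarrow> \<exists>k l. d1 U (s, t) = k *\<^sub>R U (s, t) + l *\<^sub>R v s"
    "\<And>s t. s \<in> ball s0 r \<Longrightarrow> t \<in> ball t0 r \<Longrightarrow> \<exists>c. c \<noteq> 0 \<and> V (s, t) = c *\<^sub>R v s"
    by (rule canal_surface_box[OF can x0 v_def]) (assumption | rule that)+
  have s0r: "s0 \<in> ball s0 r" using r(1) by simp
  obtain e' X Y where X: "e' > 0" "ball s0 e' \<subseteq> ball s0 r" "smooth_on (ball s0 e') X" "smooth_on (ball s0 e') Y"
    "\<And>s. s \<in> ball s0 e' \<Longrightarrow> normalized_frame (X s) (vd X s) (Y s) (vd Y s)"
    "\<And>s. s \<in> ball s0 e' \<Longrightarrow> herm4 (vd (vd X) s) (X s) = 0 \<and> herm4 (vd (vd X) s) (Y s) = 0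
       \<and> herm4 (vd (vd Y) s) (X s) = 0 \<and> herm4 (vd (vd Y) s) (Y s) = 0"
    "\<And>s. s \<in> ball s0 e' \<Longrightarrow> \<exists>k. wedge (X s) (Y s) = k *s cvec6 (v s)"
    by (rule spin_lift[OF open_ball s0r r(3-6)]) (assumption | rule that)+
  define e where "e = min e' r"
  have e: "e > 0" "ball s0 e \<subseteq> ball s0 e'" "ball s0 e \<subseteq> ball s0 r" "ball t0 e \<subseteq> ball t0 r"
    using X(1) r(1) by (auto simp: e_def)
  have s0: "s0 \<in> ball s0 e" using e by simp
  have spin: "spin_curve (ball s0 e) v X Y"
    unfolding spin_curve_def
    using smooth_on_subset[OF X(3) e(2)] smooth_on_subset[OF X(4) e(2)] X(5-7) subsetD[OF e(2)] by blast
  have box: "ball s0 e \<times> ball t0 e \<subseteq> S" using r(2) e(3,4) by blast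
  have t0: "t0 \<in> ball t0 r" using r(1) by simp
  note rest = r(7-9)[OF subsetD[OF e(3)] subsetD[OF e(4)]]
  have cs: "curvature_spheres S U V" using can by (simp add: canal_surface_def)
  have "\<exists>X Y. spin_curve (ball s0 e) v X Y \<and> bil6 (cvec6 (U (s0, t0))) (wedge (Y s0) (vd Y s0)) \<noteq> 0"
  proof (rule ccontr)
    assume not: "\<not> ?thesis"
    have "bil6 (cvec6 (U (s0, t0))) (wedge (Y s0) (vd Y s0)) = 0" using not spin by blast
    moreover have "bil6 (cvec6 (U (s0, t0))) (wedge (- X s0) (vd (\<lambda>s. - X s) s0)) = 0"
      using not spin_curve_swap[OF open_ball spin] by blast
    moreover have "vd (\<lambda>s. - X s) s0 = - vd X s0"
      using spin s0 by (intro vd_linear[OF bounded_linear_minus[OF bounded_linear_ident]]) (auto simp: spin_curve_def)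
    moreover have "wedge (- X s0) (- vd X s0) = wedge (X s0) (vd X s0)"
      by (rule vec6_eqI) (elim insertE emptyE; simp add: wedge_components)
    ultimately have 0: "bil6 (cvec6 (U (s0, t0))) (wedge (Y s0) (vd Y s0)) = 0"
      "bil6 (cvec6 (U (s0, t0))) (wedge (X s0) (vd X s0)) = 0" by simp_all
    have S: "open S" and smU: "smooth_on S U" using cs by (simp_all add: curvature_spheres_def)
    have "smooth_on (ball s0 e) (\<lambda>s. (s, t0))"
      by (intro smooth_on_Pair smooth_on_const smooth_on_linear open_ball bounded_linear_ident)
    moreover have "(\<lambda>s. (s, t0)) ` ball s0 e \<subseteq> S" using box e(1) by auto
    ultimately have smu: "smooth_on (ball s0 e) (\<lambda>s. U (s, t0))"
      using smooth_on_compose_plane[OF open_ball S _ smU] by blast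
    have smcu: "smooth_on (ball s0 e) (\<lambda>s. cvec6 (U (s, t0)))"
      by (rule smooth_on_bounded_linear[OF open_ball bounded_linear_cvec6 smu])
    have t0e: "t0 \<in> ball t0 e" using e(1) by simp
    have du: "\<exists>k l. vd (\<lambda>s. cvec6 (U (s, t0))) s = k *s cvec6 (U (s, t0)) + l *s cvec6 (v s)" if "s \<in> ball s0 e" for s
    proof -
      obtain k l where "d1 U (s, t0) = k *\<^sub>R U (s, t0) + l *\<^sub>R v s" using rest(2)[OF \<open>s \<in> ball s0 e\<close> t0e] by blast
      then have "vd (\<lambda>s. cvec6 (U (s, t0))) s = of_real k *s cvec6 (U (s, t0)) + of_real l *s cvec6 (v s)"
        using vd_linear[OF bounded_linear_cvec6 smu that] by (simp add: d1_def cvec6_def vec_eq_iff)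
      then show ?thesis by blast
    qed
    have null: "bil6 (cvec6 (U (s, t0))) (cvec6 (v s)) = 0" if "s \<in> ball s0 e" for s
      using rest(1)[OF that t0e] by (simp add: bil6_cvec6)
    have nf: "normalized_frame (X s0) (vd X s0) (Y s0) (vd Y s0)" using spin s0 by (auto simp: spin_curve_def)
    have "bil6 (cvec6 (U (s0, t0))) (cvec6 (U (s0, t0))) = 0"
      using cs x0 by (simp add: bil6_cvec6 curvature_spheres_def)
    from touching_null_vector(3)[OF nf spin_curve_coordinates(1-3)[OF open_ball spin smcu null du s0] this 0]
    have "U (s0, t0) = 0" by (simp add: cvec6_def vec_eq_iff)
    then have "0 \<in> {U (s0, t0), V (s0, t0), d2 U (s0, t0), d1 V (s0, t0)}" by simp
    moreover have "independent {U (s0, t0), V (s0, t0), d2 U (s0, t0), d1 V (s0, t0)}"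
      using cs x0 unfolding curvature_spheres_def by blast
    ultimately show False using dependent_zero[of "{U (s0, t0), V (s0, t0), d2 U (s0, t0), d1 V (s0, t0)}"] by argo
  qed
  then show thesis using that[OF e(1) box _ _ rest] by blast
qed

lemma diffeo_on_reparametrization:
  fixes f :: "real \<Rightarrow> real"
  assumes I: "open I" and J: "open J" "connected J" and f: "smooth_on J f"
    and nz: "\<And>t. t \<in> J \<Longrightarrow> vd f t \<noteq> 0"
  defines "\<phi> \<equiv> \<lambda>x. (fst x, inv_into J f (snd x)) :: real \<times> real"
  shows "diffeo_on (I \<times> f ` J) \<phi>" "\<phi> ` (I \<times> f ` J) = I \<times> J"
proof -
  note inv = smooth_inverse_function[OF J f nz]
  have O: "open (I \<times> f ` J)" "open (I \<times> J)" using I J(1) inv(2) by (auto intro: open_Times)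
  show im: "\<phi> ` (I \<times> f ` J) = I \<times> J"
  proof (intro equalityI subsetI)
    fix y assume "y \<in> I \<times> J"
    then have y: "fst y \<in> I" "snd y \<in> J" by auto
    have "\<phi> (fst y, f (snd y)) = y" by (simp add: \<phi>_def inv_into_f_f[OF inv(1) y(2)])
    moreover have "(fst y, f (snd y)) \<in> I \<times> f ` J" using y by simp
    ultimately show "y \<in> \<phi> ` (I \<times> f ` J)" by (metis imageI)
  qed (auto simp: \<phi>_def inv_into_into)
  have inj: "inj_on \<phi> (I \<times> f ` J)"
  proof (rule inj_onI, clarify)
    fix a b c d assume J: "b \<in> J" "d \<in> J" and eq: "\<phi> (a, f b) = \<phi> (c, f d)"
    have "\<phi> (a, f b) = (a, b)" "\<phi> (c, f d) = (c, d)"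
      by (simp_all add: \<phi>_def inv_into_f_f[OF inv(1)] J)
    with eq show "a = c \<and> f b = f d" by simp
  qed
  have "smooth_on (I \<times> f ` J) (\<lambda>x. inv_into J f (snd x))"
    by (rule smooth_on_compose_linear[OF bounded_linear_snd O(1) inv(2) _ inv(4)]) auto
  then have sm: "smooth_on (I \<times> f ` J) \<phi>"
    unfolding \<phi>_def by (rule smooth_on_Pair[OF O(1) smooth_on_linear[OF O(1) bounded_linear_fst]])
  have "smooth_on (I \<times> J) (\<lambda>x. f (snd x))"
    by (rule smooth_on_compose_linear[OF bounded_linear_snd O(2) J(1) _ f]) auto
  then have "smooth_on (I \<times> J) (\<lambda>x. (fst x, f (snd x)))"
    by (rule smooth_on_Pair[OF O(2) smooth_on_linear[OF O(2) bounded_linear_fst]])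
  moreover have "inv_into (I \<times> f ` J) \<phi> y = (fst y, f (snd y))" if "y \<in> I \<times> J" for y
    using that inv(1) by (intro inv_into_f_eq[OF inj]) (auto simp: \<phi>_def)
  ultimately have "smooth_on (I \<times> J) (inv_into (I \<times> f ` J) \<phi>)"
    using smooth_on_cong[OF O(2), of "inv_into (I \<times> f ` J) \<phi>" "\<lambda>x. (fst x, f (snd x))"] by blast
  then show "diffeo_on (I \<times> f ` J) \<phi>"
    unfolding diffeo_on_def im using O inj sm by blast
qed

text \<open>The affine parameter of the second family on the conic does not depend on the first coordinate
  and serves as the new second coordinate.\<close>

lemma canal_surface_conic_parameter:
  assumes can: "canal_surface S U V" and x0: "(s0, t0) \<in> S"
  obtains I J X Y \<tau> where "open I" "convex I" "s0 \<in> I" "open J" "connected J" "t0 \<in> J" "I \<times> J \<subseteq> S"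
    "spin_curve I (\<lambda>s. V (s, t0)) X Y" "smooth_on J \<tau>" "\<And>t. t \<in> J \<Longrightarrow> vd \<tau> t \<noteq> 0"
    "\<And>s t. s \<in> I \<Longrightarrow> t \<in> J \<Longrightarrow> \<exists>c. cvec6 (U (s, t)) = c *s wedge (X s + \<tau> t *\<^sub>R Y s) (vd X s + \<tau> t *\<^sub>R vd Y s)"
    "\<And>s t. s \<in> I \<Longrightarrow> t \<in> J \<Longrightarrow> \<exists>c. c \<noteq> 0 \<and> V (s, t) = c *\<^sub>R V (s, t0)"
proof -
  define v where "v = (\<lambda>s. V (s, t0))"
  obtain e X Y where e: "e > 0" "ball s0 e \<times> ball t0 e \<subseteq> S"
    "spin_curve (ball s0 e) v X Y"
    "bil6 (cvec6 (U (s0, t0))) (wedge (Y s0) (vd Y s0)) \<noteq> 0"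
    "\<And>s t. s \<in> ball s0 e \<Longrightarrow> t \<in> ball t0 e \<Longrightarrow> lie_form (U (s, t)) (v s) = 0"
    "\<And>s t. s \<in> ball s0 e \<Longrightarrow> t \<in> ball t0 e \<Longrightarrow> \<exists>k l. d1 U (s, t) = k *\<^sub>R U (s, t) + l *\<^sub>R v s"
    "\<And>s t. s \<in> ball s0 e \<Longrightarrow> t \<in> ball t0 e \<Longrightarrow> \<exists>c. c \<noteq> 0 \<and> V (s, t) = c *\<^sub>R v s"
    by (rule canal_surface_spin_curve[OF can x0 v_def]) (assumption | rule that)+
  let ?B = "ball s0 e" and ?C = "ball t0 e"
  have cs: "curvature_spheres S U V" using can by (simp add: canal_surface_def)
  then have S: "open S" and smU: "smooth_on S U"
    and Unull: "\<And>x. x \<in> S \<Longrightarrow> lie_form (U x) (U x) = 0"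
    and ind: "distinct [U (s0, t0), V (s0, t0), d2 U (s0, t0), d1 V (s0, t0)] \<and>
      independent {U (s0, t0), V (s0, t0), d2 U (s0, t0), d1 V (s0, t0)}"
    using x0 by (simp_all add: curvature_spheres_def)
  have O: "open (?B \<times> ?C)" by (simp add: open_Times)
  define u where "u = (\<lambda>x. cvec6 (U x))"
  have smu: "smooth_on S u"
    unfolding u_def by (rule smooth_on_bounded_linear[OF S bounded_linear_cvec6 smU])
  have smX: "smooth_on ?B X" "smooth_on ?B Y" using e(3) by (auto simp: spin_curve_def)
  have nf: "normalized_frame (X s) (vd X s) (Y s) (vd Y s)" if "s \<in> ?B" for s
    using e(3) that by (auto simp: spin_curve_def)
  note sm1 = smooth_on_vector_derivative[OF open_ball]
  \<comment> \<open>With these coordinates \<open>d / f\<close> is the affine parameter of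
    \<open>U\<close> on the conic, as in \<open>touching_null_vector\<close>.\<close>
  define f where "f = (\<lambda>x. bil6 (u x) (wedge (Y (fst x)) (vd Y (fst x))))"
  define d where "d = (\<lambda>x. bil6 (u x) (wedge (vd X (fst x)) (Y (fst x))))"
  have lift: "smooth_on (?B \<times> ?C) (\<lambda>x. g (fst x))" if "smooth_on ?B g" for g :: "real \<Rightarrow> complex^4"
    by (rule smooth_on_fst_curve[OF open_ball that O]) auto
  note bs = bounded_bilinear.smooth_on[OF bounded_bilinear_bil6 O]
    and ws = bounded_bilinear.smooth_on[OF bounded_bilinear_wedge O]
  have smf: "smooth_on (?B \<times> ?C) f" "smooth_on (?B \<times> ?C) d"
    unfolding f_def d_def
    by (rule bs[OF smooth_on_subset[OF smu e(2)] ws[OF lift[OF smX(2)] lift[OF sm1[OF smX(2)]]]]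
        bs[OF smooth_on_subset[OF smu e(2)] ws[OF lift[OF sm1[OF smX(1)]] lift[OF smX(2)]]])+
  have slice1: "smooth_on A (\<lambda>s. g (s, t))" if "smooth_on R g" "open R" "open A" "A \<times> {t} \<subseteq> R"
    for g :: "real \<times> real \<Rightarrow> 'b::real_normed_vector" and A R t
  proof -
    have "smooth_on A (\<lambda>s. (s, t))"
      by (intro smooth_on_Pair smooth_on_const smooth_on_linear that(3) bounded_linear_ident)
    then show ?thesis using that(4) by (intro smooth_on_compose_plane[OF that(3,2) _ that(1)]) auto
  qed
  have slice2: "smooth_on A (\<lambda>t. g (s, t))" if "smooth_on R g" "open R" "open A" "{s} \<times> A \<subseteq> R"
    for g :: "real \<times> real \<Rightarrow> 'b::real_normed_vector" and A R s
  proof -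
    have "smooth_on A (\<lambda>t. (s, t))"
      by (intro smooth_on_Pair smooth_on_const smooth_on_linear that(3) bounded_linear_ident)
    then show ?thesis using that(4) by (intro smooth_on_compose_plane[OF that(3,2) _ that(1)]) auto
  qed
  have coords: "bil6 (u (s, t)) (wedge (X s) (Y s)) = 0"
    "bil6 (u (s, t)) (wedge (X s) (vd Y s) + wedge (vd X s) (Y s)) = 0"
    "bil6 (u (s, t)) (wedge (vd X s) (vd Y s)) = 0"
    "\<exists>k. vd (\<lambda>s. f (s, t)) s = k * f (s, t) \<and> vd (\<lambda>s. d (s, t)) s = k * d (s, t)" (is ?D)
    if st: "s \<in> ?B" "t \<in> ?C" for s t
  proof -
    have sub: "?B \<times> {t} \<subseteq> S" using e(2) st(2) by auto
    have smut: "smooth_on ?B (\<lambda>s. u (s, t))" by (rule slice1[OF smu S open_ball sub])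
    have null: "bil6 (u (s, t)) (cvec6 (v s)) = 0" if "s \<in> ?B" for s
      using e(5)[OF that st(2)] by (simp add: u_def bil6_cvec6)
    have du: "\<exists>k l. vd (\<lambda>s. u (s, t)) s = k *s u (s, t) + l *s cvec6 (v s)" if s: "s \<in> ?B" for s
    proof -
      obtain k l where "d1 U (s, t) = k *\<^sub>R U (s, t) + l *\<^sub>R v s" using e(6)[OF s st(2)] by blast
      then have "vd (\<lambda>s. u (s, t)) s = of_real k *s u (s, t) + of_real l *s cvec6 (v s)"
        using vd_linear[OF bounded_linear_cvec6 slice1[OF smU S open_ball sub] s]
        by (simp add: u_def d1_def cvec6_def vec_eq_iff)
      then show ?thesis by blast
    qed
    note c = spin_curve_coordinates[OF open_ball e(3) smut null du st(1)]
    show "bil6 (u (s, t)) (wedge (X s) (Y s)) = 0" by (rule c(1))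
    show "bil6 (u (s, t)) (wedge (X s) (vd Y s) + wedge (vd X s) (Y s)) = 0" by (rule c(2))
    show "bil6 (u (s, t)) (wedge (vd X s) (vd Y s)) = 0" by (rule c(3))
    show ?D using c(4) by (simp add: f_def d_def)
  qed
  define Q where "Q = {x \<in> ?B \<times> ?C. f x \<noteq> 0}"
  have "Q = (?B \<times> ?C) \<inter> f -` (- {0})" by (auto simp: Q_def)
  then have Q: "open Q"
    using continuous_on_open_vimage[OF O, THEN iffD1, OF smooth_on_imp_continuous_on[OF smf(1)]]
    by (auto simp: open_Compl Int_commute)
  have "(s0, t0) \<in> Q" using e(1,4) by (simp add: Q_def f_def u_def)
  with Q obtain A C where AC: "open A" "open C" "s0 \<in> A" "t0 \<in> C" "A \<times> C \<subseteq> Q"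
    by (rule open_prod_elim) auto
  obtain r1 where r1: "r1 > 0" "ball s0 r1 \<subseteq> A" using AC open_contains_ball by metis
  obtain r2 where r2: "r2 > 0" "ball t0 r2 \<subseteq> C" using AC open_contains_ball by metis
  define I where "I = ball s0 r1"
  define L where "L = ball t0 r2"
  have I: "open I" "convex I" "s0 \<in> I" and L: "open L" "t0 \<in> L" using r1 r2 by (simp_all add: I_def L_def)
  have IL: "I \<times> L \<subseteq> Q" using AC(5) r1(2) r2(2) by (auto simp: I_def L_def)
  have inQ: "s \<in> ?B" "t \<in> ?C" "f (s, t) \<noteq> 0" if "s \<in> I" "t \<in> L" for s t
    using IL that by (auto simp: Q_def)
  have IB: "I \<subseteq> ?B" and LC: "L \<subseteq> ?C" using inQ L(2) I(3) by auto
  define T where "T = (\<lambda>x. d x / f x)"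
  have OIL: "open (I \<times> L)" using I L by (simp add: open_Times)
  have ILsub: "I \<times> L \<subseteq> ?B \<times> ?C" using inQ by auto
  note smfI = smooth_on_subset[OF smf(1) ILsub] smooth_on_subset[OF smf(2) ILsub]
  have smT: "smooth_on (I \<times> L) T"
    unfolding T_def by (rule smooth_on_divide[OF OIL smfI(2,1)]) (use inQ in auto)
  \<comment> \<open>Along the first coordinate \<open>f\<close> and \<open>d\<close> satisfy the
    same equation with the same factor \<open>k\<close>, so their quotient is constant; this is read
    off by differentiating \<open>d = T * f\<close>.\<close>
  have Tconst: "T (s, t) = T (s0, t)" if st: "s \<in> I" "t \<in> L" for s t
  proof (rule vd_zero_constant[OF I(2) _ _ I(3) st(1)])
    have sub: "I \<times> {t} \<subseteq> I \<times> L" using st by auto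
    note sl = slice1[OF smT OIL I(1) sub] slice1[OF smfI(1) OIL I(1) sub]
    show "smooth_on I (\<lambda>s. T (s, t))" by (rule sl(1))
    fix r assume r: "r \<in> I"
    obtain k where k: "vd (\<lambda>s. f (s, t)) r = k * f (r, t)" "vd (\<lambda>s. d (s, t)) r = k * d (r, t)"
      using coords(4) inQ[OF r st(2)] by blast
    have "vd (\<lambda>s. d (s, t)) r = vd (\<lambda>s. T (s, t) * f (s, t)) r"
      by (rule vd_cong[OF I(1) r]) (use inQ st in \<open>simp add: T_def\<close>)
    then have "k * d (r, t) = T (r, t) * (k * f (r, t)) + vd (\<lambda>s. T (s, t)) r * f (r, t)"
      unfolding k(2) vd_bilinear[OF bounded_bilinear_mult sl r] k(1) .
    moreover have "T (r, t) * (k * f (r, t)) = k * d (r, t)"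
      using inQ(3)[OF r st(2)] by (simp add: T_def)
    ultimately show "vd (\<lambda>s. T (s, t)) r = 0"
      using inQ(3)[OF r st(2)] by simp
  qed
  \<comment> \<open>\<open>T\<close> is complex-valued only in type:
    \<open>touching_parameter_real\<close> shows that its values are real.\<close>
  define \<tau> where "\<tau> = (\<lambda>t. Re (T (s0, t)))"
  have smT0: "smooth_on L (\<lambda>t. T (s0, t))" by (rule slice2[OF smT OIL L(1)]) (use I(3) in auto)
  have sm\<tau>: "smooth_on L \<tau>"
    unfolding \<tau>_def by (rule smooth_on_bounded_linear[OF L(1) bounded_linear_Re smT0])
  have Treal: "T (s, t) = of_real (\<tau> t)" if st: "s \<in> I" "t \<in> L" for s t
    using touching_parameter_real[OF nf[OF inQ(1)[OF I(3) st(2)]] _ coords(2)[OF inQ(1,2)[OF I(3) st(2)]]]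
    unfolding Tconst[OF st] by (simp add: \<tau>_def T_def f_def d_def u_def cnj6_cvec6)
  have uform: "u (s, t) = (2 * f (s, t)) *s wedge (X s + T (s, t) *s Y s) (vd X s + T (s, t) *s vd Y s)"
    if st: "s \<in> I" "t \<in> L" for s t
  proof -
    have "(s, t) \<in> S" using inQ[OF st] e(2) by blast
    then have "bil6 (u (s, t)) (u (s, t)) = 0" using Unull by (simp add: u_def bil6_cvec6)
    note tn = touching_null_vector(2)[OF nf[OF inQ(1)[OF st]] coords(1-3)[OF inQ(1,2)[OF st]] this, of "T (s, t)"]
    then show ?thesis using inQ(3)[OF st] by (simp add: f_def T_def d_def)
  qed
  \<comment> \<open>At a critical point of the parameter \<open>d2 U\<close> would be a multiple of
    \<open>U\<close>, contrary to the immersion condition.\<close>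
  have d\<tau>: "vd \<tau> t0 \<noteq> 0"
  proof
    assume 0: "vd \<tau> t0 = 0"
    have "vd (\<lambda>t. T (s0, t)) t0 = vd (\<lambda>t. complex_of_real (\<tau> t)) t0"
      by (rule vd_cong[OF L]) (rule Treal[OF I(3)])
    also have "\<dots> = 0"
      unfolding vd_linear[OF bounded_linear_of_real sm\<tau> L(2)] 0 by simp
    finally have T0: "vd (\<lambda>t. T (s0, t)) t0 = 0" .
    have lin: "bounded_linear (\<lambda>c. c *s y)" for y :: "complex^4"
      by (rule bounded_bilinear.bounded_linear_left[OF bounded_bilinear_smult])
    have smy: "smooth_on L (\<lambda>t. x + T (s0, t) *s y)" for x y :: "complex^4"
      by (rule smooth_on_add[OF L(1) smooth_on_const[OF L(1)] smooth_on_bounded_linear[OF L(1) lin smT0]])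
    have dy: "vd (\<lambda>t. x + T (s0, t) *s y) t0 = 0" for x y :: "complex^4"
      unfolding vd_add[OF smooth_on_const[OF L(1)] smooth_on_bounded_linear[OF L(1) lin smT0] L(2)]
        vd_linear[OF lin smT0 L(2)] T0 by simp
    define F where "F = (\<lambda>t. 2 * f (s0, t))"
    define G where "G = (\<lambda>t. wedge (X s0 + T (s0, t) *s Y s0) (vd X s0 + T (s0, t) *s vd Y s0))"
    have smG: "smooth_on L G"
      unfolding G_def by (rule bounded_bilinear.smooth_on[OF bounded_bilinear_wedge L(1) smy smy])
    have smF: "smooth_on L F"
      unfolding F_def by (rule smooth_on_mult[OF L(1) smooth_on_const[OF L(1)] slice2[OF smfI(1) OIL L(1)]])
        (use I(3) in auto)
    have dG: "vd G t0 = 0"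
      unfolding G_def vd_bilinear[OF bounded_bilinear_wedge smy smy L(2)] dy
      by (simp add: bounded_bilinear.zero_left[OF bounded_bilinear_wedge] bounded_bilinear.zero_right[OF bounded_bilinear_wedge])
    have sub: "{s0} \<times> L \<subseteq> S" using inQ[OF I(3)] e(2) by auto
    have "cvec6 (d2 U (s0, t0)) = vd (\<lambda>t. u (s0, t)) t0"
      using vd_linear[OF bounded_linear_cvec6 slice2[OF smU S L(1) sub] L(2)] by (simp add: u_def d2_def)
    also have "\<dots> = vd (\<lambda>t. F t *s G t) t0"
      by (rule vd_cong[OF L]) (simp add: uform[OF I(3)] F_def G_def)
    also have "\<dots> = vd F t0 *s G t0"
      unfolding vd_bilinear[OF bounded_bilinear_smult smF smG L(2)] dG by (simp add: vec_eq_iff)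
    also have "\<dots> = (vd F t0 / F t0) *s u (s0, t0)"
      using uform[OF I(3) L(2)] inQ(3)[OF I(3) L(2)] by (simp add: F_def G_def vec_eq_iff)
    finally obtain c where "cvec6 (d2 U (s0, t0)) = c *s cvec6 (U (s0, t0))" by (auto simp: u_def)
    from cvec6_smult_real[OF this cnj6_cvec6]
    have "d2 U (s0, t0) = Re c *\<^sub>R U (s0, t0)" by (simp add: re6_cvec6)
    then have "Re c *\<^sub>R U (s0, t0) + 0 *\<^sub>R V (s0, t0) + (- 1) *\<^sub>R d2 U (s0, t0) + 0 *\<^sub>R d1 V (s0, t0) = 0" by simp
    then show False using ind[unfolded independent_4_iff] by (metis neg_equal_0_iff_equal zero_neq_one)
  qed
  have cd: "continuous_on L (vd \<tau>)"
    by (rule smooth_on_imp_continuous_on[OF smooth_on_vector_derivative[OF L(1) sm\<tau>]])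
  have "open (L \<inter> vd \<tau> -` (- {0}))"
    using continuous_on_open_vimage[OF L(1), THEN iffD1, OF cd] by (auto simp: open_Compl Int_commute)
  moreover have "t0 \<in> L \<inter> vd \<tau> -` (- {0})" using L(2) d\<tau> by simp
  ultimately obtain r3 where r3: "r3 > 0" "ball t0 r3 \<subseteq> L \<inter> vd \<tau> -` (- {0})"
    using open_contains_ball by metis
  define J where "J = ball t0 r3"
  have JL: "J \<subseteq> L" "\<And>t. t \<in> J \<Longrightarrow> vd \<tau> t \<noteq> 0" using r3(2) by (auto simp: J_def)
  have J: "open J" "connected J" "t0 \<in> J" using r3(1) by (simp_all add: J_def)
  show thesis
  proof (rule that[OF I J _ _ smooth_on_subset[OF sm\<tau> JL(1)] JL(2)])
    show "I \<times> J \<subseteq> S" using ILsub JL(1) e(2) by blast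
    show "spin_curve I (\<lambda>s. V (s, t0)) X Y"
      using e(3) IB smooth_on_subset[OF smX(1) IB] smooth_on_subset[OF smX(2) IB]
      unfolding spin_curve_def v_def by blast
    show "\<exists>c. cvec6 (U (s, t)) = c *s wedge (X s + \<tau> t *\<^sub>R Y s) (vd X s + \<tau> t *\<^sub>R vd Y s)" if "s \<in> I" "t \<in> J" for s t
      using uform[OF that(1) subsetD[OF JL(1) that(2)]] Treal[OF that(1) subsetD[OF JL(1) that(2)]]
      unfolding scaleR_eq_smult by (auto simp: u_def)
    show "\<exists>c. c \<noteq> 0 \<and> V (s, t) = c *\<^sub>R V (s, t0)" if "s \<in> I" "t \<in> J" for s t
      using e(7)[OF subsetD[OF IB that(1)] subsetD[OF LC subsetD[OF JL(1) that(2)]]] by (simp add: v_def)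
  qed
qed

text \<open>With \<open>\<tau>\<close> as second coordinate, the wedge of \<open>\<psi>\<close> and
  \<open>d1 \<psi>\<close> is the conic point of \<open>U\<close>, while the wedge of
  \<open>\<psi>\<close> and \<open>d2 \<psi>\<close> reduces to that of \<open>X\<close> and
  \<open>Y\<close>, which represents \<open>V\<close>.\<close>

lemma canal_surface_normal_form:
  assumes can: "canal_surface S U V" and x0: "x0 \<in> S"
  shows "\<exists>\<Omega> \<phi> p V' W \<psi>. open \<Omega> \<and> connected \<Omega> \<and> diffeo_on \<Omega> \<phi> \<and> x0 \<in> \<phi> ` \<Omega> \<and> \<phi> ` \<Omega> \<subseteq> S \<and>
    curvature_spheres \<Omega> (U \<circ> \<phi>) (V \<circ> \<phi>) \<and> canal_system \<Omega> p V' W \<psi> \<and> normalized_on \<Omega> \<psi> \<and>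
    (\<forall>x\<in>\<Omega>. same_sphere (U (\<phi> x)) (re6 (sphere_U \<psi> x)) \<and> same_sphere (V (\<phi> x)) (re6 (sphere_V \<psi> x)))"
proof -
  obtain s0 t0 where st0: "x0 = (s0, t0)" by (cases x0)
  obtain I J X Y \<tau> where I: "open I" "convex I" "s0 \<in> I" and J: "open J" "connected J" "t0 \<in> J" and IJ: "I \<times> J \<subseteq> S"
    and spin: "spin_curve I (\<lambda>s. V (s, t0)) X Y" and \<tau>: "smooth_on J \<tau>" "\<And>t. t \<in> J \<Longrightarrow> vd \<tau> t \<noteq> 0"
    and Uf: "\<And>s t. s \<in> I \<Longrightarrow> t \<in> J \<Longrightarrow> \<exists>c. cvec6 (U (s, t)) = c *s wedge (X s + \<tau> t *\<^sub>R Y s) (vd X s + \<tau> t *\<^sub>R vd Y s)"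
    and Vf: "\<And>s t. s \<in> I \<Longrightarrow> t \<in> J \<Longrightarrow> \<exists>c. c \<noteq> 0 \<and> V (s, t) = c *\<^sub>R V (s, t0)"
    by (rule canal_surface_conic_parameter[OF can x0[unfolded st0]]) (assumption | rule that)+
  have cs: "curvature_spheres S U V" using can by (simp add: canal_surface_def)
  note inv = smooth_inverse_function[OF J(1,2) \<tau>]
  define K where "K = \<tau> ` J"
  define \<beta> where "\<beta> = inv_into J \<tau>"
  define \<phi> where "\<phi> = (\<lambda>x. (fst x, \<beta> (snd x)) :: real \<times> real)"
  have K: "open K" "connected K" and \<beta>: "smooth_on K \<beta>" using inv(2-4) by (simp_all add: K_def \<beta>_def)
  have diffeo: "diffeo_on (I \<times> K) \<phi>" and im: "\<phi> ` (I \<times> K) = I \<times> J"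
    using diffeo_on_reparametrization[OF I(1) J(1,2) \<tau>] by (simp_all add: K_def \<phi>_def \<beta>_def)
  have d\<beta>: "vd \<beta> r \<noteq> 0" if "r \<in> K" for r
  proof -
    have "inv_into J \<tau> r \<in> J" using that by (simp add: K_def inv_into_into)
    moreover have "vd \<beta> r = inverse (vd \<tau> (inv_into J \<tau> r))"
      using inv(5)[of r] that unfolding K_def \<beta>_def
      by (intro vector_derivative_at) (simp add: has_real_derivative_iff_has_vector_derivative)
    ultimately show ?thesis using \<tau>(2) by simp
  qed
  have "curvature_spheres (I \<times> K) (U \<circ> \<phi>) (V \<circ> \<phi>)"
    unfolding \<phi>_def by (rule curvature_spheres_reparametrized[OF cs I(1) K(1) _ \<beta> d\<beta>])
      (use im IJ in \<open>simp_all add: \<phi>_def\<close>)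
  define \<psi> where "\<psi> = (\<lambda>x. X (fst x) + snd x *\<^sub>R Y (fst x))"
  have sp: "smooth_on I X" "smooth_on I Y" using spin by (auto simp: spin_curve_def)
  have nf: "normalized_frame (X s) (vd X s) (Y s) (vd Y s)" if "s \<in> I" for s
    using spin that by (auto simp: spin_curve_def)
  have par: "herm4 (vd (vd X) s) (X s) = 0 \<and> herm4 (vd (vd X) s) (Y s) = 0 \<and>
      herm4 (vd (vd Y) s) (X s) = 0 \<and> herm4 (vd (vd Y) s) (Y s) = 0" if "s \<in> I" for s
    using spin that by (auto simp: spin_curve_def)
  obtain p V' W where sys: "canal_system (I \<times> K) p V' W \<psi>" "normalized_on (I \<times> K) \<psi>"
    and d\<psi>: "\<And>x. x \<in> I \<times> K \<Longrightarrow> d1 \<psi> x = vd X (fst x) + snd x *\<^sub>R vd Y (fst x)" "\<And>x. d2 \<psi> x = Y (fst x)"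
    by (rule canal_system_of_spin_curve[OF I(1) K(1) sp nf par \<psi>_def]) (assumption | rule that)+
  have spheres: "same_sphere (U (\<phi> x)) (re6 (sphere_U \<psi> x)) \<and> same_sphere (V (\<phi> x)) (re6 (sphere_V \<psi> x))"
    if x: "x \<in> I \<times> K" for x
  proof -
    obtain s r where x_eq: "x = (s, r)" "s \<in> I" "r \<in> K" using x by auto
    define t where "t = \<beta> r"
    have t: "t \<in> J" "\<tau> t = r" using x_eq(3) by (simp_all add: t_def \<beta>_def K_def inv_into_into f_inv_into_f)
    have \<phi>x: "\<phi> x = (s, t)" "(s, t) \<in> S" using x_eq t IJ by (auto simp: \<phi>_def t_def)
    have nfx: "normalized_frame (\<psi> x) (d1 \<psi> x) (d2 \<psi> x) (d1 (d2 \<psi>) x)" using sys(2) x unfolding normalized_on_def by blast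
    have "distinct [U (s, t), V (s, t), d2 U (s, t), d1 V (s, t)] \<and> independent {U (s, t), V (s, t), d2 U (s, t), d1 V (s, t)}"
      using cs \<phi>x(2) by (simp add: curvature_spheres_def)
    then have nz: "U (s, t) \<noteq> 0" "V (s, t) \<noteq> 0"
      using dependent_zero[of "{U (s, t), V (s, t), d2 U (s, t), d1 V (s, t)}"] by auto
    have real: "cnj6 (sphere_U \<psi> x) = sphere_U \<psi> x" "cnj6 (sphere_V \<psi> x) = sphere_V \<psi> x"
      unfolding sphere_U_eq[OF nfx] sphere_V_eq[OF nfx] cnj6_simps cnj6_normalized_frame[OF nfx]
      by (simp_all add: vec_eq_iff)
    obtain c where "cvec6 (U (s, t)) = c *s wedge (X s + \<tau> t *\<^sub>R Y s) (vd X s + \<tau> t *\<^sub>R vd Y s)"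
      using Uf[OF x_eq(2) t(1)] by blast
    then have "cvec6 (U (s, t)) = (c / (2 * \<i>)) *s sphere_U \<psi> x"
      unfolding sphere_U_eq[OF nfx] d\<psi>(1)[OF x] unfolding \<psi>_def x_eq t
      by (simp add: vec_eq_iff) (simp add: algebra_simps)
    \<comment> \<open>Both vectors are real, so the complex factor may be replaced by its real part,
      which is nonzero because \<open>U\<close> is.\<close>
    from cvec6_smult_real[OF this real(1)]
    have 1: "same_sphere (U (s, t)) (re6 (sphere_U \<psi> x))"
      using nz(1) unfolding same_sphere_def by (metis scaleR_zero_left)
    obtain k where k: "wedge (X s) (Y s) = k *s cvec6 (V (s, t0))"
      using spin x_eq(2) by (auto simp: spin_curve_def)
    have "k \<noteq> 0" using wedge_normalized_frame_nonzero[OF nf[OF x_eq(2)]] k by auto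
    obtain c where c: "V (s, t) = c *\<^sub>R V (s, t0)" using Vf[OF x_eq(2) t(1)] by blast
    have "sphere_V \<psi> x = (2 * k) *s cvec6 (V (s, t0))"
      unfolding sphere_V_eq[OF nfx] d\<psi>(2) unfolding \<psi>_def x_eq scaleR_eq_smult wedge_add_left wedge_smult_left
      using k by (simp add: wedge_self vec_eq_iff)
    then have "cvec6 (V (s, t)) = (of_real c / (2 * k)) *s sphere_V \<psi> x"
      using \<open>k \<noteq> 0\<close> by (simp add: c vec_eq_iff cvec6_def)
    from cvec6_smult_real[OF this real(2)]
    have "same_sphere (V (s, t)) (re6 (sphere_V \<psi> x))"
      using nz(2) unfolding same_sphere_def by (metis scaleR_zero_left)
    with 1 show ?thesis by (simp add: \<phi>x)
  qed
  have "open (I \<times> K)" "connected (I \<times> K)"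
    using I K by (auto intro: open_Times connected_Times convex_connected)
  moreover have "x0 \<in> \<phi> ` (I \<times> K)" "\<phi> ` (I \<times> K) \<subseteq> S" using im I(3) J(3) IJ by (simp_all add: st0)
  ultimately show ?thesis
    using diffeo \<open>curvature_spheres (I \<times> K) (U \<circ> \<phi>) (V \<circ> \<phi>)\<close> sys spheres by blast
qed

theorem theorem2:
  shows
    "(\<forall>(\<Omega> :: (real \<times> real) set) (p :: real \<times> real \<Rightarrow> real) V W (\<psi> :: real \<times> real \<Rightarrow> complex^4).
        open \<Omega> \<longrightarrow> connected \<Omega> \<longrightarrow> canal_system \<Omega> p V W \<psi> \<longrightarrow> normalized_on \<Omega> \<psi> \<longrightarrow>
          (\<forall>x\<in>\<Omega>. herm6 (sphere_U \<psi> x) (sphere_U \<psi> x) = 0 \<and> herm6 (sphere_V \<psi> x) (sphere_V \<psi> x) = 0) \<and>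
          (\<forall>x\<in>\<Omega>.
             \<forall>y \<in> {sphere_U \<psi> x, d2 (sphere_U \<psi>) x, d2 (d2 (sphere_U \<psi>)) x}.
             \<forall>z \<in> {sphere_V \<psi> x, d1 (sphere_V \<psi>) x, d1 (d1 (sphere_V \<psi>)) x}. herm6 y z = 0) \<and>
          curvature_spheres \<Omega> (\<lambda>x. re6 (sphere_U \<psi> x)) (\<lambda>x. re6 (sphere_V \<psi> x)) \<and>
          (\<forall>x\<in>\<Omega>. d2 (sphere_V \<psi>) x = 0) \<and>
          canal_surface \<Omega> (\<lambda>x. re6 (sphere_U \<psi> x)) (\<lambda>x. re6 (sphere_V \<psi> x)))
     \<and>
     (\<forall>(\<Omega>\<^sub>0 :: (real \<times> real) set) (U\<^sub>0 :: real \<times> real \<Rightarrow> real^6) V\<^sub>0 x\<^sub>0.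
        canal_surface \<Omega>\<^sub>0 U\<^sub>0 V\<^sub>0 \<longrightarrow> x\<^sub>0 \<in> \<Omega>\<^sub>0 \<longrightarrow>
          (\<exists>(\<Omega> :: (real \<times> real) set) (\<phi> :: real \<times> real \<Rightarrow> real \<times> real)
             (p :: real \<times> real \<Rightarrow> real) V W (\<psi> :: real \<times> real \<Rightarrow> complex^4).
             open \<Omega> \<and> connected \<Omega> \<and> diffeo_on \<Omega> \<phi> \<and> x\<^sub>0 \<in> \<phi> ` \<Omega> \<and> \<phi> ` \<Omega> \<subseteq> \<Omega>\<^sub>0 \<and>
             curvature_spheres \<Omega> (U\<^sub>0 \<circ> \<phi>) (V\<^sub>0 \<circ> \<phi>) \<and>
             canal_system \<Omega> p V W \<psi> \<and> normalized_on \<Omega> \<psi> \<and>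
             (\<forall>x\<in>\<Omega>. same_sphere (U\<^sub>0 (\<phi> x)) (re6 (sphere_U \<psi> x)) \<and>
                    same_sphere (V\<^sub>0 (\<phi> x)) (re6 (sphere_V \<psi> x)))))"
  proof (intro conjI allI impI)
  fix \<Omega> p V W \<psi>
  assume "open \<Omega>" "connected \<Omega>" "canal_system \<Omega> p V W \<psi>" "normalized_on \<Omega> \<psi>"
  note * = this(1,3,4)
  show "\<forall>x\<in>\<Omega>. herm6 (sphere_U \<psi> x) (sphere_U \<psi> x) = 0 \<and> herm6 (sphere_V \<psi> x) (sphere_V \<psi> x) = 0"
    using sphere_null[OF *] by blast
  show "curvature_spheres \<Omega> (\<lambda>x. re6 (sphere_U \<psi> x)) (\<lambda>x. re6 (sphere_V \<psi> x))"
    by (rule curvature_spheres_of_system[OF *])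
  show "\<forall>x\<in>\<Omega>. d2 (sphere_V \<psi>) x = 0"
    using d2_sphere_V[OF *] by blast
  show "canal_surface \<Omega> (\<lambda>x. re6 (sphere_U \<psi> x)) (\<lambda>x. re6 (sphere_V \<psi> x))"
    by (rule canal_surface_of_system[OF *])
  show "\<forall>x\<in>\<Omega>. \<forall>y \<in> {sphere_U \<psi> x, d2 (sphere_U \<psi>) x, d2 (d2 (sphere_U \<psi>)) x}.
      \<forall>z \<in> {sphere_V \<psi> x, d1 (sphere_V \<psi>) x, d1 (d1 (sphere_V \<psi>)) x}. herm6 y z = 0"
    by (intro ballI) (rule sphere_triples_orthogonal[OF *])
qed (rule canal_surface_normal_form)

end
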